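(* Let $1\leq p\leq\infty$, let $\Omega\subset\mathbb{R}^n$ be open, and let $A:L^p(\Omega)\to L^p(\Omega)$ be a bounded linear operator. Let $\alpha_0\in(0,1)$, let $\alpha\in L^\infty(\Omega)$ satisfy $\alpha(x)\in[\alpha_0,1]$ for almost every $x\in\Omega$, and let $u_0\in L^p(\Omega)$. If $f\in C([0,\infty)\times L^p(\Omega);L^p(\Omega))$ is locally Lipschitz in the second variable, uniformly with respect to the first variable, then there exists $\tau_0>0$ such that the semilinear Cauchy problem $$cD_t^{\alpha(x)}u(t,x)=Au(t,x)+f(t,u(t,x)),\qquad u(0,x)=u_0(x)$$ has a unique solution in $[0,\tau_0]\times\Omega$.
   Context: For $\varphi:I\times\Omega\to\mathbb{R}$ and $\beta:\Omega\to[0,1]$, the Riemann-Liouville fractional integral of order $\beta(x)$ is $J_t^{\beta(x)}\varphi(t,x)=\frac{1}{\Gamma(\beta(x))}\int_0^t(t-s)^{\beta(x)-1}\varphi(s,x)\,ds$ if $\beta(x)\in(0,1]$, and $J_t^{\beta(x)}\varphi(t,x)=\varphi(t,x)$ if $\beta(x)=0$. The Riemann-Liouville fractional derivative of order $\alpha(x)$ is $D_t^{\alpha(x)}\varphi(t,x)=\frac{d}{dt}\big[J_t^{1-\alpha(x)}\varphi(t,x)\big]$, and the Caputo fractional derivative of order $\alpha(x)$ is $cD_t^{\alpha(x)}\varphi(t,x)=D_t^{\alpha(x)}\big[\varphi(t,x)-\varphi(0,x)\big]$, wherever the right-hand sides exist. For $I=[0,T]$ or $I=[0,\infty)$, a solution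 of the semilinear problem in $I\times\Omega$ is a function $\varphi\in C(I;L^p(\Omega))$ such that (i) $cD_t^{\alpha(x)}\varphi(t,x)=A\varphi(t,x)+f(t,\varphi(t,x))$ for every $t\in I$ and almost every $x\in\Omega$, and (ii) $\varphi(0,x)=u_0(x)$ for almost every $x\in\Omega$. Here $\varphi\in C(I;L^p(\Omega))$ is identified with $(t,x)\mapsto\varphi(t)(x)$, $A\varphi(t,x)=(A\varphi(t,\cdot))(x)$, and $f(t,\varphi(t,x))$ means $f(t,\varphi(t,\cdot))(x)$. $f:[0,\infty)\times L^p(\Omega)\to L^p(\Omega)$ is locally Lipschitz in the second variable, uniformly with respect to the first variable, if for each $(t_0,\phi_0)\in[0,\infty)\times L^p(\Omega)$ there exist $r_0,L_0>0$ such that $\|f(t,\psi)-f(t,\phi)\|_{L^p(\Omega)}\leq L_0\|\psi-\phi\|_{L^p(\Omega)}$ for every $(t,\psi),(t,\phi)\in B_{r_0}(t_0,\phi_0)$, where $B_{r_0}(t_0,\phi_0)=\{(s,\lambda)\in[0,\infty)\times L^p(\Omega):|s-t_0|+\|\lambda-\phi_0\|_{L^p(\Omega)}<r_0\}$.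
   Formalization: The time derivative d/dt is taken in the norm of L^p(Ω) (one-sided at the ends of the interval), since with the derivative at fixed x uniqueness fails, and solutions are represented by jointly measurable functions of (t,x). *)

theory Defs
  imports "HOL-Analysis.Analysis" "HOL-Probability.Essential_Supremum"
begin

text \<open>
  Elements of \<open>L\<^sup>p\<close> are represented by measurable functions, and equality in \<open>L\<^sup>p\<close> is equality almost
  everywhere.  Operators on \<open>L\<^sup>p\<close> act on representatives.  That they are well defined on classes is
  not an extra hypothesis: it follows from boundedness (for linear operators) or continuity, since
  these are stated with the \<open>L\<^sup>p\<close> seminorm.
\<close>

definition Lp :: "ennreal \<Rightarrow> 'a measure \<Rightarrow> ('a \<Rightarrow> real) set" where
  "Lp p M = {u \<in> borel_measurable M.
     if p = \<infinity> then esssup M (\<lambda>x. ennreal \<bar>u x\<bar>) < \<infinity>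
     else integrable M (\<lambda>x. \<bar>u x\<bar> powr enn2real p)}"

definition Lp_norm :: "ennreal \<Rightarrow> 'a measure \<Rightarrow> ('a \<Rightarrow> real) \<Rightarrow> real" where
  "Lp_norm p M u =
     (if p = \<infinity> then enn2real (esssup M (\<lambda>x. ennreal \<bar>u x\<bar>))
      else (LINT x|M. \<bar>u x\<bar> powr enn2real p) powr (1 / enn2real p))"

abbreviation Lp_dist :: "ennreal \<Rightarrow> 'a measure \<Rightarrow> ('a \<Rightarrow> real) \<Rightarrow> ('a \<Rightarrow> real) \<Rightarrow> real" where
  "Lp_dist p M u v \<equiv> Lp_norm p M (\<lambda>x. u x - v x)"

definition bounded_linear_Lp ::
    "ennreal \<Rightarrow> 'a measure \<Rightarrow> (('a \<Rightarrow> real) \<Rightarrow> 'a \<Rightarrow> real) \<Rightarrow> bool" where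
  "bounded_linear_Lp p M A \<longleftrightarrow>
     (\<forall>u\<in>Lp p M. A u \<in> Lp p M) \<and>
     (\<forall>u\<in>Lp p M. \<forall>v\<in>Lp p M. AE x in M. A (\<lambda>y. u y + v y) x = A u x + A v x) \<and>
     (\<forall>c. \<forall>u\<in>Lp p M. AE x in M. A (\<lambda>y. c * u y) x = c * A u x) \<and>
     (\<exists>K. \<forall>u\<in>Lp p M. Lp_norm p M (A u) \<le> K * Lp_norm p M u)"

text \<open>\<open>f \<in> C([0,\<infinity>) \<times> L\<^sup>p; L\<^sup>p)\<close>\<close>

definition continuous_Lp_map ::
    "ennreal \<Rightarrow> 'a measure \<Rightarrow> (real \<Rightarrow> ('a \<Rightarrow> real) \<Rightarrow> 'a \<Rightarrow> real) \<Rightarrow> bool" where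
  "continuous_Lp_map p M f \<longleftrightarrow>
     (\<forall>t\<ge>0. \<forall>u\<in>Lp p M. f t u \<in> Lp p M) \<and>
     (\<forall>t0\<ge>0. \<forall>u0\<in>Lp p M. \<forall>\<epsilon>>0. \<exists>\<delta>>0. \<forall>t\<ge>0. \<forall>u\<in>Lp p M.
        \<bar>t - t0\<bar> + Lp_dist p M u u0 < \<delta> \<longrightarrow> Lp_dist p M (f t u) (f t0 u0) < \<epsilon>)"

definition time_Lp_ball ::
    "ennreal \<Rightarrow> 'a measure \<Rightarrow> real \<Rightarrow> ('a \<Rightarrow> real) \<Rightarrow> real \<Rightarrow> (real \<times> ('a \<Rightarrow> real)) set" where
  "time_Lp_ball p M t0 u0 r =
     {(s, u). 0 \<le> s \<and> u \<in> Lp p M \<and> \<bar>s - t0\<bar> + Lp_dist p M u u0 < r}"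

definition locally_Lipschitz_Lp ::
    "ennreal \<Rightarrow> 'a measure \<Rightarrow> (real \<Rightarrow> ('a \<Rightarrow> real) \<Rightarrow> 'a \<Rightarrow> real) \<Rightarrow> bool" where
  "locally_Lipschitz_Lp p M f \<longleftrightarrow>
     (\<forall>t0\<ge>0. \<forall>u0\<in>Lp p M. \<exists>r0>0. \<exists>L0>0. \<forall>t u v.
        (t, v) \<in> time_Lp_ball p M t0 u0 r0 \<longrightarrow> (t, u) \<in> time_Lp_ball p M t0 u0 r0 \<longrightarrow>
        Lp_dist p M (f t v) (f t u) \<le> L0 * Lp_dist p M v u)"

text \<open>
  \<open>\<phi> \<in> C(I; L\<^sup>p(\<Omega>))\<close>, identified with the function \<open>(t, x) \<mapsto> \<phi> t x\<close> on \<open>I \<times> \<Omega>\<close>.  Every continuous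
  curve in \<open>L\<^sup>p\<close> has a jointly measurable version, unique up to null sets; joint measurability is
  demanded so that time integrals at fixed \<open>x\<close> do not depend on the choice of
  representatives of the individual \<open>\<phi> t\<close>.
\<close>

definition Lp_curves ::
    "ennreal \<Rightarrow> real set \<Rightarrow> 'a::euclidean_space set \<Rightarrow> (real \<Rightarrow> 'a \<Rightarrow> real) set" where
  "Lp_curves p I \<Omega> =
     {\<phi>. (\<lambda>(t, x). \<phi> t x) \<in> borel_measurable (lebesgue_on (I \<times> \<Omega>)) \<and>
          (\<forall>t\<in>I. \<phi> t \<in> Lp p (lebesgue_on \<Omega>)) \<and>
          (\<forall>t\<in>I. ((\<lambda>s. Lp_dist p (lebesgue_on \<Omega>) (\<phi> s) (\<phi> t)) \<longlongrightarrow> 0) (at t within I))}"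

definition RL_integral ::
    "('a \<Rightarrow> real) \<Rightarrow> (real \<Rightarrow> 'a \<Rightarrow> real) \<Rightarrow> real \<Rightarrow> 'a \<Rightarrow> real" where
  "RL_integral \<beta> \<phi> t x =
     (if \<beta> x = 0 then \<phi> t x
      else 1 / Gamma (\<beta> x) * (LINT s:{0..t}|lebesgue. (t - s) powr (\<beta> x - 1) * \<phi> s x))"

definition RL_integral_exists ::
    "('a \<Rightarrow> real) \<Rightarrow> (real \<Rightarrow> 'a \<Rightarrow> real) \<Rightarrow> real \<Rightarrow> 'a \<Rightarrow> bool" where
  "RL_integral_exists \<beta> \<phi> t x \<longleftrightarrow>
     (\<beta> x = 0 \<or> set_integrable lebesgue {0..t} (\<lambda>s. (t - s) powr (\<beta> x - 1) * \<phi> s x))"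

text \<open>
  The time derivative is that of an \<open>L\<^sup>p\<close>-valued function (one-sided at end points of \<open>I\<close>).
  Difference quotients taken at individual points \<open>x\<close> are not suitable: with \<open>\<alpha> = 1\<close>,
  \<open>\<Omega> = (0,1)\<close>, \<open>p < \<infinity>\<close>, the function \<open>\<phi> t x = (if x < t then 1 else 0)\<close> lies in \<open>C(I; L\<^sup>p)\<close>, vanishes
  at \<open>t = 0\<close>, and for every \<open>t\<close> its pointwise time derivative is \<open>0\<close> for almost every \<open>x\<close>.
\<close>

definition has_Lp_derivative ::
    "ennreal \<Rightarrow> 'a measure \<Rightarrow> (real \<Rightarrow> 'a \<Rightarrow> real) \<Rightarrow> ('a \<Rightarrow> real) \<Rightarrow> real \<Rightarrow> real set \<Rightarrow> bool" where
  "has_Lp_derivative p M F G t I \<longleftrightarrow>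
     (\<forall>s\<in>I. F s \<in> Lp p M) \<and> G \<in> Lp p M \<and>
     ((\<lambda>s. Lp_dist p M (\<lambda>x. (F s x - F t x) / (s - t)) G) \<longlongrightarrow> 0) (at t within I)"

definition has_RL_derivative ::
    "ennreal \<Rightarrow> 'a::euclidean_space set \<Rightarrow> ('a \<Rightarrow> real) \<Rightarrow> (real \<Rightarrow> 'a \<Rightarrow> real) \<Rightarrow> ('a \<Rightarrow> real)
      \<Rightarrow> real \<Rightarrow> real set \<Rightarrow> bool" where
  "has_RL_derivative p \<Omega> \<alpha> \<phi> G t I \<longleftrightarrow>
     (\<forall>s\<in>I. AE x in lebesgue_on \<Omega>. RL_integral_exists (\<lambda>x. 1 - \<alpha> x) \<phi> s x) \<and>
     has_Lp_derivative p (lebesgue_on \<Omega>) (RL_integral (\<lambda>x. 1 - \<alpha> x) \<phi>) G t I"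

definition has_Caputo_derivative ::
    "ennreal \<Rightarrow> 'a::euclidean_space set \<Rightarrow> ('a \<Rightarrow> real) \<Rightarrow> (real \<Rightarrow> 'a \<Rightarrow> real) \<Rightarrow> ('a \<Rightarrow> real)
      \<Rightarrow> real \<Rightarrow> real set \<Rightarrow> bool" where
  "has_Caputo_derivative p \<Omega> \<alpha> \<phi> G t I \<longleftrightarrow>
     has_RL_derivative p \<Omega> \<alpha> (\<lambda>t x. \<phi> t x - \<phi> 0 x) G t I"

definition is_solution ::
    "ennreal \<Rightarrow> 'a::euclidean_space set \<Rightarrow> ('a \<Rightarrow> real) \<Rightarrow> (('a \<Rightarrow> real) \<Rightarrow> 'a \<Rightarrow> real)
      \<Rightarrow> (real \<Rightarrow> ('a \<Rightarrow> real) \<Rightarrow> 'a \<Rightarrow> real) \<Rightarrow> ('a \<Rightarrow> real) \<Rightarrow> real set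
      \<Rightarrow> (real \<Rightarrow> 'a \<Rightarrow> real) \<Rightarrow> bool" where
  "is_solution p \<Omega> \<alpha> A f u0 I \<phi> \<longleftrightarrow>
     \<phi> \<in> Lp_curves p I \<Omega> \<and>
     (\<forall>t\<in>I. \<exists>G. has_Caputo_derivative p \<Omega> \<alpha> \<phi> G t I \<and>
        (AE x in lebesgue_on \<Omega>. G x = A (\<phi> t) x + f t (\<phi> t) x)) \<and>
     (AE x in lebesgue_on \<Omega>. \<phi> 0 x = u0 x)"

end

theory Submission
  imports Defs
begin

text \<open>
  Write \<open>g t u = A u + f t u\<close>, and let \<open>J\<close> be the fractional integral of order \<open>\<alpha>(x)\<close> in time.  Since
  \<open>J\<^bsup>a\<^esup> J\<^bsup>b\<^esup> = J\<^bsup>a+b\<^esup>\<close> pointwise in \<open>x\<close> (Beta integral), a curve \<open>u\<close> solves the problem iff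
  \<open>u = u\<^sub>0 + J (g \<circ> u)\<close>: from the equation, \<open>J\<^bsup>1-\<alpha>\<^esup> (u - u\<^sub>0)\<close> and \<open>J\<^bsup>1\<^esup> (g \<circ> u)\<close> have the same
  \<open>L\<^sup>p\<close> derivative and vanish at \<open>0\<close>, so they agree, and \<open>J\<^bsup>\<alpha>\<^esup>\<close> can be applied to both.
  For times up to \<open>1\<close> the kernel of \<open>J\<close> is dominated by a multiple of \<open>(t - s) powr (\<alpha>\<^sub>0 - 1)\<close> uniformly in \<open>x\<close>.
  Averaging a curve in \<open>L\<^sup>p\<close> against a weight in time costs at most the mass of the weight
  (Jensen and Tonelli), so \<open>J\<close> has norm \<open>O(\<tau> powr \<alpha>\<^sub>0)\<close> on \<open>[0,\<tau>]\<close>.  For small \<open>\<tau>\<close> the map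
  \<open>u \<mapsto> u\<^sub>0 + J (g \<circ> u)\<close> is a contraction of a ball around \<open>u\<^sub>0\<close>, and no solution can leave that ball.
  Values of \<open>g \<circ> u\<close> are only determined up to null sets at each time; integrating them at fixed
  \<open>x\<close> requires a jointly measurable version, obtained as a limit of step functions in time.
\<close>

section \<open>The spaces \<open>L\<^sup>p\<close> and weighted averages\<close>

text \<open>All estimates come from one inequality, \<open>Lp_le_average\<close>, stated for an
  arbitrary sigma-finite index measure. On a two-point space it is the triangle inequality, on the
  naturals it gives completeness, and on the time line it bounds primitives, \<open>J\<close> and
  the increments of \<open>J\<close>. Times are kept below 1 because r powr (b - 1) is at most
  \<open>r powr (\<alpha>\<^sub>0 - 1)\<close> for \<open>\<alpha>\<^sub>0 \<le> b\<close> only when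
  r \<le> 1. Order 0 stays apart throughout: its kernel would be a Dirac mass, so the points with
  \<alpha>(x) = 1 form their own case. The main obstacle is null sets. Identities between curves
  hold at each time outside a null set depending on that time, whereas fractional integrals are
  taken at fixed x. Fubini exchanges the quantifiers at the price of "almost every time", and
  differentiation in L^p leads back to every time. A solution is measurable only for the completed
  product, so it is first compared with a version measurable for the product sigma-algebra.\<close>

lemma powr_tangent_le:
  fixes y c q :: real
  assumes "0 \<le> y" "0 \<le> c" "1 \<le> q"
  shows "q * c powr (q - 1) * y \<le> y powr q + (q - 1) * c powr q"
proof (cases "y = 0 \<or> c = 0")
  case True
  then show ?thesis using assms by (elim disjE) (simp_all add: mult_nonneg_nonneg)
next
  case False
  have "(y powr q) powr (1/q) * (c powr q) powr (1 - 1/q) \<le> (1/q) * y powr q + (1 - 1/q) * c powr q"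
    by (rule Youngs_inequality_0) (use assms False in \<open>auto simp: field_simps\<close>)
  moreover have "(y powr q) powr (1/q) = y" using assms by (simp add: powr_powr)
  moreover have "q * (1 - 1/q) = q - 1" using assms by (simp add: field_simps)
  then have "(c powr q) powr (1 - 1/q) = c powr (q - 1)" by (simp add: powr_powr)
  ultimately have "y * c powr (q - 1) \<le> (1/q) * y powr q + (1 - 1/q) * c powr q" by simp
  then have "q * (y * c powr (q - 1)) \<le> q * ((1/q) * y powr q + (1 - 1/q) * c powr q)"
    using assms by (intro mult_left_mono) auto
  also have "\<dots> = y powr q + (q - 1) * c powr q" using assms by (simp add: field_simps)
  finally show ?thesis by (simp add: mult_ac)
qed

text \<open>Jensen's inequality for a weight of arbitrary mass W: the tangent inequality, taken at
  the mean c = E / W, is integrated against w. As w is not normalised, the factor W powr (q - 1)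
  appears.\<close>

lemma weighted_integral_powr_le:
  fixes w y :: "'s \<Rightarrow> real"
  assumes q: "1 \<le> q" and w: "integrable N w" "\<And>s. 0 \<le> w s" and y: "y \<in> borel_measurable N" "\<And>s. 0 \<le> y s"
    and i: "integrable N (\<lambda>s. w s * y s powr q)"
  shows "integrable N (\<lambda>s. w s * y s)"
    and "(LINT s|N. w s * y s) powr q \<le> (LINT s|N. w s) powr (q - 1) * (LINT s|N. w s * y s powr q)"
proof -
  have [measurable]: "w \<in> borel_measurable N" "y \<in> borel_measurable N" using w y by auto
  have le: "y s \<le> 1 + y s powr q" for s
  proof (cases "y s \<le> 1")
    case True then show ?thesis by (simp add: add_increasing2)
  next
    case False
    then have "y s powr 1 \<le> y s powr q" using q by (intro powr_mono) auto
    then show ?thesis using False y(2)[of s] by simp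
  qed
  have "integrable N (\<lambda>s. w s + w s * y s powr q)" using w i by auto
  then show int: "integrable N (\<lambda>s. w s * y s)"
  proof (rule Bochner_Integration.integrable_bound)
    show "AE s in N. norm (w s * y s) \<le> norm (w s + w s * y s powr q)"
      using mult_left_mono[OF le w(2)] w y by (auto simp: abs_mult algebra_simps)
  qed simp
  define W where "W = (LINT s|N. w s)"
  define E where "E = (LINT s|N. w s * y s)"
  define F where "F = (LINT s|N. w s * y s powr q)"
  have W0: "0 \<le> W" "0 \<le> E" "0 \<le> F" unfolding W_def E_def F_def using w y by (auto intro!: integral_nonneg_AE)
  have "E powr q \<le> W powr (q - 1) * F"
  proof (cases "W = 0")
    case True
    then have "AE s in N. w s = 0"
      unfolding W_def using w integral_nonneg_eq_0_iff_AE[of N w] by auto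
    then have "E = (LINT s|N. 0)" unfolding E_def by (intro integral_cong_AE) auto
    then show ?thesis using W0 q by simp
  next
    case False
    then have Wp: "0 < W" using W0 by simp
    define c where "c = E / W"
    have c0: "0 \<le> c" using W0 by (simp add: c_def)
    have "(LINT s|N. q * c powr (q - 1) * (w s * y s)) \<le> (LINT s|N. w s * y s powr q + (q - 1) * c powr q * w s)"
    proof (rule integral_mono)
      fix s
      show "q * c powr (q - 1) * (w s * y s) \<le> w s * y s powr q + (q - 1) * c powr q * w s"
        using mult_left_mono[OF powr_tangent_le[of "y s" c q] w(2)[of s]] y c0 q by (simp add: algebra_simps)
    qed (use int i w in auto)
    then have "q * c powr (q - 1) * E \<le> F + (q - 1) * c powr q * W"
      using int i w by (simp add: E_def F_def W_def)
    moreover have "c powr (q - 1) * E = c powr q * W"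
    proof (cases "c = 0")
      case True then show ?thesis using Wp by (simp add: c_def)
    next
      case False
      then have "c powr q = c powr (q - 1) * c" using c0 by (simp add: powr_diff)
      moreover have "c * W = E" using Wp by (simp add: c_def)
      ultimately show ?thesis by (simp add: mult.assoc)
    qed
    ultimately have "q * (c powr q * W) \<le> F + (q - 1) * (c powr q * W)" by (simp only: mult.assoc)
    then have "c powr q * W \<le> F" by (simp add: left_diff_distrib)
    then have "W powr (q - 1) * (c powr q * W) \<le> W powr (q - 1) * F" by (intro mult_left_mono) auto
    moreover have "W powr (q - 1) * (c powr q * W) = E powr q"
      using Wp W0 by (simp add: c_def powr_divide powr_diff)
    ultimately show ?thesis by simp
  qed
  then show "(LINT s|N. w s * y s) powr q \<le> (LINT s|N. w s) powr (q - 1) * (LINT s|N. w s * y s powr q)"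
    by (simp add: E_def W_def F_def)
qed

section \<open>Norm bounds in L^p, uniformly in the exponent\<close>

locale Lp_space = sigma_finite_measure M for M :: "'a measure" +
  fixes p :: ennreal
  assumes p_ge_1: "1 \<le> p"
begin

text \<open>Membership and a norm bound in one predicate. The nonnegative integral makes sense
  before integrability is known, so Tonelli applies directly; for p = \<infinity> an
  almost-everywhere bound takes the place of the essential supremum.\<close>

definition Lp_le :: "real \<Rightarrow> ('a \<Rightarrow> real) \<Rightarrow> bool" where
  "Lp_le B u \<longleftrightarrow> u \<in> borel_measurable M \<and>
     (if p = \<infinity> then AE x in M. \<bar>u x\<bar> \<le> B
      else (\<integral>\<^sup>+x. ennreal (\<bar>u x\<bar> powr enn2real p) \<partial>M) \<le> ennreal (B powr enn2real p))"

lemma Lp_le_top: "p = \<infinity> \<Longrightarrow> Lp_le B u \<longleftrightarrow> u \<in> borel_measurable M \<and> (AE x in M. \<bar>u x\<bar> \<le> B)"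
  and Lp_le_finite: "p \<noteq> \<infinity> \<Longrightarrow> Lp_le B u \<longleftrightarrow> u \<in> borel_measurable M \<and>
      (\<integral>\<^sup>+x. ennreal (\<bar>u x\<bar> powr enn2real p) \<partial>M) \<le> ennreal (B powr enn2real p)"
  unfolding Lp_le_def by simp_all

lemma q_ge_1: "p \<noteq> \<infinity> \<Longrightarrow> 1 \<le> enn2real p"
  using p_ge_1 enn2real_mono[of 1 p] by (auto simp: top.not_eq_extremum)

lemma Lp_le_iff:
  assumes "0 \<le> B"
  shows "Lp_le B u \<longleftrightarrow> u \<in> Lp p M \<and> Lp_norm p M u \<le> B"
proof (cases "p = \<infinity>")
  case True
  have "u \<in> borel_measurable M \<Longrightarrow> (AE x in M. \<bar>u x\<bar> \<le> B) \<longleftrightarrow> esssup M (\<lambda>x. ennreal \<bar>u x\<bar>) \<le> ennreal B"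
  proof
    assume "u \<in> borel_measurable M" "AE x in M. \<bar>u x\<bar> \<le> B"
    then show "esssup M (\<lambda>x. ennreal \<bar>u x\<bar>) \<le> ennreal B"
      by (intro esssup_I) (auto intro: ennreal_leI)
  next
    assume le: "esssup M (\<lambda>x. ennreal \<bar>u x\<bar>) \<le> ennreal B"
    show "AE x in M. \<bar>u x\<bar> \<le> B"
      using esssup_AE[of "\<lambda>x. ennreal \<bar>u x\<bar>" M]
    proof (eventually_elim)
      case (elim x)
      then have "ennreal \<bar>u x\<bar> \<le> ennreal B" using le by (rule order_trans)
      then show ?case using assms by (simp add: ennreal_le_iff)
    qed
  qed
  moreover have "e \<le> ennreal B \<longleftrightarrow> e < \<infinity> \<and> enn2real e \<le> B" for e
    using assms by (cases e) (auto simp: ennreal_le_iff top_unique)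
  ultimately show ?thesis
    unfolding Lp_le_top[OF True] Lp_def Lp_norm_def if_P[OF True] by blast
next
  case False
  define q where "q = enn2real p"
  have q: "1 \<le> q" using q_ge_1 False by (simp add: q_def)
  have int: "integrable M (\<lambda>x. \<bar>u x\<bar> powr q) \<longleftrightarrow> (\<integral>\<^sup>+x. ennreal (\<bar>u x\<bar> powr q) \<partial>M) < \<infinity>" if "u \<in> borel_measurable M"
    using that by (simp add: integrable_iff_bounded)
  show ?thesis
  proof (cases "integrable M (\<lambda>x. \<bar>u x\<bar> powr q)")
    case i: True
    have "(LINT x|M. \<bar>u x\<bar> powr q) \<le> B powr q \<longleftrightarrow> (LINT x|M. \<bar>u x\<bar> powr q) powr (1/q) \<le> B"
    proof -
      have "I \<le> B powr q \<longleftrightarrow> I powr (1/q) \<le> B" if "0 \<le> I" for I :: real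
      proof
        assume "I \<le> B powr q"
        then have "I powr (1/q) \<le> (B powr q) powr (1/q)" using that q by (intro powr_mono2) auto
        then show "I powr (1/q) \<le> B" using q assms by (simp add: powr_powr)
      next
        assume "I powr (1/q) \<le> B"
        then have "(I powr (1/q)) powr q \<le> B powr q" using that q by (intro powr_mono2) auto
        then show "I \<le> B powr q" using q that by (simp add: powr_powr)
      qed
      then show ?thesis by simp
    qed
    moreover have "(\<integral>\<^sup>+x. ennreal (\<bar>u x\<bar> powr q) \<partial>M) = ennreal (LINT x|M. \<bar>u x\<bar> powr q)"
      using i by (intro nn_integral_eq_integral) auto
    ultimately show ?thesis
      unfolding Lp_le_finite[OF False] Lp_def Lp_norm_def if_not_P[OF False] q_def[symmetric]
      using i by (simp add: ennreal_le_iff)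
  next
    case i: False
    moreover have "\<not> Lp_le B u"
    proof
      assume "Lp_le B u"
      then have "u \<in> borel_measurable M" "(\<integral>\<^sup>+x. ennreal (\<bar>u x\<bar> powr q) \<partial>M) < \<infinity>"
        unfolding Lp_le_finite[OF False] q_def by (auto intro: le_less_trans)
      then show False using int i by auto
    qed
    ultimately show ?thesis
      unfolding Lp_def if_not_P[OF False] q_def[symmetric] by blast
  qed
qed

lemma Lp_norm_nonneg: "0 \<le> Lp_norm p M u"
  by (auto simp: Lp_norm_def)

lemma Lp_le_norm: "u \<in> Lp p M \<Longrightarrow> Lp_le (Lp_norm p M u) u"
  using Lp_le_iff[of "Lp_norm p M u" u] Lp_norm_nonneg by auto

lemma Lp_le_imp_Lp: "Lp_le B u \<Longrightarrow> 0 \<le> B \<Longrightarrow> u \<in> Lp p M"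
  and Lp_le_imp_norm: "Lp_le B u \<Longrightarrow> 0 \<le> B \<Longrightarrow> Lp_norm p M u \<le> B"
  using Lp_le_iff by auto

lemma Lp_le_measurable: "Lp_le B u \<Longrightarrow> u \<in> borel_measurable M"
  by (auto simp: Lp_le_def)

lemma Lp_measurable: "u \<in> Lp p M \<Longrightarrow> u \<in> borel_measurable M"
  by (auto simp: Lp_def)

lemma Lp_le_mono:
  assumes "Lp_le B v" "u \<in> borel_measurable M" "AE x in M. \<bar>u x\<bar> \<le> \<bar>v x\<bar>" "B \<le> C" "0 \<le> B"
  shows "Lp_le C u"
proof (cases "p = \<infinity>")
  case True
  have "AE x in M. \<bar>v x\<bar> \<le> B" using assms unfolding Lp_le_top[OF True] by blast
  with assms(3) have "AE x in M. \<bar>u x\<bar> \<le> C" by eventually_elim (use assms in auto)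
  then show ?thesis unfolding Lp_le_top[OF True] using assms by blast
next
  case False
  note q = q_ge_1[OF False]
  have "(\<integral>\<^sup>+x. ennreal (\<bar>u x\<bar> powr enn2real p) \<partial>M) \<le> (\<integral>\<^sup>+x. ennreal (\<bar>v x\<bar> powr enn2real p) \<partial>M)"
  proof (rule nn_integral_mono_AE)
    show "AE x in M. ennreal (\<bar>u x\<bar> powr enn2real p) \<le> ennreal (\<bar>v x\<bar> powr enn2real p)"
      using assms(3) by eventually_elim (use q in \<open>auto intro!: ennreal_leI powr_mono2\<close>)
  qed
  also have "\<dots> \<le> ennreal (B powr enn2real p)" using False assms by (auto simp: Lp_le_def)
  also have "\<dots> \<le> ennreal (C powr enn2real p)" using assms q by (intro ennreal_leI powr_mono2) auto
  finally show ?thesis using False assms by (auto simp: Lp_le_def)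
qed

lemma Lp_le_cong_AE:
  assumes "Lp_le B v" "u \<in> borel_measurable M" "AE x in M. u x = v x" "0 \<le> B"
  shows "Lp_le B u"
  using assms by (intro Lp_le_mono[of B v u]) auto

lemma Lp_le_cmult:
  assumes "Lp_le B u" "0 \<le> B"
  shows "Lp_le (\<bar>c\<bar> * B) (\<lambda>x. c * u x)"
proof (cases "p = \<infinity>")
  case True
  have "AE x in M. \<bar>u x\<bar> \<le> B" and [measurable]: "u \<in> borel_measurable M"
    using assms unfolding Lp_le_top[OF True] by blast+
  from this(1) have "AE x in M. \<bar>c * u x\<bar> \<le> \<bar>c\<bar> * B"
    by eventually_elim (auto simp: abs_mult intro: mult_left_mono)
  then show ?thesis unfolding Lp_le_top[OF True] by simp
next
  case False
  have [measurable]: "u \<in> borel_measurable M" using assms by (auto simp: Lp_le_def)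
  have "(\<integral>\<^sup>+x. ennreal (\<bar>c * u x\<bar> powr enn2real p) \<partial>M)
      = (\<integral>\<^sup>+x. ennreal (\<bar>c\<bar> powr enn2real p) * ennreal (\<bar>u x\<bar> powr enn2real p) \<partial>M)"
    by (intro nn_integral_cong) (simp add: abs_mult powr_mult flip: ennreal_mult)
  also have "\<dots> = ennreal (\<bar>c\<bar> powr enn2real p) * (\<integral>\<^sup>+x. ennreal (\<bar>u x\<bar> powr enn2real p) \<partial>M)"
    by (intro nn_integral_cmult) auto
  also have "\<dots> \<le> ennreal (\<bar>c\<bar> powr enn2real p) * ennreal (B powr enn2real p)"
    using False assms by (intro mult_left_mono) (auto simp: Lp_le_def)
  also have "\<dots> = ennreal ((\<bar>c\<bar> * B) powr enn2real p)"
    using assms by (simp add: powr_mult flip: ennreal_mult)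
  finally show ?thesis using False by (auto simp: Lp_le_def)
qed

lemma Lp_le_0_iff: "Lp_le 0 u \<longleftrightarrow> u \<in> borel_measurable M \<and> (AE x in M. u x = 0)"
  by (auto simp: Lp_le_def nn_integral_0_iff_AE)

text \<open>For p = \<infinity> the pointwise bounds are integrated after exchanging "almost every
  s" and "almost every x". For finite p, Jensen in s at fixed x is followed by Tonelli; the mass
  then enters as W powr (q - 1) * W = W powr q. The bound on g s is asked only where w s is nonzero,
  so that weights can cut out a time interval, and h is only dominated by the average, so that
  kernels may depend on x.\<close>

lemma Lp_le_average:
  fixes w :: "'s \<Rightarrow> real" and g :: "'s \<Rightarrow> 'a \<Rightarrow> real"
  assumes N: "sigma_finite_measure N"
    and w: "integrable N w" "\<And>s. 0 \<le> w s"
    and g: "(\<lambda>(s, x). g s x) \<in> borel_measurable (N \<Otimes>\<^sub>M M)"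
    and B: "0 \<le> B" "\<And>s. s \<in> space N \<Longrightarrow> w s \<noteq> 0 \<Longrightarrow> Lp_le B (g s)"
  shows "AE x in M. integrable N (\<lambda>s. w s * g s x)"
    and "h \<in> borel_measurable M \<Longrightarrow> AE x in M. \<bar>h x\<bar> \<le> (LINT s|N. w s * \<bar>g s x\<bar>) \<Longrightarrow> Lp_le (B * (LINT s|N. w s)) h"
proof -
  interpret N: sigma_finite_measure N by fact
  interpret NM: pair_sigma_finite N M ..
  note g[measurable]
  have [measurable]: "w \<in> borel_measurable N" using w by auto
  have gm[measurable]: "(\<lambda>s. g s x) \<in> borel_measurable N" if "x \<in> space M" for x
    using measurable_Pair1[OF g that] by simp
  define W where "W = (LINT s|N. w s)"
  have W0: "0 \<le> W" unfolding W_def using w by (intro integral_nonneg_AE) auto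
  show "AE x in M. integrable N (\<lambda>s. w s * g s x)"
    and "h \<in> borel_measurable M \<Longrightarrow> AE x in M. \<bar>h x\<bar> \<le> (LINT s|N. w s * \<bar>g s x\<bar>) \<Longrightarrow> Lp_le (B * (LINT s|N. w s)) h"
  proof (atomize (full), cases "p = \<infinity>")
    case True
    have "AE s in N. AE x in M. w s * \<bar>g s x\<bar> \<le> w s * B"
    proof (rule AE_I2)
      fix s assume s: "s \<in> space N"
      show "AE x in M. w s * \<bar>g s x\<bar> \<le> w s * B"
      proof (cases "w s = 0")
        case False
        then have "AE x in M. \<bar>g s x\<bar> \<le> B" using B(2)[OF s] unfolding Lp_le_top[OF True] by blast
        then show ?thesis by eventually_elim (use w in \<open>auto intro: mult_left_mono\<close>)
      qed auto
    qed
    moreover have "(\<lambda>z. w (fst z) * \<bar>g (fst z) (snd z)\<bar>) \<in> borel_measurable (N \<Otimes>\<^sub>M M)"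
      using g by (simp add: split_beta)
    then have "{z \<in> space (N \<Otimes>\<^sub>M M). w (fst z) * \<bar>g (fst z) (snd z)\<bar> \<le> w (fst z) * B} \<in> sets (N \<Otimes>\<^sub>M M)"
      by measurable
    ultimately have "AE x in M. AE s in N. w s * \<bar>g s x\<bar> \<le> w s * B"
      by (simp add: NM.AE_commute)
    then have *: "AE x in M. integrable N (\<lambda>s. w s * g s x) \<and> (LINT s|N. w s * \<bar>g s x\<bar>) \<le> B * W"
      using AE_space
    proof eventually_elim
      case (elim x)
      note gm[OF elim(2), measurable]
      have i: "integrable N (\<lambda>s. w s * g s x)"
        by (rule Bochner_Integration.integrable_bound[of N "\<lambda>s. w s * B"])
          (use elim w B in \<open>auto simp: abs_mult\<close>)
      then have "integrable N (\<lambda>s. w s * \<bar>g s x\<bar>)"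
        using integrable_abs[OF i] w by (simp add: abs_mult)
      then have "(LINT s|N. w s * \<bar>g s x\<bar>) \<le> (LINT s|N. w s * B)"
        using elim w by (intro integral_mono_AE) auto
      then show ?case using i by (simp add: W_def mult.commute)
    qed
    have "AE x in M. integrable N (\<lambda>s. w s * g s x)" using * by eventually_elim auto
    moreover have "Lp_le (B * W) h" if "h \<in> borel_measurable M" "AE x in M. \<bar>h x\<bar> \<le> (LINT s|N. w s * \<bar>g s x\<bar>)"
    proof -
      have "AE x in M. \<bar>h x\<bar> \<le> B * W" using * that(2) by eventually_elim auto
      then show ?thesis unfolding Lp_le_top[OF True] using that by blast
    qed
    ultimately show "(AE x in M. integrable N (\<lambda>s. w s * g s x)) \<and>
      (h \<in> borel_measurable M \<longrightarrow> (AE x in M. \<bar>h x\<bar> \<le> (LINT s|N. w s * \<bar>g s x\<bar>)) \<longrightarrow> Lp_le (B * (LINT s|N. w s)) h)"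
      by (simp add: W_def)
  next
    case False
    define q where "q = enn2real p"
    have q: "1 \<le> q" using q_ge_1 False by (simp add: q_def)
    \<comment> \<open>The q-th moment in s at fixed x. Its integral over x is at most W * B powr q,
      hence it is finite for almost every x, and Jensen can be applied there.\<close>
    define A where "A x = (\<integral>\<^sup>+s. ennreal (w s * \<bar>g s x\<bar> powr q) \<partial>N)" for x
    have Am[measurable]: "A \<in> borel_measurable M" unfolding A_def using g by measurable
    have "(\<integral>\<^sup>+x. A x \<partial>M) = (\<integral>\<^sup>+s. (\<integral>\<^sup>+x. ennreal (w s * \<bar>g s x\<bar> powr q) \<partial>M) \<partial>N)"
      unfolding A_def using g by (intro NM.Fubini') measurable
    also have "\<dots> \<le> (\<integral>\<^sup>+s. ennreal (w s * B powr q) \<partial>N)"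
    proof (rule nn_integral_mono)
      fix s assume s: "s \<in> space N"
      show "(\<integral>\<^sup>+x. ennreal (w s * \<bar>g s x\<bar> powr q) \<partial>M) \<le> ennreal (w s * B powr q)"
      proof (cases "w s = 0")
        case wn: False
        have [measurable]: "g s \<in> borel_measurable M" using B(2)[OF s wn] by (rule Lp_le_measurable)
        have "(\<integral>\<^sup>+x. ennreal (w s * \<bar>g s x\<bar> powr q) \<partial>M) = ennreal (w s) * (\<integral>\<^sup>+x. ennreal (\<bar>g s x\<bar> powr q) \<partial>M)"
          by (subst nn_integral_cmult[symmetric]) (use w in \<open>auto simp: ennreal_mult\<close>)
        also have "\<dots> \<le> ennreal (w s) * ennreal (B powr q)"
          using B(2)[OF s wn] False by (intro mult_left_mono) (auto simp: Lp_le_def q_def)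
        finally show ?thesis using w by (simp add: ennreal_mult)
      qed auto
    qed
    also have "\<dots> = ennreal (W * B powr q)"
      using w by (subst nn_integral_eq_integral) (auto simp: W_def)
    finally have Aint: "(\<integral>\<^sup>+x. A x \<partial>M) \<le> ennreal (W * B powr q)" .
    then have "(\<integral>\<^sup>+x. A x \<partial>M) \<noteq> \<infinity>" by (auto simp: top_unique)
    then have "AE x in M. A x \<noteq> \<infinity>" by (intro nn_integral_PInf_AE) auto
    then have *: "AE x in M. integrable N (\<lambda>s. w s * g s x) \<and>
        ennreal ((LINT s|N. w s * \<bar>g s x\<bar>) powr q) \<le> ennreal (W powr (q - 1)) * A x"
      using AE_space
    proof eventually_elim
      case (elim x)
      note gm[OF elim(2), measurable]
      have i: "integrable N (\<lambda>s. w s * \<bar>g s x\<bar> powr q)"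
        using elim w by (intro integrableI_bounded) (auto simp: A_def abs_mult less_top)
      have Ax: "A x = ennreal (LINT s|N. w s * \<bar>g s x\<bar> powr q)"
        unfolding A_def using i w by (intro nn_integral_eq_integral) auto
      note J = weighted_integral_powr_le[OF q w _ _ i, simplified]
      have "integrable N (\<lambda>s. w s * g s x)"
        by (rule Bochner_Integration.integrable_bound[OF J(1)]) (use w in \<open>auto simp: abs_mult\<close>)
      moreover have "ennreal ((LINT s|N. w s * \<bar>g s x\<bar>) powr q) \<le> ennreal (W powr (q - 1)) * A x"
        using J(2) w by (simp add: Ax W_def ennreal_leI flip: ennreal_mult)
      ultimately show ?case by simp
    qed
    have "AE x in M. integrable N (\<lambda>s. w s * g s x)" using * by eventually_elim auto
    moreover have "Lp_le (B * W) h" if "h \<in> borel_measurable M" "AE x in M. \<bar>h x\<bar> \<le> (LINT s|N. w s * \<bar>g s x\<bar>)"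
    proof -
      have "AE x in M. ennreal (\<bar>h x\<bar> powr q) \<le> ennreal (W powr (q - 1)) * A x"
        using * that(2)
      proof eventually_elim
        case (elim x)
        have "\<bar>h x\<bar> powr q \<le> (LINT s|N. w s * \<bar>g s x\<bar>) powr q" using elim q by (intro powr_mono2) auto
        then show ?case using elim by (meson ennreal_leI order_trans)
      qed
      then have "(\<integral>\<^sup>+x. ennreal (\<bar>h x\<bar> powr q) \<partial>M) \<le> (\<integral>\<^sup>+x. ennreal (W powr (q - 1)) * A x \<partial>M)"
        by (rule nn_integral_mono_AE)
      also have "\<dots> = ennreal (W powr (q - 1)) * (\<integral>\<^sup>+x. A x \<partial>M)" by (intro nn_integral_cmult) auto
      also have "\<dots> \<le> ennreal (W powr (q - 1)) * ennreal (W * B powr q)" using Aint by (intro mult_left_mono) auto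
      also have "\<dots> = ennreal ((B * W) powr q)"
        using W0 B q by (cases "W = 0") (auto simp: powr_mult powr_diff simp flip: ennreal_mult)
      finally show ?thesis using False that by (auto simp: Lp_le_def q_def)
    qed
    ultimately show "(AE x in M. integrable N (\<lambda>s. w s * g s x)) \<and>
      (h \<in> borel_measurable M \<longrightarrow> (AE x in M. \<bar>h x\<bar> \<le> (LINT s|N. w s * \<bar>g s x\<bar>)) \<longrightarrow> Lp_le (B * (LINT s|N. w s)) h)"
      by (simp add: W_def)
  qed
qed

text \<open>Minkowski's inequality as an average over two points: u + v is the combination of u / a
  and v / b, both of norm at most 1, with masses a and b of total a + b. The divisions force the
  case a = 0 or b = 0 to be split off.\<close>

lemma Lp_le_add:
  assumes "Lp_le a u" "Lp_le b v" "0 \<le> a" "0 \<le> b"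
  shows "Lp_le (a + b) (\<lambda>x. u x + v x)"
proof -
  have [measurable]: "u \<in> borel_measurable M" "v \<in> borel_measurable M" using assms by (auto simp: Lp_le_def)
  show ?thesis
  proof (cases "a = 0 \<or> b = 0")
    case True
    then consider "a = 0" | "b = 0" by auto
    then show ?thesis
    proof cases
      case 1
      then have "AE x in M. u x = 0" using assms by (simp add: Lp_le_0_iff)
      then have "AE x in M. u x + v x = v x" by eventually_elim auto
      then show ?thesis using 1 assms by (auto intro: Lp_le_cong_AE)
    next
      case 2
      then have "AE x in M. v x = 0" using assms by (simp add: Lp_le_0_iff)
      then have "AE x in M. u x + v x = u x" by eventually_elim auto
      then show ?thesis using 2 assms by (auto intro: Lp_le_cong_AE)
    qed
  next
    case False
    then have ab: "0 < a" "0 < b" using assms by auto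
    let ?N = "count_space (UNIV :: bool set)"
    define w where "w = (\<lambda>s. if s then a else b)"
    define g where "g = (\<lambda>s x. if s then u x / a else v x / b)"
    have I: "(LINT s|?N. F s) = F False + F True" for F :: "bool \<Rightarrow> real"
      by (subst lebesgue_integral_count_space_finite) (auto simp: UNIV_bool)
    have "Lp_le (1 * (LINT s|?N. w s)) (\<lambda>x. u x + v x)"
    proof (rule Lp_le_average(2)[where g = g])
      show "sigma_finite_measure ?N" by (rule sigma_finite_measure_count_space)
      show "integrable ?N w" by (rule integrable_count_space) auto
      show "(\<lambda>(s, x). g s x) \<in> borel_measurable (?N \<Otimes>\<^sub>M M)"
        by (subst measurable_pair_measure_countable1) (auto simp: g_def)
      show "Lp_le 1 (g s)" for s
        using Lp_le_cmult[OF assms(1), of "1/a"] Lp_le_cmult[OF assms(2), of "1/b"] ab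
        by (cases s) (auto simp: g_def field_simps)
      show "AE x in M. \<bar>u x + v x\<bar> \<le> (LINT s|?N. w s * \<bar>g s x\<bar>)"
        unfolding I using ab by (auto simp: w_def g_def)
    qed (use ab in \<open>auto simp: w_def\<close>)
    then show ?thesis unfolding I by (simp add: w_def add.commute)
  qed
qed

lemma Lp_add: "u \<in> Lp p M \<Longrightarrow> v \<in> Lp p M \<Longrightarrow> (\<lambda>x. u x + v x) \<in> Lp p M"
  using Lp_le_add[OF Lp_le_norm Lp_le_norm] Lp_norm_nonneg by (blast intro: Lp_le_imp_Lp add_nonneg_nonneg)

lemma Lp_cmult: "u \<in> Lp p M \<Longrightarrow> (\<lambda>x. c * u x) \<in> Lp p M"
  using Lp_le_cmult[OF Lp_le_norm] Lp_norm_nonneg by (blast intro: Lp_le_imp_Lp mult_nonneg_nonneg abs_ge_zero)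

lemma Lp_diff: "u \<in> Lp p M \<Longrightarrow> v \<in> Lp p M \<Longrightarrow> (\<lambda>x. u x - v x) \<in> Lp p M"
  using Lp_add[OF _ Lp_cmult[of v "-1"], of u] by simp

lemma Lp_norm_cmult_le: "u \<in> Lp p M \<Longrightarrow> Lp_norm p M (\<lambda>x. c * u x) \<le> \<bar>c\<bar> * Lp_norm p M u"
  by (intro Lp_le_imp_norm Lp_le_cmult Lp_le_norm mult_nonneg_nonneg Lp_norm_nonneg) auto

lemma Lp_norm_add_le:
  "u \<in> Lp p M \<Longrightarrow> v \<in> Lp p M \<Longrightarrow> Lp_norm p M (\<lambda>x. u x + v x) \<le> Lp_norm p M u + Lp_norm p M v"
  by (intro Lp_le_imp_norm Lp_le_add Lp_le_norm add_nonneg_nonneg Lp_norm_nonneg)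

lemma Lp_dist_commute: "Lp_dist p M u v = Lp_dist p M v u"
  by (simp add: Lp_norm_def abs_minus_commute)

lemma Lp_dist_triangle:
  assumes "u \<in> Lp p M" "v \<in> Lp p M" "w \<in> Lp p M"
  shows "Lp_dist p M u w \<le> Lp_dist p M u v + Lp_dist p M v w"
  using Lp_norm_add_le[of "\<lambda>x. u x - v x" "\<lambda>x. v x - w x"] assms Lp_diff by simp

lemma Lp_cong_AE:
  assumes "v \<in> Lp p M" "u \<in> borel_measurable M" "AE x in M. u x = v x"
  shows "u \<in> Lp p M"
  using Lp_le_cong_AE[OF Lp_le_norm] assms Lp_norm_nonneg Lp_le_imp_Lp by blast

lemma Lp_norm_cong_AE:
  assumes "u \<in> borel_measurable M" "v \<in> borel_measurable M" "AE x in M. u x = v x"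
  shows "Lp_norm p M u = Lp_norm p M v"
proof -
  note [measurable] = assms(1,2)
  have "esssup M (\<lambda>x. ennreal \<bar>u x\<bar>) = esssup M (\<lambda>x. ennreal \<bar>v x\<bar>)"
    by (rule esssup_AE_cong) (use assms in auto)
  moreover have "(LINT x|M. \<bar>u x\<bar> powr enn2real p) = (LINT x|M. \<bar>v x\<bar> powr enn2real p)"
    by (rule integral_cong_AE) (use assms in auto)
  ultimately show ?thesis by (simp add: Lp_norm_def)
qed

lemma Lp_norm_eq_0D: "u \<in> Lp p M \<Longrightarrow> Lp_norm p M u \<le> 0 \<Longrightarrow> AE x in M. u x = 0"
  using Lp_le_iff[of 0 u] by (auto simp: Lp_le_0_iff)

lemma Lp_norm_eq_0I: "u \<in> borel_measurable M \<Longrightarrow> AE x in M. u x = 0 \<Longrightarrow> Lp_norm p M u = 0"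
  using Lp_le_imp_norm[of 0 u] Lp_norm_nonneg[of u] by (force simp: Lp_le_0_iff)

lemma Lp_dist_eq_0D: "u \<in> Lp p M \<Longrightarrow> v \<in> Lp p M \<Longrightarrow> Lp_dist p M u v \<le> 0 \<Longrightarrow> AE x in M. u x = v x"
  using Lp_norm_eq_0D[OF Lp_diff, of u v] by auto

text \<open>The same device on the naturals: v n / a n has norm at most 1 and carries mass a n, so
  positivity of a n is what makes the normalisation possible. Integrability for counting measure is
  absolute summability.\<close>

lemma Lp_le_suminf:
  assumes a: "\<And>n. 0 < a n" "summable a" and v: "\<And>n. Lp_le (a n) (v n)"
  shows "AE x in M. summable (\<lambda>n. \<bar>v n x\<bar>)"
    and "Lp_le (\<Sum>n. a n) (\<lambda>x. \<Sum>n. v n x)"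
proof -
  let ?N = "count_space (UNIV :: nat set)"
  define g where "g n x = v n x / a n" for n x
  have vm[measurable]: "v n \<in> borel_measurable M" for n using v by (rule Lp_le_measurable)
  have ia: "integrable ?N a" using a by (simp add: integrable_count_space_nat_iff order.strict_implies_order)
  have gm: "(\<lambda>(s, x). g s x) \<in> borel_measurable (?N \<Otimes>\<^sub>M M)"
    by (subst measurable_pair_measure_countable1) (auto simp: g_def)
  have le: "Lp_le 1 (g n)" for n
    using Lp_le_cmult[OF v, of n "1 / a n"] a(1)[of n] by (auto simp: g_def[abs_def])
  have ag: "a n * g n x = v n x" for n x using a(1)[of n] by (simp add: g_def)
  note avg = Lp_le_average[OF sigma_finite_measure_count_space ia _ gm zero_le_one le, unfolded ag]
  have "AE x in M. integrable ?N (\<lambda>s. v s x)" by (rule avg(1)) (use a in \<open>auto intro: less_imp_le\<close>)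
  then show s: "AE x in M. summable (\<lambda>n. \<bar>v n x\<bar>)" by (simp add: integrable_count_space_nat_iff)
  have "Lp_le (1 * (LINT s|?N. a s)) (\<lambda>x. \<Sum>n. v n x)"
  proof (rule avg(2))
    show "AE x in M. \<bar>\<Sum>n. v n x\<bar> \<le> (LINT s|?N. a s * \<bar>g s x\<bar>)"
      using s
    proof eventually_elim
      case (elim x)
      have "a s * \<bar>g s x\<bar> = \<bar>v s x\<bar>" for s
        using ag[of s x] a(1)[of s] by (metis abs_mult abs_of_pos)
      moreover have "(LINT s|?N. \<bar>v s x\<bar>) = (\<Sum>n. \<bar>v n x\<bar>)"
        by (rule integral_count_space_nat) (use elim in \<open>simp add: integrable_count_space_nat_iff\<close>)
      ultimately show ?case using summable_rabs[OF elim] by simp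
    qed
  qed (use a in \<open>auto intro: less_imp_le\<close>)
  then show "Lp_le (\<Sum>n. a n) (\<lambda>x. \<Sum>n. v n x)"
    using integral_count_space_nat[OF ia] by simp
qed

lemma AE_tendsto_0_if_Lp_le:
  assumes "\<And>n. Lp_le (c * (1/2)^n) (v n)" "0 < c"
  shows "AE x in M. (\<lambda>n. v n x) \<longlonglongrightarrow> 0"
proof -
  have "AE x in M. summable (\<lambda>n. \<bar>v n x\<bar>)"
    using assms by (intro Lp_le_suminf(1)[of "\<lambda>n. c * (1/2)^n"]) (auto intro!: summable_mult summable_geometric)
  then show ?thesis
    by eventually_elim (auto dest!: summable_LIMSEQ_zero simp: tendsto_rabs_zero_iff)
qed

text \<open>The limit is taken pointwise, so that for a family of sequences it is jointly measurable.\<close>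

lemma Lp_fast_Cauchy:
  assumes u: "\<And>n. u n \<in> Lp p M" and c: "0 < c"
    and le: "\<And>n. Lp_dist p M (u (Suc n)) (u n) \<le> c * (1/2)^n"
  shows "(\<lambda>x. lim (\<lambda>n. u n x)) \<in> Lp p M"
    and "Lp_dist p M (\<lambda>x. lim (\<lambda>n. u n x)) (u n) \<le> 2 * c * (1/2)^n"
proof -
  have um[measurable]: "u n \<in> borel_measurable M" for n using u by (rule Lp_measurable)
  have v: "Lp_le (c * (1/2)^n) (\<lambda>x. u (Suc n) x - u n x)" for n
    using Lp_le_iff[of "c * (1/2)^n"] Lp_diff u le c by auto
  have s: "AE x in M. summable (\<lambda>n. \<bar>u (Suc n) x - u n x\<bar>)"
    by (rule Lp_le_suminf(1)[of "\<lambda>n. c * (1/2)^n"]) (use v c in \<open>auto intro!: summable_mult summable_geometric\<close>)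
  have L: "Lp_le (2 * c * (1/2)^n) (\<lambda>x. lim (\<lambda>n. u n x) - u n x)" for n
  proof (rule Lp_le_cong_AE)
    have "Lp_le (\<Sum>k. c * (1/2)^(k + n)) (\<lambda>x. \<Sum>k. u (Suc (k + n)) x - u (k + n) x)"
    proof (rule Lp_le_suminf(2))
      show "Lp_le (c * (1/2)^(k + n)) (\<lambda>x. u (Suc (k + n)) x - u (k + n) x)" for k by (rule v)
    qed (use c in \<open>auto simp: power_add intro!: summable_mult summable_mult2 summable_geometric\<close>)
    moreover have "(\<Sum>k. c * (1/2)^(k + n)) = 2 * c * (1/2)^n"
    proof -
      have "(\<lambda>k. c * (1/2)^n * (1/2::real)^k) sums (c * (1/2)^n * (1 / (1 - 1/2)))"
        by (intro sums_mult geometric_sums) auto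
      then show ?thesis by (simp add: sums_iff power_add mult_ac)
    qed
    ultimately show "Lp_le (2 * c * (1/2)^n) (\<lambda>x. \<Sum>k. u (Suc (k + n)) x - u (k + n) x)" by simp
    show "AE x in M. lim (\<lambda>n. u n x) - u n x = (\<Sum>k. u (Suc (k + n)) x - u (k + n) x)"
      using s
    proof eventually_elim
      case (elim x)
      then have "summable (\<lambda>k. u (Suc k) x - u k x)" by (rule summable_rabs_cancel)
      then have sm: "summable (\<lambda>k. u (Suc (k + n)) x - u (k + n) x)"
        using summable_iff_shift[of "\<lambda>k. u (Suc k) x - u k x" n] by simp
      have "(\<Sum>j<k. u (Suc (j + n)) x - u (j + n) x) = u (k + n) x - u n x" for k
        by (induction k) auto
      then have "(\<lambda>k. u (k + n) x - u n x) \<longlonglongrightarrow> (\<Sum>k. u (Suc (k + n)) x - u (k + n) x)"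
        using summable_LIMSEQ[OF sm] by simp
      then have "(\<lambda>k. u (k + n) x) \<longlonglongrightarrow> (\<Sum>k. u (Suc (k + n)) x - u (k + n) x) + u n x"
        using tendsto_add[OF _ tendsto_const[of "u n x"]] by force
      then have "(\<lambda>k. u k x) \<longlonglongrightarrow> (\<Sum>k. u (Suc (k + n)) x - u (k + n) x) + u n x"
        by (rule LIMSEQ_offset)
      then show ?case by (simp add: limI)
    qed
  qed (use c in auto)
  show "Lp_dist p M (\<lambda>x. lim (\<lambda>n. u n x)) (u n) \<le> 2 * c * (1/2)^n"
    using Lp_le_imp_norm[OF L] c by auto
  have "(\<lambda>x. lim (\<lambda>n. u n x) - u 0 x) \<in> Lp p M" using Lp_le_imp_Lp[OF L, of 0] c by auto
  from Lp_add[OF this u[of 0]] show "(\<lambda>x. lim (\<lambda>n. u n x)) \<in> Lp p M" by simp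
qed

section \<open>Continuous curves in L^p\<close>

definition Lp_continuous_on :: "real set \<Rightarrow> (real \<Rightarrow> 'a \<Rightarrow> real) \<Rightarrow> bool" where
  "Lp_continuous_on I \<phi> \<longleftrightarrow> (\<forall>t\<in>I. \<phi> t \<in> Lp p M) \<and>
     (\<forall>t\<in>I. ((\<lambda>s. Lp_dist p M (\<phi> s) (\<phi> t)) \<longlongrightarrow> 0) (at t within I))"

text \<open>A limit at t within I ignores s = t; the distance vanishes there, so the epsilon-delta
  form may include that point.\<close>

lemma Lp_continuous_on_eps:
  "Lp_continuous_on I \<phi> \<longleftrightarrow> (\<forall>t\<in>I. \<phi> t \<in> Lp p M) \<and>
     (\<forall>t\<in>I. \<forall>\<epsilon>>0. \<exists>\<delta>>0. \<forall>s\<in>I. \<bar>s - t\<bar> < \<delta> \<longrightarrow> Lp_dist p M (\<phi> s) (\<phi> t) < \<epsilon>)"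
proof -
  have "((\<lambda>s. Lp_dist p M (\<phi> s) (\<phi> t)) \<longlongrightarrow> 0) (at t within I) \<longleftrightarrow>
      (\<forall>\<epsilon>>0. \<exists>\<delta>>0. \<forall>s\<in>I. \<bar>s - t\<bar> < \<delta> \<longrightarrow> Lp_dist p M (\<phi> s) (\<phi> t) < \<epsilon>)" if "t \<in> I" for t
  proof -
    have "Lp_dist p M (\<phi> t) (\<phi> t) = 0" by (simp add: Lp_norm_eq_0I)
    then have *: "(s \<noteq> t \<and> dist s t < \<delta> \<longrightarrow> dist (Lp_dist p M (\<phi> s) (\<phi> t)) 0 < \<epsilon>) \<longleftrightarrow>
        (\<bar>s - t\<bar> < \<delta> \<longrightarrow> Lp_dist p M (\<phi> s) (\<phi> t) < \<epsilon>)" if "\<epsilon> > 0" for s \<epsilon> \<delta>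
      using that by (cases "s = t") (simp_all add: dist_real_def Lp_norm_nonneg)
    show ?thesis unfolding tendsto_iff eventually_at 
      by (rule all_cong, rule ex_cong1, rule conj_cong, rule refl, rule ball_cong, rule refl, rule *)
  qed
  then show ?thesis by (auto simp: Lp_continuous_on_def)
qed

lemma Lp_continuous_on_Lp: "Lp_continuous_on I \<phi> \<Longrightarrow> t \<in> I \<Longrightarrow> \<phi> t \<in> Lp p M"
  by (auto simp: Lp_continuous_on_def)

lemma Lp_continuous_on_cong_AE:
  assumes "Lp_continuous_on I \<phi>" "\<And>t. t \<in> I \<Longrightarrow> \<psi> t \<in> borel_measurable M"
    "\<And>t. t \<in> I \<Longrightarrow> AE x in M. \<psi> t x = \<phi> t x"
  shows "Lp_continuous_on I \<psi>"
proof -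
  have "Lp_dist p M (\<psi> s) (\<psi> t) = Lp_dist p M (\<phi> s) (\<phi> t)" if st: "s \<in> I" "t \<in> I" for s t
  proof -
    note m = assms(2) Lp_continuous_on_Lp[OF assms(1), THEN Lp_measurable]
    have "AE x in M. \<psi> s x - \<psi> t x = \<phi> s x - \<phi> t x"
      using assms(3)[OF st(1)] assms(3)[OF st(2)] by eventually_elim auto
    then show ?thesis
      by (intro Lp_norm_cong_AE borel_measurable_diff m st)
  qed
  moreover have "\<psi> t \<in> Lp p M" if "t \<in> I" for t
    by (rule Lp_cong_AE[OF Lp_continuous_on_Lp[OF assms(1) that] assms(2)[OF that] assms(3)[OF that]])
  ultimately show ?thesis using assms(1) unfolding Lp_continuous_on_eps by simp
qed

lemma Lp_continuous_on_diff:
  assumes "Lp_continuous_on I \<phi>" "Lp_continuous_on I \<psi>"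
  shows "Lp_continuous_on I (\<lambda>t x. \<phi> t x - \<psi> t x)"
  unfolding Lp_continuous_on_def
proof (intro conjI ballI)
  note m = Lp_continuous_on_Lp[OF assms(1)] Lp_continuous_on_Lp[OF assms(2)]
  fix t assume t: "t \<in> I"
  then show "(\<lambda>x. \<phi> t x - \<psi> t x) \<in> Lp p M" using m by (auto intro: Lp_diff)
  show "((\<lambda>s. Lp_norm p M (\<lambda>x. \<phi> s x - \<psi> s x - (\<phi> t x - \<psi> t x))) \<longlongrightarrow> 0) (at t within I)"
  proof (rule tendsto_sandwich[OF _ _ tendsto_const])
    have "((\<lambda>s. Lp_dist p M (\<phi> s) (\<phi> t) + Lp_dist p M (\<psi> t) (\<psi> s)) \<longlongrightarrow> 0 + 0) (at t within I)"
      using assms t by (intro tendsto_add) (auto simp: Lp_continuous_on_def Lp_dist_commute[of "\<psi> t"])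
    then show "((\<lambda>s. Lp_dist p M (\<phi> s) (\<phi> t) + Lp_dist p M (\<psi> t) (\<psi> s)) \<longlongrightarrow> 0) (at t within I)" by simp
    have "Lp_norm p M (\<lambda>x. \<phi> s x - \<psi> s x - (\<phi> t x - \<psi> t x)) \<le> Lp_dist p M (\<phi> s) (\<phi> t) + Lp_dist p M (\<psi> t) (\<psi> s)" if "s \<in> I" for s
      using Lp_norm_add_le[of "\<lambda>x. \<phi> s x - \<phi> t x" "\<lambda>x. \<psi> t x - \<psi> s x"] m that t
      by (simp add: Lp_diff algebra_simps)
    then show "\<forall>\<^sub>F s in at t within I. Lp_norm p M (\<lambda>x. \<phi> s x - \<psi> s x - (\<phi> t x - \<psi> t x)) \<le> Lp_dist p M (\<phi> s) (\<phi> t) + Lp_dist p M (\<psi> t) (\<psi> s)"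
      by (auto simp: eventually_at_filter)
  qed (auto simp: Lp_norm_nonneg)
qed

lemma Lp_continuous_on_const: "u \<in> Lp p M \<Longrightarrow> Lp_continuous_on I (\<lambda>_. u)"
  by (auto simp: Lp_continuous_on_def Lp_norm_eq_0I)

text \<open>e is a Lebesgue number of a cover of I by balls on which the curve stays within
  \<epsilon>/2 of its value at the centre; two times closer than e share such a ball.\<close>

lemma Lp_uniformly_continuous:
  assumes \<phi>: "Lp_continuous_on I \<phi>" and I: "compact I" and \<epsilon>: "0 < \<epsilon>"
  shows "\<exists>\<delta>>0. \<forall>s\<in>I. \<forall>t\<in>I. \<bar>s - t\<bar> < \<delta> \<longrightarrow> Lp_dist p M (\<phi> s) (\<phi> t) < \<epsilon>"
proof -
  have "\<forall>t\<in>I. \<exists>\<delta>>0. \<forall>s\<in>I. \<bar>s - t\<bar> < \<delta> \<longrightarrow> Lp_dist p M (\<phi> s) (\<phi> t) < \<epsilon>/2"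
    using \<phi> \<epsilon> unfolding Lp_continuous_on_eps by (meson half_gt_zero)
  then obtain d where d: "\<And>t. t \<in> I \<Longrightarrow> d t > 0"
    "\<And>s t. t \<in> I \<Longrightarrow> s \<in> I \<Longrightarrow> \<bar>s - t\<bar> < d t \<Longrightarrow> Lp_dist p M (\<phi> s) (\<phi> t) < \<epsilon>/2"
    by metis
  have "I \<subseteq> \<Union> ((\<lambda>t. ball t (d t)) ` I)" using d by force
  then obtain e where e: "e > 0" "\<And>x. x \<in> I \<Longrightarrow> \<exists>G \<in> (\<lambda>t. ball t (d t)) ` I. ball x e \<subseteq> G"
    by (rule Heine_Borel_lemma[OF I]) auto
  show ?thesis
  proof (intro exI[of _ e] conjI ballI impI e(1))
    fix s t assume st: "s \<in> I" "t \<in> I" "\<bar>s - t\<bar> < e"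
    then obtain r where r: "r \<in> I" "ball t e \<subseteq> ball r (d r)" using e(2)[of t] by auto
    have "s \<in> ball t e" "t \<in> ball t e" using st e(1) by (auto simp: dist_real_def)
    then have "s \<in> ball r (d r)" "t \<in> ball r (d r)" using r(2) by blast+
    then have "\<bar>s - r\<bar> < d r" "\<bar>t - r\<bar> < d r" by (auto simp: dist_real_def)
    then have "Lp_dist p M (\<phi> s) (\<phi> r) < \<epsilon>/2" "Lp_dist p M (\<phi> t) (\<phi> r) < \<epsilon>/2" using d(2) r(1) st by auto
    moreover have "Lp_dist p M (\<phi> s) (\<phi> t) \<le> Lp_dist p M (\<phi> s) (\<phi> r) + Lp_dist p M (\<phi> r) (\<phi> t)"
      by (intro Lp_dist_triangle Lp_continuous_on_Lp[OF \<phi>] st r(1))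
    ultimately show "Lp_dist p M (\<phi> s) (\<phi> t) < \<epsilon>" by (simp add: Lp_dist_commute[of "\<phi> r"])
  qed
qed

section \<open>Jointly measurable versions of curves\<close>

definition jointly_measurable :: "(real \<Rightarrow> 'a \<Rightarrow> real) \<Rightarrow> bool" where
  "jointly_measurable F \<longleftrightarrow> (\<lambda>(t, x). F t x) \<in> borel_measurable (lborel \<Otimes>\<^sub>M M)"

lemma jointly_measurableD1:
  assumes "jointly_measurable F"
  shows "F t \<in> borel_measurable M"
proof -
  note [measurable] = assms[unfolded jointly_measurable_def]
  have "(\<lambda>x. (\<lambda>(t, x). F t x) (t, x)) \<in> borel_measurable M" by measurable
  then show ?thesis by simp
qed

lemma jointly_measurableD2:
  assumes "jointly_measurable F" "x \<in> space M"
  shows "(\<lambda>t. F t x) \<in> borel_measurable lborel"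
proof -
  have "(\<lambda>t. (\<lambda>(t, x). F t x) (t, x)) \<in> borel_measurable lborel"
    using measurable_Pair1[OF assms[unfolded jointly_measurable_def]] by simp
  then show ?thesis by simp
qed

text \<open>The exceptional set may vary with t, and uncountably many null sets cannot be united.
  Fubini on the measurable set where F and G agree gives instead one null set of x, outside of which
  the slices agree at almost every time.\<close>

lemma AE_AE_commute:
  assumes F: "jointly_measurable F" and G: "jointly_measurable G" and I: "I \<in> sets borel"
    and eq: "\<And>t. t \<in> I \<Longrightarrow> AE x in M. F t x = G t x"
  shows "AE x in M. AE t in lborel. t \<in> I \<longrightarrow> F t x = G t x"
proof -
  interpret pair_sigma_finite lborel M ..
  note [measurable] = F[unfolded jointly_measurable_def] G[unfolded jointly_measurable_def] I
  have "(\<lambda>z. F (fst z) (snd z)) \<in> borel_measurable (lborel \<Otimes>\<^sub>M M)"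
    "(\<lambda>z. G (fst z) (snd z)) \<in> borel_measurable (lborel \<Otimes>\<^sub>M M)"
    using F G by (simp_all add: jointly_measurable_def split_beta)
  note [measurable] = this
  have "{z \<in> space (lborel \<Otimes>\<^sub>M M). fst z \<in> I \<longrightarrow> F (fst z) (snd z) = G (fst z) (snd z)} \<in> sets (lborel \<Otimes>\<^sub>M M)"
    by measurable
  moreover have "AE t in lborel. AE x in M. t \<in> I \<longrightarrow> F t x = G t x"
  proof (rule AE_I2)
    fix t show "AE x in M. t \<in> I \<longrightarrow> F t x = G t x"
      using eq by (cases "t \<in> I") auto
  qed
  ultimately show ?thesis using AE_commute[of "\<lambda>t x. t \<in> I \<longrightarrow> F t x = G t x"] by blast
qed

text \<open>The curve is sampled on ever finer time grids. Each sampled curve takes countably many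
  values, hence is jointly measurable, and the errors (1/2)^n are summable, which upgrades
  convergence in L^p to convergence at almost every x, for every t.\<close>

lemma jointly_measurable_version:
  assumes \<phi>: "Lp_continuous_on {0..T} \<phi>"
  shows "\<exists>G. jointly_measurable G \<and> (\<forall>t\<in>{0..T}. AE x in M. G t x = \<phi> t x)"
proof -
  have "\<forall>n::nat. \<exists>\<delta>>0. \<forall>s\<in>{0..T}. \<forall>t\<in>{0..T}. \<bar>s - t\<bar> < \<delta> \<longrightarrow> Lp_dist p M (\<phi> s) (\<phi> t) < (1/2)^n"
    using \<phi> by (intro allI Lp_uniformly_continuous) auto
  then obtain d where d: "\<And>n::nat. d n > 0"
    "\<And>n s t. s \<in> {0..T} \<Longrightarrow> t \<in> {0..T} \<Longrightarrow> \<bar>s - t\<bar> < d n \<Longrightarrow> Lp_dist p M (\<phi> s) (\<phi> t) < (1/2)^n"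
    by metis
  have "\<forall>n. \<exists>N::nat. N > 0 \<and> 1 / real N < d n"
  proof
    fix n
    obtain k where "1 / real (Suc k) < d n" using nat_approx_posE[OF d(1)] .
    then show "\<exists>N::nat. N > 0 \<and> 1 / real N < d n" by blast
  qed
  then obtain N where N: "\<And>n. N n > 0" "\<And>n. 1 / real (N n) < d n" by metis
  \<comment> \<open>t rounded down to a multiple of 1 / N n, a mesh below the modulus of continuity
    d n. Rounding down keeps the sample inside [0,T].\<close>
  define s where "s n t = real_of_int \<lfloor>t * real (N n)\<rfloor> / real (N n)" for n t
  \<comment> \<open>Grid points outside [0,T] also occur in the countable composition; the value 0
    there keeps every sample measurable.\<close>
  define \<phi>' where "\<phi>' t = (if t \<in> {0..T} then \<phi> t else (\<lambda>_. 0))" for t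
  define G where "G n t = \<phi>' (s n t)" for n t
  have [measurable]: "\<phi>' t \<in> borel_measurable M" for t
    using Lp_continuous_on_Lp[OF \<phi>, THEN Lp_measurable] by (auto simp: \<phi>'_def)
  have Gm: "(\<lambda>z. G n (fst z) (snd z)) \<in> borel_measurable (lborel \<Otimes>\<^sub>M M)" for n
    unfolding G_def s_def
    by (rule measurable_compose_countable[where f = "\<lambda>i z. \<phi>' (real_of_int i / real (N n)) (snd z)"]) measurable
  have s: "s n t \<in> {0..T}" "\<bar>s n t - t\<bar> < d n" if t: "t \<in> {0..T}" for n t
  proof -
    have Np: "real (N n) > 0" using N(1) by simp
    have "0 \<le> s n t" using t by (simp add: s_def)
    moreover have "s n t \<le> t" using Np by (simp add: s_def pos_divide_le_eq)
    moreover have "t * real (N n) < real_of_int \<lfloor>t * real (N n)\<rfloor> + 1" by linarith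
    then have "t < s n t + 1 / real (N n)" using Np by (simp add: s_def field_simps)
    ultimately show "s n t \<in> {0..T}" "\<bar>s n t - t\<bar> < d n" using N(2)[of n] t by auto
  qed
  define F where "F t x = lim (\<lambda>n. G n t x)" for t x
  have "(\<lambda>z. F (fst z) (snd z)) \<in> borel_measurable (lborel \<Otimes>\<^sub>M M)"
    unfolding F_def using Gm by measurable
  then have "jointly_measurable F" by (simp add: jointly_measurable_def split_beta)
  moreover have "AE x in M. F t x = \<phi> t x" if t: "t \<in> {0..T}" for t
  proof -
    have "Lp_le (1 * (1/2)^n) (\<lambda>x. G n t x - \<phi> t x)" for n
      using d(2)[OF s(1)[OF t] t s(2)[OF t], of n] s(1)[OF t, of n]
        Lp_diff[OF Lp_continuous_on_Lp[OF \<phi> s(1)[OF t]] Lp_continuous_on_Lp[OF \<phi> t], of n]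
      by (subst Lp_le_iff) (auto simp: G_def \<phi>'_def)
    then have "AE x in M. (\<lambda>n. G n t x - \<phi> t x) \<longlonglongrightarrow> 0" by (rule AE_tendsto_0_if_Lp_le) simp
    then show ?thesis
      by eventually_elim (simp add: F_def limI Lim_null[symmetric])
  qed
  ultimately show ?thesis by blast
qed

end

section \<open>Fractional integrals of real functions\<close>

text \<open>The reciprocal Gamma function is continuous in the order, which makes the kernel
  measurable when the order depends on x. Extension by 0 to r \<le> 0 turns fractional integrals
  into convolutions on the line. For b = 0 the kernel vanishes, as rGamma 0 = 0, and does not
  represent the identity.\<close>

definition rl_kernel :: "real \<Rightarrow> real \<Rightarrow> real" where
  "rl_kernel b r = (if 0 < r then r powr (b - 1) * rGamma b else 0)"

definition frac_integral :: "real \<Rightarrow> (real \<Rightarrow> real) \<Rightarrow> real \<Rightarrow> real" where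
  "frac_integral b h t = (LINT s|lborel. indicator {0..} s * (rl_kernel b (t - s) * h s))"

abbreviation frac_integrable :: "real \<Rightarrow> (real \<Rightarrow> real) \<Rightarrow> real \<Rightarrow> bool" where
  "frac_integrable b h t \<equiv> integrable lborel (\<lambda>s. indicator {0..} s * (rl_kernel b (t - s) * h s))"

lemma borel_measurable_rl_kernel [measurable (raw)]:
  assumes [measurable]: "f \<in> borel_measurable N" "g \<in> borel_measurable N"
  shows "(\<lambda>z. rl_kernel (f z) (g z)) \<in> borel_measurable N"
proof -
  have [measurable]: "(rGamma :: real \<Rightarrow> real) \<in> borel_measurable borel"
    by (intro borel_measurable_continuous_onI continuous_on_rGamma)
  show ?thesis unfolding rl_kernel_def by measurable
qed

lemma rGamma_real_pos: "0 < b \<Longrightarrow> 0 < rGamma (b :: real)"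
  using Gamma_real_pos[of b] by (simp add: rGamma_inverse_Gamma)

lemma rl_kernel_nonneg: "0 < b \<Longrightarrow> 0 \<le> rl_kernel b r"
  using rGamma_real_pos[of b] by (auto simp: rl_kernel_def)

lemma rl_kernel_1: "rl_kernel 1 r = indicator {0<..} r"
  by (simp add: rl_kernel_def rGamma_inverse_Gamma Gamma_1)

text \<open>The substitution r = s + d * x with d = t - s reduces the convolution to Beta b a times
  a power of d: the kernels contribute d powr (a + b - 2) and the substitution one more factor d.
  Nonnegative integrals avoid any prior integrability claim.\<close>

lemma rl_kernel_convolution:
  assumes a: "0 < a" and b: "0 < b"
  shows "(\<integral>\<^sup>+r. ennreal (rl_kernel a (t - r) * rl_kernel b (r - s)) \<partial>lborel) = ennreal (rl_kernel (a + b) (t - s))"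
proof (cases "s < t")
  case False
  then have "rl_kernel a (t - r) * rl_kernel b (r - s) = 0" for r by (simp add: rl_kernel_def)
  moreover have "rl_kernel (a + b) (t - s) = 0" using False by (simp add: rl_kernel_def)
  ultimately show ?thesis by (simp only: ennreal_0 nn_integral_const mult_zero_left)
next
  case True
  define d where "d = t - s"
  have d: "0 < d" using True by (simp add: d_def)
  define c where "c = d powr (a + b - 2) * (rGamma a * rGamma b)"
  have c: "0 \<le> c" using rGamma_real_pos[OF a] rGamma_real_pos[OF b] by (simp add: c_def)
  have eq: "rl_kernel a (t - (s + d * x)) * rl_kernel b (s + d * x - s)
      = c * (indicator {0..1} x * (x powr (b - 1) * (1 - x) powr (a - 1)))" for x
  proof -
    have 1: "t - (s + d * x) = d * (1 - x)" by (simp add: d_def algebra_simps)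
    have p: "d powr (a + b - 2) = d powr (a - 1) * d powr (b - 1)"
      by (simp add: algebra_simps flip: powr_add)
    consider "x \<le> 0" | "0 < x" "x < 1" | "1 \<le> x" by linarith
    then show ?thesis
    proof cases
      case 2
      then show ?thesis unfolding 1 using d
        by (simp add: rl_kernel_def c_def p powr_mult)
    qed (use d in \<open>auto simp: 1 rl_kernel_def zero_less_mult_iff indicator_def\<close>)
  qed
  have "(\<integral>\<^sup>+r. ennreal (rl_kernel a (t - r) * rl_kernel b (r - s)) \<partial>lborel)
      = ennreal d * (\<integral>\<^sup>+x. ennreal (rl_kernel a (t - (s + d * x)) * rl_kernel b (s + d * x - s)) \<partial>lborel)"
    using d by (subst nn_integral_real_affine[where c = d and t = s]) auto
  also have "(\<integral>\<^sup>+x. ennreal (rl_kernel a (t - (s + d * x)) * rl_kernel b (s + d * x - s)) \<partial>lborel)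
      = (\<integral>\<^sup>+x. ennreal c * ennreal (indicator {0..1} x * (x powr (b - 1) * (1 - x) powr (a - 1))) \<partial>lborel)"
    unfolding eq using c by (simp add: ennreal_mult)
  also have "\<dots> = ennreal c * (\<integral>\<^sup>+x. ennreal (indicator {0..1} x * (x powr (b - 1) * (1 - x) powr (a - 1))) \<partial>lborel)"
    by (intro nn_integral_cmult) auto
  also have "(\<integral>\<^sup>+x. ennreal (indicator {0..1} x * (x powr (b - 1) * (1 - x) powr (a - 1))) \<partial>lborel) = ennreal (Beta b a)"
    by (rule nn_integral_has_integral_lebesgue[OF _ has_integral_Beta_real[OF b a]]) auto
  also have "ennreal d * (ennreal c * ennreal (Beta b a)) = ennreal (rl_kernel (a + b) (t - s))"
  proof -
    have "Gamma a \<noteq> 0" "Gamma b \<noteq> 0" using Gamma_real_pos a b by (metis less_irrefl)+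
    then have "d * (c * Beta b a) = d * d powr (a + b - 2) * rGamma (a + b)"
      by (simp add: c_def Beta_def rGamma_inverse_Gamma field_simps add.commute[of b a])
    also have "d * d powr (a + b - 2) = d powr (a + b - 1)" using d
      by (simp add: powr_diff powr_numeral power2_eq_square)
    finally have "d * (c * Beta b a) = rl_kernel (a + b) (t - s)" using d by (simp add: rl_kernel_def d_def)
    moreover have "0 \<le> Beta b a" using Gamma_real_pos a b by (simp add: Beta_def less_imp_le)
    ultimately show ?thesis using d c by (simp flip: ennreal_mult)
  qed
  finally show ?thesis .
qed

text \<open>Fubini on the triangle of pairs s < r < t. Since the kernels are nonnegative,
  integrating |\<Phi>| over r first gives the integrand of order a + b in absolute value;
  integrability at that order, at the single time t, is therefore exactly what Fubini needs.\<close>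

lemma frac_integral_semigroup:
  assumes a: "0 < a" and b: "0 < b" and h[measurable]: "h \<in> borel_measurable lborel"
    and int: "frac_integrable (a + b) h t"
  shows "frac_integrable a (frac_integral b h) t"
    and "frac_integral a (frac_integral b h) t = frac_integral (a + b) h t"
proof -
  define \<Phi> where "\<Phi> s r = indicator {0..} s * h s * (rl_kernel a (t - r) * rl_kernel b (r - s))" for s r
  have [measurable]: "(\<lambda>z. \<Phi> (fst z) (snd z)) \<in> borel_measurable (lborel \<Otimes>\<^sub>M lborel)"
    unfolding \<Phi>_def by measurable
  then have m: "case_prod \<Phi> \<in> borel_measurable (lborel \<Otimes>\<^sub>M lborel)" by (simp add: split_beta)
  have conv: "integrable lborel (\<lambda>r. rl_kernel a (t - r) * rl_kernel b (r - s))"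
      "(LINT r|lborel. rl_kernel a (t - r) * rl_kernel b (r - s)) = rl_kernel (a + b) (t - s)" for s
    using rl_kernel_convolution[OF a b, of t s] rl_kernel_nonneg[OF a] rl_kernel_nonneg[OF b] rl_kernel_nonneg[of "a + b"] a b
    by (auto intro!: integrableI_nonneg simp: integral_eq_nn_integral)
  have "integrable lborel (\<lambda>s. LINT r|lborel. norm (\<Phi> s r))"
  proof (rule Bochner_Integration.integrable_cong[THEN iffD1, OF refl _ integrable_norm[OF int]])
    fix s
    have "norm (\<Phi> s r) = \<bar>indicator {0..} s * h s\<bar> * (rl_kernel a (t - r) * rl_kernel b (r - s))" for r
      using rl_kernel_nonneg[OF a] rl_kernel_nonneg[OF b] by (simp add: \<Phi>_def abs_mult)
    then show "norm (indicator {0..} s * (rl_kernel (a + b) (t - s) * h s)) = (LINT r|lborel. norm (\<Phi> s r))"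
      using conv(2)[of s] rl_kernel_nonneg[of "a + b" "t - s"] a b by (simp add: abs_mult)
  qed
  then have I: "integrable (lborel \<Otimes>\<^sub>M lborel) (case_prod \<Phi>)"
    using conv by (intro lborel_pair.Fubini_integrable m) (auto simp: \<Phi>_def)
  have inner: "(LINT s|lborel. \<Phi> s r) = indicator {0..} r * (rl_kernel a (t - r) * frac_integral b h r)" for r
  proof -
    \<comment> \<open>The factor indicator {0..} r may be inserted because for r < 0 \<le> s the
      kernel of order b already vanishes.\<close>
    have "\<Phi> s r = (indicator {0..} r * rl_kernel a (t - r)) * (indicator {0..} s * (rl_kernel b (r - s) * h s))" for s
      by (auto simp: \<Phi>_def indicator_def rl_kernel_def)
    then show ?thesis by (simp add: frac_integral_def)
  qed
  show "frac_integrable a (frac_integral b h) t"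
    using lborel_pair.integrable_snd[OF I] by (simp add: inner)
  have "(LINT r|lborel. LINT s|lborel. \<Phi> s r) = (LINT s|lborel. LINT r|lborel. \<Phi> s r)"
    by (rule lborel_pair.Fubini_integral[OF I])
  moreover have "(LINT r|lborel. \<Phi> s r) = indicator {0..} s * (rl_kernel (a + b) (t - s) * h s)" for s
    using conv(2)[of s] by (simp add: \<Phi>_def)
  ultimately show "frac_integral a (frac_integral b h) t = frac_integral (a + b) h t"
    by (simp add: inner) (simp add: frac_integral_def)
qed

lemma RL_integral_eq_frac_integral:
  assumes \<phi>[measurable]: "(\<lambda>s. \<phi> s x) \<in> borel_measurable lborel" and b: "\<beta> x \<noteq> 0"
  shows "RL_integral \<beta> \<phi> t x = frac_integral (\<beta> x) (\<lambda>s. \<phi> s x) t"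
proof -
  have "(LINT s:{0..t}|lebesgue. (t - s) powr (\<beta> x - 1) * \<phi> s x)
      = (LINT s:{0..t}|lborel. (t - s) powr (\<beta> x - 1) * \<phi> s x)"
    unfolding set_lebesgue_integral_def by (intro integral_completion) measurable
  then have "RL_integral \<beta> \<phi> t x = (LINT s|lborel. rGamma (\<beta> x) * (indicator {0..t} s * ((t - s) powr (\<beta> x - 1) * \<phi> s x)))"
    using b by (simp add: RL_integral_def set_lebesgue_integral_def rGamma_inverse_Gamma divide_inverse)
  also have "\<dots> = frac_integral (\<beta> x) (\<lambda>s. \<phi> s x) t"
    unfolding frac_integral_def by (intro Bochner_Integration.integral_cong) (auto simp: rl_kernel_def indicator_def)
  finally show ?thesis .
qed

lemma RL_integral_existsI:
  assumes \<phi>[measurable]: "(\<lambda>s. \<phi> s x) \<in> borel_measurable lborel" and b: "0 < \<beta> x"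
    and int: "frac_integrable (\<beta> x) (\<lambda>s. \<phi> s x) t"
  shows "RL_integral_exists \<beta> \<phi> t x"
proof -
  have "integrable lborel (\<lambda>s. Gamma (\<beta> x) * (indicator {0..} s * (rl_kernel (\<beta> x) (t - s) * \<phi> s x)))"
    using int by simp
  moreover have "Gamma (\<beta> x) \<noteq> 0" using Gamma_real_pos[OF b] by simp
  then have "Gamma (\<beta> x) * (indicator {0..} s * (rl_kernel (\<beta> x) (t - s) * \<phi> s x))
      = indicator {0..t} s *\<^sub>R ((t - s) powr (\<beta> x - 1) * \<phi> s x)" for s
    by (auto simp: rl_kernel_def rGamma_inverse_Gamma indicator_def)
  ultimately have "integrable lborel (\<lambda>s. indicator {0..t} s *\<^sub>R ((t - s) powr (\<beta> x - 1) * \<phi> s x))" by simp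
  then have "set_integrable lebesgue {0..t} (\<lambda>s. (t - s) powr (\<beta> x - 1) * \<phi> s x)"
    unfolding set_integrable_def by (subst integrable_completion) auto
  then show ?thesis by (simp add: RL_integral_exists_def)
qed

text \<open>For orders at least 1 the kernel is not singular and is bounded on [0,t], so plain
  integrability is enough. This serves the orders 1 and 1 + \<alpha>(x) that arise from the
  semigroup law.\<close>

lemma frac_integrable_ge_1:
  assumes b: "1 \<le> b" and h: "integrable lborel (\<lambda>s. indicator {0..t} s * h s)" and hm[measurable]: "h \<in> borel_measurable lborel"
  shows "frac_integrable b h t"
proof (rule Bochner_Integration.integrable_bound)
  show "integrable lborel (\<lambda>s. (t powr (b - 1) * rGamma b) * (indicator {0..t} s * h s))"
    using h by simp
  show "AE s in lborel. norm (indicator {0..} s * (rl_kernel b (t - s) * h s))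
      \<le> norm (t powr (b - 1) * rGamma b * (indicator {0..t} s * h s))"
  proof (rule AE_I2)
    fix s
    have "(t - s) powr (b - 1) \<le> t powr (b - 1)" if "0 \<le> s" "s < t"
      using that b by (intro powr_mono2) auto
    then show "norm (indicator {0..} s * (rl_kernel b (t - s) * h s))
      \<le> norm (t powr (b - 1) * rGamma b * (indicator {0..t} s * h s))"
      using rGamma_real_pos[of b] b
      by (auto simp: rl_kernel_def indicator_def abs_mult intro!: mult_right_mono)
  qed
qed measurable

text \<open>One constant serves all orders in \<open>[\<alpha>\<^sub>0, 1]\<close>: rGamma is
  continuous, hence bounded on this compact interval, and for r \<le> 1 the most singular power is
  the one of order \<open>\<alpha>\<^sub>0\<close>. The second bound compares increments of kernels
  and leads to continuity in time.\<close>

lemma rl_kernel_bound: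
  assumes "0 < \<alpha>\<^sub>0"
  obtains C where "0 < C" "\<And>b r. \<alpha>\<^sub>0 \<le> b \<Longrightarrow> b \<le> 1 \<Longrightarrow> r \<le> 1 \<Longrightarrow> rl_kernel b r \<le> C * (indicator {0<..} r * r powr (\<alpha>\<^sub>0 - 1))"
    "\<And>b r h. \<alpha>\<^sub>0 \<le> b \<Longrightarrow> b \<le> 1 \<Longrightarrow> 0 \<le> h \<Longrightarrow> 0 < r \<Longrightarrow> r + h \<le> 1 \<Longrightarrow> \<bar>rl_kernel b (r + h) - rl_kernel b r\<bar>
      \<le> C * (r powr (\<alpha>\<^sub>0 - 1) - (r + h) powr (\<alpha>\<^sub>0 - 1))"
proof -
  have "compact (rGamma ` {\<alpha>\<^sub>0..1::real})"
    by (intro compact_continuous_image continuous_on_rGamma) auto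
  then obtain C where C: "\<And>b. b \<in> {\<alpha>\<^sub>0..1} \<Longrightarrow> \<bar>rGamma b\<bar> \<le> C"
    unfolding bounded_iff using compact_imp_bounded by (force simp: bounded_iff)
  define C' where "C' = max C 1"
  have C': "0 < C'" "\<And>b. \<alpha>\<^sub>0 \<le> b \<Longrightarrow> b \<le> 1 \<Longrightarrow> 0 < rGamma b \<and> rGamma b \<le> C'"
    using C rGamma_real_pos assms by (force simp: C'_def)+
  show ?thesis
  proof (rule that[OF C'(1)])
    fix b r :: real assume b: "\<alpha>\<^sub>0 \<le> b" "b \<le> 1" and r: "r \<le> 1"
    have "r powr (b - 1) * rGamma b \<le> r powr (\<alpha>\<^sub>0 - 1) * C'" if "0 < r"
      using C'(2)[OF b] that b r by (intro mult_mono powr_mono') auto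
    then show "rl_kernel b r \<le> C' * (indicator {0<..} r * r powr (\<alpha>\<^sub>0 - 1))"
      by (auto simp: rl_kernel_def mult.commute)
  next
    fix b r h :: real assume b: "\<alpha>\<^sub>0 \<le> b" "b \<le> 1" and h: "0 \<le> h" "0 < r" "r + h \<le> 1"
    have mono: "(r + h) powr (b - 1) \<le> r powr (b - 1)" using h b by (intro powr_mono2') auto
    \<comment> \<open>\<open>r powr (\<alpha>\<^sub>0 - 1) - r powr (b - 1)\<close> factors as
      \<open>r powr (b - 1) * (r powr (\<alpha>\<^sub>0 - b) - 1)\<close>. On (0,1] both factors are
      nonnegative and nonincreasing, hence so is the difference; this compares the two
      increments.\<close>
    have "(r + h) powr (b - 1) * ((r + h) powr (\<alpha>\<^sub>0 - b) - 1) \<le> r powr (b - 1) * (r powr (\<alpha>\<^sub>0 - b) - 1)"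
    proof (rule mult_mono[OF mono])
      show "(r + h) powr (\<alpha>\<^sub>0 - b) - 1 \<le> r powr (\<alpha>\<^sub>0 - b) - 1" using h b by (auto intro: powr_mono2')
      have "1 powr (\<alpha>\<^sub>0 - b) \<le> (r + h) powr (\<alpha>\<^sub>0 - b)" using h b by (intro powr_mono2') auto
      then show "0 \<le> (r + h) powr (\<alpha>\<^sub>0 - b) - 1" by simp
    qed auto
    then have "r powr (b - 1) - (r + h) powr (b - 1) \<le> r powr (\<alpha>\<^sub>0 - 1) - (r + h) powr (\<alpha>\<^sub>0 - 1)"
      by (simp add: right_diff_distrib flip: powr_add)
    then have "rGamma b * (r powr (b - 1) - (r + h) powr (b - 1)) \<le> C' * (r powr (\<alpha>\<^sub>0 - 1) - (r + h) powr (\<alpha>\<^sub>0 - 1))"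
      using C'(2)[OF b] mono by (intro mult_mono) auto
    moreover have "\<bar>rl_kernel b (r + h) - rl_kernel b r\<bar> = rGamma b * (r powr (b - 1) - (r + h) powr (b - 1))"
      using h C'(2)[OF b] mult_right_mono[OF mono, of "rGamma b"] by (auto simp: rl_kernel_def algebra_simps)
    ultimately show "\<bar>rl_kernel b (r + h) - rl_kernel b r\<bar> \<le> C' * (r powr (\<alpha>\<^sub>0 - 1) - (r + h) powr (\<alpha>\<^sub>0 - 1))" by simp
  qed
qed

text \<open>If t = t' and a < 1 the integrand is unbounded near s = t, hence the interior form of
  the fundamental theorem, with a primitive continuous on the closed interval. Keeping t and t'
  apart lets increments of the kernel be integrated too.\<close>

lemma powr_weight_integral:
  assumes a: "0 < a" and t: "0 \<le> t" "t \<le> t'"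
  shows "has_bochner_integral lborel (\<lambda>s. indicator {0..<t} s * (t' - s) powr (a - 1) :: real) ((t' powr a - (t' - t) powr a) / a)"
proof (rule has_bochner_integral_nn_integral)
  have "((\<lambda>s. (t' - s) powr (a - 1)) has_integral (- ((t' - t) powr a) / a - (- ((t' - 0) powr a) / a))) {0..t}"
  proof (rule fundamental_theorem_of_calculus_interior)
    show "continuous_on {0..t} (\<lambda>s. - ((t' - s) powr a) / a)"
      using a t by (intro continuous_on_powr' continuous_intros) auto
    fix s assume s: "s \<in> {0<..<t}"
    have "((\<lambda>s. - ((t' - s) powr a) / a) has_real_derivative (t' - s) powr (a - 1)) (at s)"
      using a t s by (auto intro!: derivative_eq_intros simp: powr_diff field_simps)
    then show "((\<lambda>s. - ((t' - s) powr a) / a) has_vector_derivative (t' - s) powr (a - 1)) (at s)"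
      by (simp add: has_real_derivative_iff_has_vector_derivative)
  qed (use t in auto)
  then have "(\<integral>\<^sup>+s. ennreal (indicator {0..t} s * (t' - s) powr (a - 1)) \<partial>lborel)
      = ennreal (- ((t' - t) powr a) / a - (- ((t' - 0) powr a) / a))"
    by (rule nn_integral_has_integral_lebesgue[rotated]) auto
  moreover have "(\<integral>\<^sup>+s. ennreal (indicator {0..<t} s * (t' - s) powr (a - 1)) \<partial>lborel)
      = (\<integral>\<^sup>+s. ennreal (indicator {0..t} s * (t' - s) powr (a - 1)) \<partial>lborel)"
    using AE_lborel_singleton[of t] by (intro nn_integral_cong_AE) (auto simp: indicator_def)
  ultimately show "(\<integral>\<^sup>+s. ennreal (indicator {0..<t} s * (t' - s) powr (a - 1)) \<partial>lborel) = ennreal ((t' powr a - (t' - t) powr a) / a)"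
    by (simp add: diff_divide_distrib)
  show "0 \<le> (t' powr a - (t' - t) powr a) / a" using a t by (simp add: powr_mono2)
qed (use a in auto)

lemma frac_integral_1_diff:
  assumes i: "integrable lborel (\<lambda>s. indicator {0..T} s * h s)" and t: "0 \<le> a" "a \<le> b" "b \<le> T"
    and hm[measurable]: "h \<in> borel_measurable lborel"
  shows "integrable lborel (\<lambda>s. indicator {a..<b} s * h s)"
    and "frac_integral 1 h b - frac_integral 1 h a = (LINT s|lborel. indicator {a..<b} s * h s)"
proof -
  have ii: "integrable lborel (\<lambda>s. indicator {c..<d} s * h s)" if "0 \<le> c" "d \<le> T" for c d
    by (rule Bochner_Integration.integrable_bound[OF i]) (use that in \<open>auto simp: indicator_def\<close>)
  then show "integrable lborel (\<lambda>s. indicator {a..<b} s * h s)" using t by auto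
  have eq: "frac_integral 1 h c = (LINT s|lborel. indicator {0..<c} s * h s)" for c
    unfolding frac_integral_def by (intro Bochner_Integration.integral_cong) (auto simp: rl_kernel_1 indicator_def)
  have "indicator {a..<b} s * h s = indicator {0..<b} s * h s - indicator {0..<a} s * h s" for s
    using t by (auto simp: indicator_def)
  then show "frac_integral 1 h b - frac_integral 1 h a = (LINT s|lborel. indicator {a..<b} s * h s)"
    using ii[of 0 b] ii[of 0 a] t by (simp add: eq)
qed

lemma frac_integral_0: "frac_integral b h 0 = 0"
proof -
  have "(\<lambda>s. indicator {0..} s * (rl_kernel b (0 - s) * h s)) = (\<lambda>s. 0)"
    by (simp add: rl_kernel_def indicator_def fun_eq_iff)
  then show ?thesis unfolding frac_integral_def by simp
qed

lemma indicator_integrable_subset: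
  fixes h :: "real \<Rightarrow> real"
  assumes "integrable lborel (\<lambda>s. indicator {0..T} s * h s)" "t \<le> T"
  shows "integrable lborel (\<lambda>s. indicator {0..t} s * h s)"
proof -
  have "integrable lborel (\<lambda>s. indicator {0..t} s *\<^sub>R (indicator {0..T} s * h s))"
    using assms(1) by (rule integrable_mult_indicator[rotated]) auto
  moreover have "indicator {0..t} s *\<^sub>R (indicator {0..T} s * h s) = indicator {0..t} s * h s" for s
    using assms(2) by (auto simp: indicator_def)
  ultimately show ?thesis by (simp only:)
qed

lemma frac_integral_cong_AE:
  assumes [measurable]: "h \<in> borel_measurable lborel" "k \<in> borel_measurable lborel"
    and eq: "AE s in lborel. s \<in> {0..T} \<longrightarrow> h s = k s" and t: "t \<le> T"
  shows "frac_integral b h t = frac_integral b k t"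
  unfolding frac_integral_def
proof (rule integral_cong_AE)
  show "AE s in lborel. indicator {0..} s * (rl_kernel b (t - s) * h s) = indicator {0..} s * (rl_kernel b (t - s) * k s)"
    using eq by eventually_elim (use t in \<open>auto simp: indicator_def rl_kernel_def\<close>)
qed measurable

section \<open>Differentiation of curves in \<open>L\<^sup>p\<close>\<close>

context Lp_space
begin

lemma jointly_measurable_frac_integral:
  assumes F: "jointly_measurable F" and \<beta>[measurable]: "\<beta> \<in> borel_measurable M"
  shows "jointly_measurable (\<lambda>t x. frac_integral (\<beta> x) (\<lambda>s. F s x) t)"
proof -
  have F'[measurable]: "(\<lambda>z. F (fst z) (snd z)) \<in> borel_measurable (lborel \<Otimes>\<^sub>M M)"
    using F by (simp add: jointly_measurable_def split_beta)
  have [measurable]: "(\<lambda>w. F (snd w) (snd (fst w))) \<in> borel_measurable ((lborel \<Otimes>\<^sub>M M) \<Otimes>\<^sub>M lborel)"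
    using measurable_compose[OF _ F', of "\<lambda>w. (snd w, snd (fst w))" "(lborel \<Otimes>\<^sub>M M) \<Otimes>\<^sub>M lborel"] by simp
  show ?thesis
    unfolding jointly_measurable_def frac_integral_def split_beta by measurable
qed

lemma jointly_measurable_diff:
  assumes "jointly_measurable F" "jointly_measurable G"
  shows "jointly_measurable (\<lambda>t x. F t x - G t x)"
  using borel_measurable_diff[OF assms[unfolded jointly_measurable_def]]
  by (simp add: jointly_measurable_def split_beta)

lemma jointly_measurable_add:
  assumes "jointly_measurable F" "jointly_measurable G"
  shows "jointly_measurable (\<lambda>t x. F t x + G t x)"
  using borel_measurable_add[OF assms[unfolded jointly_measurable_def]]
  by (simp add: jointly_measurable_def split_beta)

lemma jointly_measurable_const:
  assumes [measurable]: "u \<in> borel_measurable M"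
  shows "jointly_measurable (\<lambda>t. u)"
  unfolding jointly_measurable_def split_beta by measurable

lemma continuous_on_Lp_norm:
  assumes "Lp_continuous_on I \<phi>"
  shows "continuous_on I (\<lambda>t. Lp_norm p M (\<phi> t))"
  unfolding continuous_on_def
proof
  fix t assume t: "t \<in> I"
  note m = Lp_continuous_on_Lp[OF assms]
  have "\<bar>Lp_norm p M (\<phi> s) - Lp_norm p M (\<phi> t)\<bar> \<le> Lp_dist p M (\<phi> s) (\<phi> t)" if "s \<in> I" for s
    using Lp_norm_add_le[OF Lp_diff[OF m[OF that] m[OF t]] m[OF t]]
      Lp_norm_add_le[OF Lp_diff[OF m[OF t] m[OF that]] m[OF that]] by (simp add: Lp_dist_commute[of "\<phi> t"])
  then have "\<forall>\<^sub>F s in at t within I. norm (Lp_norm p M (\<phi> s) - Lp_norm p M (\<phi> t)) \<le> Lp_dist p M (\<phi> s) (\<phi> t)"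
    by (auto simp: eventually_at_filter)
  moreover have "((\<lambda>s. Lp_dist p M (\<phi> s) (\<phi> t)) \<longlongrightarrow> 0) (at t within I)"
    using assms t by (simp add: Lp_continuous_on_def)
  ultimately have "((\<lambda>s. Lp_norm p M (\<phi> s) - Lp_norm p M (\<phi> t)) \<longlongrightarrow> 0) (at t within I)"
    by (rule Lim_null_comparison)
  then show "((\<lambda>s. Lp_norm p M (\<phi> s)) \<longlongrightarrow> Lp_norm p M (\<phi> t)) (at t within I)"
    by (simp add: Lim_null[of _ "Lp_norm p M (\<phi> t)"])
qed

lemma Lp_bounded_on_compact:
  assumes "Lp_continuous_on I \<phi>" "compact I"
  obtains B where "0 < B" "\<And>t. t \<in> I \<Longrightarrow> Lp_le B (\<phi> t)"
proof -
  have "bounded ((\<lambda>t. Lp_norm p M (\<phi> t)) ` I)"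
    by (intro compact_imp_bounded compact_continuous_image continuous_on_Lp_norm assms)
  then obtain B where B: "B > 0" "\<And>t. t \<in> I \<Longrightarrow> \<bar>Lp_norm p M (\<phi> t)\<bar> \<le> B"
    by (auto simp: bounded_pos)
  show ?thesis
  proof (rule that[OF B(1)])
    fix t assume "t \<in> I"
    then show "Lp_le B (\<phi> t)"
      using B Lp_continuous_on_Lp[OF assms(1), of t] by (subst Lp_le_iff) (auto intro: abs_le_D1)
  qed
qed

section \<open>Primitives in time and their L^p derivatives\<close>

lemma AE_integrable_in_time:
  assumes F: "jointly_measurable F" and B: "0 \<le> B" "\<And>s. s \<in> {0..T} \<Longrightarrow> Lp_le B (F s)"
  shows "AE x in M. integrable lborel (\<lambda>s. indicator {0..T} s * F s x)"
  by (rule Lp_le_average(1)[where B = B])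
    (use F B in \<open>auto simp: jointly_measurable_def split: split_indicator_asm
      intro!: integrable_real_indicator emeasure_compact_finite lborel.sigma_finite_measure_axioms\<close>)

text \<open>The left-over of the increment is the integral of F r - u over [a,b), an average with
  mass b - a. With u = F t this gives differentiability of the primitive, with u = 0 and a = 0 its
  membership in L^p.\<close>

lemma Lp_le_integral_increment:
  assumes F: "jointly_measurable F"
    and B: "0 \<le> B" "\<And>s. s \<in> {0..T} \<Longrightarrow> Lp_le B (F s)"
    and ab: "0 \<le> a" "a \<le> b" "b \<le> T" and u: "u \<in> borel_measurable M"
    and e: "0 \<le> e" "\<And>r. a \<le> r \<Longrightarrow> r \<le> b \<Longrightarrow> Lp_le e (\<lambda>x. F r x - u x)"
  shows "Lp_le (e * (b - a))
    (\<lambda>x. frac_integral 1 (\<lambda>s. F s x) b - frac_integral 1 (\<lambda>s. F s x) a - (b - a) * u x)"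
proof -
  let ?P = "\<lambda>t x. frac_integral 1 (\<lambda>s. F s x) t"
  have Pm: "jointly_measurable ?P" by (rule jointly_measurable_frac_integral[OF F]) auto
  have int: "AE x in M. integrable lborel (\<lambda>s. indicator {0..T} s * F s x)"
    by (rule AE_integrable_in_time[OF F B])
  have m: "jointly_measurable (\<lambda>r x. F r x - u x)"
    by (intro jointly_measurable_diff F jointly_measurable_const u)
  have w: "has_bochner_integral lborel (indicator {a..<b} :: real \<Rightarrow> real) (b - a)"
    using has_bochner_integral_real_indicator[of "{a..<b}" lborel] ab by simp
  have "Lp_le (e * (LINT s|lborel. indicator {a..<b} s)) (\<lambda>x. ?P b x - ?P a x - (b - a) * u x)"
  proof (rule Lp_le_average(2)[where g = "\<lambda>r x. F r x - u x"])
    show "integrable lborel (indicator {a..<b} :: real \<Rightarrow> real)" using w by (rule integrable.intros)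
    show "(\<lambda>(s, x). F s x - u x) \<in> borel_measurable (lborel \<Otimes>\<^sub>M M)" using m by (simp add: jointly_measurable_def)
    show "Lp_le e (\<lambda>x. F s x - u x)" if "indicator {a..<b} s \<noteq> (0::real)" for s
      using e that by (auto split: split_indicator_asm)
    show "(\<lambda>x. ?P b x - ?P a x - (b - a) * u x) \<in> borel_measurable M"
      using jointly_measurableD1[OF Pm] u by measurable
    show "AE x in M. \<bar>?P b x - ?P a x - (b - a) * u x\<bar> \<le> (LINT s|lborel. indicator {a..<b} s * \<bar>F s x - u x\<bar>)"
      using int AE_space
    proof eventually_elim
      case (elim x)
      note * = frac_integral_1_diff[OF elim(1) ab jointly_measurableD2[OF F elim(2)]]
      have wu: "has_bochner_integral lborel (\<lambda>s. indicator {a..<b} s * u x) ((b - a) * u x)"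
        by (rule has_bochner_integral_mult_left) (rule w)
      have "?P b x - ?P a x - (b - a) * u x = (LINT s|lborel. indicator {a..<b} s * F s x - indicator {a..<b} s * u x)"
        unfolding Bochner_Integration.integral_diff[OF *(1) integrable.intros[OF wu]]
          has_bochner_integral_integral_eq[OF wu] *(2) ..
      also have "\<bar>\<dots>\<bar> \<le> (LINT s|lborel. \<bar>indicator {a..<b} s * F s x - indicator {a..<b} s * u x\<bar>)"
        by (rule integral_abs_bound)
      also have "\<dots> = (LINT s|lborel. indicator {a..<b} s * \<bar>F s x - u x\<bar>)"
        by (intro Bochner_Integration.integral_cong) (auto simp: indicator_def)
      finally show ?case .
    qed
  qed (use e in \<open>auto intro: lborel.sigma_finite_measure_axioms\<close>)
  then show ?thesis using w by (simp add: has_bochner_integral_iff)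
qed

lemma has_Lp_derivative_integral:
  assumes F: "jointly_measurable F" and c: "Lp_continuous_on {0..T} F" and t: "t \<in> {0..T}"
  shows "has_Lp_derivative p M (\<lambda>t x. frac_integral 1 (\<lambda>s. F s x) t) (F t) t {0..T}"
proof -
  let ?P = "\<lambda>t x. frac_integral 1 (\<lambda>s. F s x) t"
  obtain B where B: "0 < B" "\<And>t. t \<in> {0..T} \<Longrightarrow> Lp_le B (F t)"
    using Lp_bounded_on_compact[OF c] by auto
  have Ft: "F t \<in> Lp p M" using c t by (rule Lp_continuous_on_Lp)
  have P: "?P s \<in> Lp p M" if s: "s \<in> {0..T}" for s
  proof -
    have "Lp_le (B * (s - 0)) (\<lambda>x. ?P s x - ?P 0 x - (s - 0) * 0)"
      by (rule Lp_le_integral_increment[OF F _ B(2)]) (use s B in auto)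
    then show ?thesis
      using B s Lp_le_imp_Lp by (simp add: frac_integral_0)
  qed
  have "((\<lambda>s. Lp_dist p M (\<lambda>x. (?P s x - ?P t x) / (s - t)) (F t)) \<longlongrightarrow> 0) (at t within {0..T})"
  proof (rule tendstoI)
    fix e :: real assume e: "0 < e"
    then obtain d where d: "d > 0" "\<And>s. s \<in> {0..T} \<Longrightarrow> \<bar>s - t\<bar> < d \<Longrightarrow> Lp_dist p M (F s) (F t) < e / 2"
      using c t unfolding Lp_continuous_on_eps by (meson half_gt_zero)
    have "Lp_dist p M (\<lambda>x. (?P s x - ?P t x) / (s - t)) (F t) < e"
      if s: "s \<in> {0..T}" "s \<noteq> t" "\<bar>s - t\<bar> < d" for s
    proof -
      \<comment> \<open>s may lie on either side of t; the difference quotient is symmetric, so it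
        can be computed with ordered end points.\<close>
      define a b where "a = min s t" and "b = max s t"
      have ab: "0 \<le> a" "a < b" "b \<le> T" "b - a < d" using s t by (auto simp: a_def b_def min_def max_def)
      have "Lp_le (e/2 * (b - a)) (\<lambda>x. ?P b x - ?P a x - (b - a) * F t x)"
      proof (rule Lp_le_integral_increment[OF F _ B(2)])
        fix r assume r: "a \<le> r" "r \<le> b"
        then have "r \<in> {0..T}" "\<bar>r - t\<bar> < d" using ab by (auto simp: a_def b_def)
        then show "Lp_le (e/2) (\<lambda>x. F r x - F t x)"
          using d(2)[of r] e Lp_diff[OF Lp_continuous_on_Lp[OF c] Ft, of r] by (subst Lp_le_iff) auto
      qed (use B ab e Ft in \<open>auto intro: Lp_measurable\<close>)
      then have "Lp_le (\<bar>1 / (b - a)\<bar> * (e/2 * (b - a))) (\<lambda>x. 1 / (b - a) * (?P b x - ?P a x - (b - a) * F t x))"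
        using ab e by (intro Lp_le_cmult) auto
      moreover have "\<bar>1 / (b - a)\<bar> * (e/2 * (b - a)) = e / 2" using ab by simp
      moreover have "1 / (b - a) * (?P b x - ?P a x - (b - a) * F t x) = (?P s x - ?P t x) / (s - t) - F t x" for x
      proof -
        have "(?P b x - ?P a x) / (b - a) = (?P s x - ?P t x) / (s - t)"
          using minus_divide_divide[of "?P s x - ?P t x" "s - t"] by (simp add: a_def b_def min_def max_def)
        then show ?thesis using ab by (simp add: diff_divide_distrib)
      qed
      ultimately have "Lp_le (e / 2) (\<lambda>x. (?P s x - ?P t x) / (s - t) - F t x)" by (simp only:)
      then have "Lp_dist p M (\<lambda>x. (?P s x - ?P t x) / (s - t)) (F t) \<le> e / 2" using e by (intro Lp_le_imp_norm) auto
      then show ?thesis using e by simp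
    qed
    then show "\<forall>\<^sub>F s in at t within {0..T}. dist (Lp_dist p M (\<lambda>x. (?P s x - ?P t x) / (s - t)) (F t)) 0 < e"
      unfolding eventually_at using d(1) by (intro exI[of _ d]) (auto simp: dist_real_def Lp_norm_nonneg)
  qed
  with P Ft show ?thesis by (simp add: has_Lp_derivative_def)
qed

lemma has_Lp_derivative_cong_AE:
  assumes F: "has_Lp_derivative p M F G t I" and t: "t \<in> I"
    and F': "\<And>s. s \<in> I \<Longrightarrow> F' s \<in> borel_measurable M" "\<And>s. s \<in> I \<Longrightarrow> AE x in M. F' s x = F s x"
    and G': "G' \<in> borel_measurable M" "AE x in M. G' x = G x"
  shows "has_Lp_derivative p M F' G' t I"
proof -
  have FL: "F s \<in> Lp p M" if "s \<in> I" for s using F that by (simp add: has_Lp_derivative_def)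
  have GL: "G \<in> Lp p M" using F by (simp add: has_Lp_derivative_def)
  note m = F'(1)[OF t] G'(1) FL[OF t, THEN Lp_measurable] GL[THEN Lp_measurable]
  have "Lp_dist p M (\<lambda>x. (F' s x - F' t x) / (s - t)) G' = Lp_dist p M (\<lambda>x. (F s x - F t x) / (s - t)) G"
    if s: "s \<in> I" for s
  proof (rule Lp_norm_cong_AE)
    show "AE x in M. (F' s x - F' t x) / (s - t) - G' x = (F s x - F t x) / (s - t) - G x"
      using F'(2)[OF s] F'(2)[OF t] G'(2) by eventually_elim simp
  qed (use m F'(1)[OF s] FL[OF s, THEN Lp_measurable] in measurable)
  then have "\<forall>\<^sub>F s in at t within I. Lp_dist p M (\<lambda>x. (F s x - F t x) / (s - t)) G
      = Lp_dist p M (\<lambda>x. (F' s x - F' t x) / (s - t)) G'"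
    by (auto simp: eventually_at_filter)
  then have "((\<lambda>s. Lp_dist p M (\<lambda>x. (F' s x - F' t x) / (s - t)) G') \<longlongrightarrow> 0) (at t within I)"
    using F by (rule_tac Lim_transform_eventually) (auto simp: has_Lp_derivative_def)
  then show ?thesis
    using Lp_cong_AE[OF FL F'(1) F'(2)] Lp_cong_AE[OF GL G'] by (simp add: has_Lp_derivative_def)
qed

lemma has_Lp_derivative_diff:
  assumes 1: "has_Lp_derivative p M F G t I" and 2: "has_Lp_derivative p M F' G' t I" and t: "t \<in> I"
  shows "has_Lp_derivative p M (\<lambda>s x. F s x - F' s x) (\<lambda>x. G x - G' x) t I"
proof -
  have L: "F s \<in> Lp p M" "F' s \<in> Lp p M" "G \<in> Lp p M" "G' \<in> Lp p M" if "s \<in> I" for s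
    using 1 2 that by (auto simp: has_Lp_derivative_def)
  have quot: "(\<lambda>x. (H s x - H t x) / (s - t)) \<in> Lp p M"
    if "H s \<in> Lp p M" "H t \<in> Lp p M" for H s
    using Lp_cmult[OF Lp_diff[OF that], of "1 / (s - t)"] by simp
  have "Lp_dist p M (\<lambda>x. (F s x - F' s x - (F t x - F' t x)) / (s - t)) (\<lambda>x. G x - G' x)
      \<le> Lp_dist p M (\<lambda>x. (F s x - F t x) / (s - t)) G + Lp_dist p M G' (\<lambda>x. (F' s x - F' t x) / (s - t))"
    if s: "s \<in> I" for s
  proof -
    have "(F s x - F' s x - (F t x - F' t x)) / (s - t) - (G x - G' x)
      = ((F s x - F t x) / (s - t) - G x) + (G' x - (F' s x - F' t x) / (s - t))" for x
      by (simp add: diff_divide_distrib)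
    then show ?thesis
      using Lp_norm_add_le[OF Lp_diff[OF quot[OF L(1)[OF s] L(1)[OF t]] L(3)[OF t]] Lp_diff[OF L(4)[OF t] quot[OF L(2)[OF s] L(2)[OF t]]]]
      by presburger
  qed
  then have *: "\<forall>\<^sub>F s in at t within I. norm (Lp_dist p M (\<lambda>x. (F s x - F' s x - (F t x - F' t x)) / (s - t)) (\<lambda>x. G x - G' x))
      \<le> Lp_dist p M (\<lambda>x. (F s x - F t x) / (s - t)) G + Lp_dist p M G' (\<lambda>x. (F' s x - F' t x) / (s - t))"
    by (auto simp: eventually_at_filter Lp_norm_nonneg)
  have "((\<lambda>s. Lp_dist p M (\<lambda>x. (F s x - F t x) / (s - t)) G + Lp_dist p M G' (\<lambda>x. (F' s x - F' t x) / (s - t))) \<longlongrightarrow> 0 + 0) (at t within I)"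
    using 1 2 by (intro tendsto_add) (auto simp: has_Lp_derivative_def Lp_dist_commute[of G'])
  then have "((\<lambda>s. Lp_dist p M (\<lambda>x. (F s x - F' s x - (F t x - F' t x)) / (s - t)) (\<lambda>x. G x - G' x)) \<longlongrightarrow> 0) (at t within I)"
    by (intro Lim_null_comparison[OF *]) simp
  then show ?thesis using L t by (simp add: has_Lp_derivative_def Lp_diff)
qed

text \<open>The real function \<open>t \<mapsto> \<parallel>H t\<parallel>\<close> has derivative zero.\<close>

lemma has_Lp_derivative_zero_imp_zero:
  assumes H: "\<And>t. t \<in> {0..T} \<Longrightarrow> has_Lp_derivative p M H (\<lambda>_. 0) t {0..T}"
    and 0: "AE x in M. H 0 x = 0" and t: "t \<in> {0..T}"
  shows "AE x in M. H t x = 0"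
proof -
  have L: "H s \<in> Lp p M" if "s \<in> {0..T}" for s using H[OF that] that by (auto simp: has_Lp_derivative_def)
  have "((\<lambda>t. Lp_norm p M (H t)) has_field_derivative 0) (at t within {0..T})" if t: "t \<in> {0..T}" for t
    unfolding has_field_derivative_iff
  proof (rule Lim_null_comparison)
    show "((\<lambda>s. Lp_norm p M (\<lambda>x. (H s x - H t x) / (s - t))) \<longlongrightarrow> 0) (at t within {0..T})"
      using H[OF t] by (simp add: has_Lp_derivative_def)
    have "norm ((Lp_norm p M (H s) - Lp_norm p M (H t)) / (s - t)) \<le> Lp_norm p M (\<lambda>x. (H s x - H t x) / (s - t))"
      if s: "s \<in> {0..T}" "s \<noteq> t" for s
    proof -
      let ?Q = "\<lambda>x. (H s x - H t x) / (s - t)"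
      have Q: "?Q \<in> Lp p M" using Lp_cmult[OF Lp_diff[OF L[OF s(1)] L[OF t]], of "1 / (s - t)"] by simp
      have "Lp_norm p M (H s) \<le> Lp_norm p M (H t) + \<bar>s - t\<bar> * Lp_norm p M ?Q"
        using Lp_norm_add_le[OF L[OF t] Lp_cmult[OF Q, of "s - t"]] Lp_norm_cmult_le[OF Q, of "s - t"] s by simp
      moreover have "Lp_norm p M (H t) \<le> Lp_norm p M (H s) + \<bar>s - t\<bar> * Lp_norm p M ?Q"
      proof -
        have "H s x + - (s - t) * ((H s x - H t x) / (s - t)) = H t x" for x
          using s(2) by (simp only: minus_mult_left[symmetric] nonzero_mult_div_cancel_left times_divide_eq_right) simp
        then show ?thesis
          using Lp_norm_add_le[OF L[OF s(1)] Lp_cmult[OF Q, of "- (s - t)"]] Lp_norm_cmult_le[OF Q, of "- (s - t)"]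
          unfolding abs_minus_cancel by simp
      qed
      ultimately have "\<bar>Lp_norm p M (H s) - Lp_norm p M (H t)\<bar> \<le> \<bar>s - t\<bar> * Lp_norm p M ?Q" by linarith
      then show ?thesis using s by (simp add: divide_le_eq mult.commute)
    qed
    then show "\<forall>\<^sub>F s in at t within {0..T}. norm ((Lp_norm p M (H s) - Lp_norm p M (H t)) / (s - t))
        \<le> Lp_norm p M (\<lambda>x. (H s x - H t x) / (s - t))"
      by (auto simp: eventually_at_filter)
  qed
  then obtain c where "\<And>t. t \<in> {0..T} \<Longrightarrow> Lp_norm p M (H t) = c"
    using has_field_derivative_zero_constant[of "{0..T}" "\<lambda>t. Lp_norm p M (H t)"] by auto
  moreover have "0 \<in> {0..T}" using t by auto
  moreover have "Lp_norm p M (H 0) = 0" using 0 L[of 0] t by (intro Lp_norm_eq_0I) (auto intro: Lp_measurable)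
  ultimately have "Lp_norm p M (H t) = 0" using t by metis
  then show ?thesis using L[OF t] by (intro Lp_norm_eq_0D) auto
qed

text \<open>Used to strip a time integral: if the primitive of a continuous curve vanishes at all
  times, so does the curve at every time, not merely at almost every one. T > 0 makes t a limit
  point, so the limit is unique.\<close>

lemma has_Lp_derivative_of_zero:
  assumes H: "has_Lp_derivative p M H G t {0..T}" and t: "t \<in> {0..T}" and T: "0 < T"
    and 0: "\<And>s. s \<in> {0..T} \<Longrightarrow> AE x in M. H s x = 0"
  shows "AE x in M. G x = 0"
proof -
  have L: "H s \<in> Lp p M" "G \<in> Lp p M" if "s \<in> {0..T}" for s using H that by (auto simp: has_Lp_derivative_def)
  have "Lp_dist p M (\<lambda>x. (H s x - H t x) / (s - t)) G = Lp_norm p M G" if s: "s \<in> {0..T}" for s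
  proof -
    have "Lp_dist p M (\<lambda>x. (H s x - H t x) / (s - t)) G = Lp_dist p M (\<lambda>x. 0) G"
    proof (rule Lp_norm_cong_AE)
      show "AE x in M. (H s x - H t x) / (s - t) - G x = 0 - G x"
        using 0[OF s] 0[OF t] by eventually_elim simp
    qed (use L(1)[OF s, THEN Lp_measurable] L[OF t, THEN Lp_measurable] in measurable)
    then show ?thesis using Lp_dist_commute[of "\<lambda>x. 0" G] by simp
  qed
  then have "\<forall>\<^sub>F s in at t within {0..T}. Lp_dist p M (\<lambda>x. (H s x - H t x) / (s - t)) G = Lp_norm p M G"
    by (auto simp: eventually_at_filter)
  then have "((\<lambda>s. Lp_norm p M G) \<longlongrightarrow> 0) (at t within {0..T})"
    using H by (rule_tac Lim_transform_eventually) (auto simp: has_Lp_derivative_def)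
  moreover have "at t within {0..T} \<noteq> bot" using T t by (simp add: trivial_limit_within islimpt_Icc)
  ultimately have "Lp_norm p M G = 0" using tendsto_const_iff by blast
  then show ?thesis using L(2)[OF t] by (intro Lp_norm_eq_0D) auto
qed

section \<open>The right-hand side: a bounded operator plus the nonlinearity\<close>

lemma bounded_linear_Lp_Lipschitz:
  assumes A: "bounded_linear_Lp p M A"
  obtains K where "0 \<le> K" "\<And>u v. u \<in> Lp p M \<Longrightarrow> v \<in> Lp p M \<Longrightarrow> Lp_dist p M (A u) (A v) \<le> K * Lp_dist p M u v"
proof -
  obtain K where K: "\<And>u. u \<in> Lp p M \<Longrightarrow> Lp_norm p M (A u) \<le> K * Lp_norm p M u"
    using A unfolding bounded_linear_Lp_def by blast
  have AL: "\<And>u. u \<in> Lp p M \<Longrightarrow> A u \<in> Lp p M" using A by (simp add: bounded_linear_Lp_def)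
  show ?thesis
  proof (rule that[of "\<bar>K\<bar>"])
    fix u v assume u: "u \<in> Lp p M" and v: "v \<in> Lp p M"
    note d = Lp_diff[OF u v]
    have "\<forall>u\<in>Lp p M. \<forall>v\<in>Lp p M. AE x in M. A (\<lambda>y. u y + v y) x = A u x + A v x"
      using A by (simp add: bounded_linear_Lp_def)
    \<comment> \<open>Additivity is applied to the sum v + (u - v), which is the function u itself,
      so the left-hand side is literally A u.\<close>
    from bspec[OF bspec[OF this v] d]
    have "AE x in M. A (\<lambda>y. v y + (u y - v y)) x = A v x + A (\<lambda>y. u y - v y) x" .
    then have "AE x in M. A u x - A v x = A (\<lambda>y. u y - v y) x" by eventually_elim simp
    then have "Lp_dist p M (A u) (A v) = Lp_norm p M (A (\<lambda>y. u y - v y))"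
      by (intro Lp_norm_cong_AE Lp_measurable Lp_diff AL u v d)
    also have "\<dots> \<le> K * Lp_dist p M u v" by (rule K[OF d])
    also have "\<dots> \<le> \<bar>K\<bar> * Lp_dist p M u v" by (intro mult_right_mono Lp_norm_nonneg) auto
    finally show "Lp_dist p M (A u) (A v) \<le> \<bar>K\<bar> * Lp_dist p M u v" .
  qed simp
qed

lemma Lp_dist_sum_le:
  assumes "a \<in> Lp p M" "b \<in> Lp p M" "c \<in> Lp p M" "d \<in> Lp p M"
  shows "Lp_dist p M (\<lambda>x. a x + b x) (\<lambda>x. c x + d x) \<le> Lp_dist p M a c + Lp_dist p M b d"
  using Lp_norm_add_le[OF Lp_diff[OF assms(1,3)] Lp_diff[OF assms(2,4)]] by (simp add: algebra_simps)

lemma continuous_Lp_map_plus_linear: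
  assumes A: "bounded_linear_Lp p M A" and f: "continuous_Lp_map p M f"
  shows "continuous_Lp_map p M (\<lambda>t u x. A u x + f t u x)"
  unfolding continuous_Lp_map_def
proof (intro conjI allI impI ballI)
  obtain K where K: "0 \<le> K" "\<And>u v. u \<in> Lp p M \<Longrightarrow> v \<in> Lp p M \<Longrightarrow> Lp_dist p M (A u) (A v) \<le> K * Lp_dist p M u v"
    using bounded_linear_Lp_Lipschitz[OF A] by blast
  have AL: "\<And>u. u \<in> Lp p M \<Longrightarrow> A u \<in> Lp p M" using A by (simp add: bounded_linear_Lp_def)
  have fL: "\<And>t u. 0 \<le> t \<Longrightarrow> u \<in> Lp p M \<Longrightarrow> f t u \<in> Lp p M" using f by (simp add: continuous_Lp_map_def)
  show "(\<lambda>x. A u x + f t u x) \<in> Lp p M" if "0 \<le> t" "u \<in> Lp p M" for t u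
    using that by (intro Lp_add AL fL)
  fix t0 e :: real and u0 assume t0: "0 \<le> t0" and u0: "u0 \<in> Lp p M" and e: "0 < e"
  have "0 < e / 2" using e by simp
  then obtain d where d: "0 < d" "\<And>t u. 0 \<le> t \<Longrightarrow> u \<in> Lp p M \<Longrightarrow> \<bar>t - t0\<bar> + Lp_dist p M u u0 < d \<Longrightarrow> Lp_dist p M (f t u) (f t0 u0) < e / 2"
    using f t0 u0 unfolding continuous_Lp_map_def by meson
  show "\<exists>\<delta>>0. \<forall>t\<ge>0. \<forall>u\<in>Lp p M. \<bar>t - t0\<bar> + Lp_dist p M u u0 < \<delta> \<longrightarrow>
      Lp_norm p M (\<lambda>x. A u x + f t u x - (A u0 x + f t0 u0 x)) < e"
  \<comment> \<open>K may be 0; the denominator with K + 1 stays positive and still gives K *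
    \<delta> \<le> e / 2.\<close>
  proof (intro exI[of _ "min d (e / (2 * (K + 1)))"] conjI allI ballI impI)
    show "0 < min d (e / (2 * (K + 1)))" using d e K(1) by auto
    fix t u assume t: "0 \<le> t" and u: "u \<in> Lp p M" and lt: "\<bar>t - t0\<bar> + Lp_dist p M u u0 < min d (e / (2 * (K + 1)))"
    have "Lp_dist p M u u0 \<le> e / (2 * (K + 1))" using lt by linarith
    then have "K * Lp_dist p M u u0 \<le> K * (e / (2 * (K + 1)))" using K(1) by (rule mult_left_mono)
    also have "\<dots> \<le> e / 2" using K(1) e by (simp add: field_simps)
    finally have "Lp_dist p M (A u) (A u0) \<le> e / 2" using K(2)[OF u u0] by linarith
    moreover have "Lp_dist p M (f t u) (f t0 u0) < e / 2" using lt by (intro d(2) t u) simp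
    ultimately show "Lp_norm p M (\<lambda>x. A u x + f t u x - (A u0 x + f t0 u0 x)) < e"
      using Lp_dist_sum_le[OF AL[OF u] fL[OF t u] AL[OF u0] fL[OF t0 u0]] by linarith
  qed
qed

lemma locally_Lipschitz_Lp_plus_linear:
  assumes A: "bounded_linear_Lp p M A" and fL: "\<And>t u. 0 \<le> t \<Longrightarrow> u \<in> Lp p M \<Longrightarrow> f t u \<in> Lp p M"
    and f: "locally_Lipschitz_Lp p M f"
  shows "locally_Lipschitz_Lp p M (\<lambda>t u x. A u x + f t u x)"
  unfolding locally_Lipschitz_Lp_def
proof (intro allI impI ballI)
  obtain K where K: "0 \<le> K" "\<And>u v. u \<in> Lp p M \<Longrightarrow> v \<in> Lp p M \<Longrightarrow> Lp_dist p M (A u) (A v) \<le> K * Lp_dist p M u v"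
    using bounded_linear_Lp_Lipschitz[OF A] by blast
  have AL: "\<And>u. u \<in> Lp p M \<Longrightarrow> A u \<in> Lp p M" using A by (simp add: bounded_linear_Lp_def)
  fix t0 :: real and u0 assume t0: "0 \<le> t0" and u0: "u0 \<in> Lp p M"
  obtain r L where rL: "0 < r" "0 < L" "\<And>t u v. (t, v) \<in> time_Lp_ball p M t0 u0 r \<Longrightarrow> (t, u) \<in> time_Lp_ball p M t0 u0 r \<Longrightarrow>
      Lp_dist p M (f t v) (f t u) \<le> L * Lp_dist p M v u"
    using f[unfolded locally_Lipschitz_Lp_def, rule_format, OF t0 u0] by blast
  have "Lp_norm p M (\<lambda>x. A v x + f t v x - (A u x + f t u x)) \<le> (K + L) * Lp_dist p M v u"
    if m: "(t, v) \<in> time_Lp_ball p M t0 u0 r" "(t, u) \<in> time_Lp_ball p M t0 u0 r" for t u v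
  proof -
    have t: "0 \<le> t" and u: "u \<in> Lp p M" and v: "v \<in> Lp p M" using m by (auto simp: time_Lp_ball_def)
    show ?thesis
      using Lp_dist_sum_le[OF AL[OF v] fL[OF t v] AL[OF u] fL[OF t u]] K(2)[OF v u] rL(3)[OF m]
      by (simp add: distrib_right)
  qed
  moreover have "0 < K + L" using K(1) rL(2) by simp
  ultimately show "\<exists>r0>0. \<exists>L0>0. \<forall>t u v. (t, v) \<in> time_Lp_ball p M t0 u0 r0 \<longrightarrow> (t, u) \<in> time_Lp_ball p M t0 u0 r0 \<longrightarrow>
        Lp_norm p M (\<lambda>x. A v x + f t v x - (A u x + f t u x)) \<le> L0 * Lp_dist p M v u"
    using rL(1) by blast
qed

end

section \<open>Fractional integrals of curves in \<open>L\<^sup>p\<close>\<close>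

locale fractional_Lp_space = Lp_space +
  fixes \<alpha> :: "'a \<Rightarrow> real" and \<alpha>\<^sub>0 :: real
  assumes \<alpha>\<^sub>0_pos: "0 < \<alpha>\<^sub>0" and \<alpha>\<^sub>0_le_1: "\<alpha>\<^sub>0 \<le> 1"
    and \<alpha>_measurable [measurable]: "\<alpha> \<in> borel_measurable M"
    and \<alpha>_bounds: "AE x in M. \<alpha>\<^sub>0 \<le> \<alpha> x \<and> \<alpha> x \<le> 1"
begin

definition J :: "(real \<Rightarrow> 'a \<Rightarrow> real) \<Rightarrow> real \<Rightarrow> 'a \<Rightarrow> real" where
  "J F t x = frac_integral (\<alpha> x) (\<lambda>s. F s x) t"

lemma jointly_measurable_J: "jointly_measurable F \<Longrightarrow> jointly_measurable (J F)"
  using jointly_measurable_frac_integral[OF _ \<alpha>_measurable, of F] by (simp add: J_def[abs_def])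

lemma J_0: "J F 0 x = 0"
  by (simp add: J_def frac_integral_0)

text \<open>The kernel, whose order depends on x, is dominated by C * W with W independent of x, so
  the averaging lemma applies with one weight. Bounds are asked only for s < t, the form in which
  the first exit argument can supply them.\<close>

lemma AE_frac_integrable:
  assumes F: "jointly_measurable F" and B: "0 \<le> B" and t: "0 \<le> t" "t \<le> 1"
    and FB: "\<And>s. 0 \<le> s \<Longrightarrow> s < t \<Longrightarrow> Lp_le B (F s)"
  shows "AE x in M. frac_integrable (\<alpha> x) (\<lambda>s. F s x) t"
proof -
  obtain C where C: "0 < C"
    "\<And>b r. \<alpha>\<^sub>0 \<le> b \<Longrightarrow> b \<le> 1 \<Longrightarrow> r \<le> 1 \<Longrightarrow> rl_kernel b r \<le> C * (indicator {0<..} r * r powr (\<alpha>\<^sub>0 - 1))"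
    using rl_kernel_bound[OF \<alpha>\<^sub>0_pos] by metis
  define W where "W s = (indicator {0..<t} s * (t - s) powr (\<alpha>\<^sub>0 - 1) :: real)" for s
  have Fm: "(\<lambda>(s, x). F s x) \<in> borel_measurable (lborel \<Otimes>\<^sub>M M)" using F by (simp add: jointly_measurable_def)
  have "AE x in M. integrable lborel (\<lambda>s. W s * F s x)"
  proof (rule Lp_le_average(1)[OF _ _ _ Fm B])
    show "integrable lborel W"
      unfolding W_def using powr_weight_integral[OF \<alpha>\<^sub>0_pos t(1) order_refl] by (rule integrable.intros)
    show "Lp_le B (F s)" if "W s \<noteq> 0" for s
      using that by (intro FB) (auto simp: W_def indicator_def split: if_splits)
    show "0 \<le> W s" for s by (simp add: W_def)
  qed (rule lborel.sigma_finite_measure_axioms)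
  then show ?thesis
    using \<alpha>_bounds AE_space
  proof eventually_elim
    case (elim x)
    note [measurable] = jointly_measurableD2[OF F elim(3)]
    have a: "\<alpha>\<^sub>0 \<le> \<alpha> x" "\<alpha> x \<le> 1" "0 < \<alpha> x" using elim(2) \<alpha>\<^sub>0_pos by auto
    show ?case
    proof (rule Bochner_Integration.integrable_bound)
      show "integrable lborel (\<lambda>s. C * (W s * F s x))" using elim(1) by simp
      show "AE s in lborel. norm (indicator {0..} s * (rl_kernel (\<alpha> x) (t - s) * F s x)) \<le> norm (C * (W s * F s x))"
      proof (rule AE_I2)
        fix s
        have "rl_kernel (\<alpha> x) (t - s) \<le> C * (indicator {0<..} (t - s) * (t - s) powr (\<alpha>\<^sub>0 - 1))" if "0 \<le> s"
          using C(2)[OF a(1,2), of "t - s"] that t by simp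
        then have "indicator {0..} s * rl_kernel (\<alpha> x) (t - s) \<le> C * W s"
          by (auto simp: W_def indicator_def)
        then have "indicator {0..} s * rl_kernel (\<alpha> x) (t - s) * \<bar>F s x\<bar> \<le> C * W s * \<bar>F s x\<bar>"
          by (intro mult_right_mono) auto
        then show "norm (indicator {0..} s * (rl_kernel (\<alpha> x) (t - s) * F s x)) \<le> norm (C * (W s * F s x))"
          using C(1) rl_kernel_nonneg[OF a(3), of "t - s"] by (simp add: abs_mult W_def)
      qed
    qed measurable
  qed
qed

lemma J_diff:
  assumes F: "jointly_measurable F" and G: "jointly_measurable G" and B: "0 \<le> B" and t: "0 \<le> t" "t \<le> 1"
    and le: "\<And>s. 0 \<le> s \<Longrightarrow> s < t \<Longrightarrow> Lp_le B (F s)" "\<And>s. 0 \<le> s \<Longrightarrow> s < t \<Longrightarrow> Lp_le B (G s)"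
  shows "AE x in M. J (\<lambda>s x. F s x - G s x) t x = J F t x - J G t x"
proof -
  have "AE x in M. frac_integrable (\<alpha> x) (\<lambda>s. F s x) t" "AE x in M. frac_integrable (\<alpha> x) (\<lambda>s. G s x) t"
    by (blast intro: AE_frac_integrable[OF F B t] AE_frac_integrable[OF G B t] le)+
  then show ?thesis
  proof eventually_elim
    case (elim x)
    then show ?case
      unfolding J_def frac_integral_def
      by (subst Bochner_Integration.integral_diff[symmetric]) (simp_all add: right_diff_distrib)
  qed
qed

text \<open>Hoelder continuity of J F in time with exponent \<open>\<alpha>\<^sub>0\<close>, and for
  t = 0 the norm bound behind the contraction. C is fixed before F, B and the times. The increment
  of the kernel is dominated, uniformly in x, by one weight of small mass.\<close>

lemma J_increment:
  obtains C where "0 < C"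
    "\<And>F B t t'. jointly_measurable F \<Longrightarrow> 0 \<le> B \<Longrightarrow> 0 \<le> t \<Longrightarrow> t \<le> t' \<Longrightarrow> t' \<le> 1 \<Longrightarrow>
      (\<And>s. 0 \<le> s \<Longrightarrow> s < t' \<Longrightarrow> Lp_le B (F s)) \<Longrightarrow>
      Lp_le (C * B * (t' - t) powr \<alpha>\<^sub>0) (\<lambda>x. J F t' x - J F t x)"
proof -
  obtain C where C: "0 < C"
    "\<And>b r. \<alpha>\<^sub>0 \<le> b \<Longrightarrow> b \<le> 1 \<Longrightarrow> r \<le> 1 \<Longrightarrow> rl_kernel b r \<le> C * (indicator {0<..} r * r powr (\<alpha>\<^sub>0 - 1))"
    "\<And>b r h. \<alpha>\<^sub>0 \<le> b \<Longrightarrow> b \<le> 1 \<Longrightarrow> 0 \<le> h \<Longrightarrow> 0 < r \<Longrightarrow> r + h \<le> 1 \<Longrightarrow> \<bar>rl_kernel b (r + h) - rl_kernel b r\<bar>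
      \<le> C * (r powr (\<alpha>\<^sub>0 - 1) - (r + h) powr (\<alpha>\<^sub>0 - 1))"
    using rl_kernel_bound[OF \<alpha>\<^sub>0_pos] by metis
  define W where "W u v s = (indicator {0..<u} s * (v - s) powr (\<alpha>\<^sub>0 - 1) :: real)" for u v s
  have W: "has_bochner_integral lborel (W u v) ((v powr \<alpha>\<^sub>0 - (v - u) powr \<alpha>\<^sub>0) / \<alpha>\<^sub>0)" if "0 \<le> u" "u \<le> v" for u v
    unfolding W_def using powr_weight_integral[OF \<alpha>\<^sub>0_pos that] .
  have main: "Lp_le (2 * C / \<alpha>\<^sub>0 * B * (t' - t) powr \<alpha>\<^sub>0) (\<lambda>x. J F t' x - J F t x)"
    if F: "jointly_measurable F" and B: "0 \<le> B" and t: "0 \<le> t" "t \<le> t'" "t' \<le> 1"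
      and FB: "\<And>s. 0 \<le> s \<Longrightarrow> s < t' \<Longrightarrow> Lp_le B (F s)" for F B t t'
  proof -
    have Fm: "(\<lambda>(s, x). F s x) \<in> borel_measurable (lborel \<Otimes>\<^sub>M M)" using F by (simp add: jointly_measurable_def)
    \<comment> \<open>On [0,t) both kernels are present and their difference is bounded by the
      increment of the comparison power; on [t,t') only the later kernel is left.\<close>
    define w where "w s = C * (W t t s - W t t' s + (W t' t' s - W t t' s))" for s
    have w: "has_bochner_integral lborel w (C * ((t powr \<alpha>\<^sub>0 - (t - t) powr \<alpha>\<^sub>0) / \<alpha>\<^sub>0 - (t' powr \<alpha>\<^sub>0 - (t' - t) powr \<alpha>\<^sub>0) / \<alpha>\<^sub>0
        + ((t' powr \<alpha>\<^sub>0 - (t' - t') powr \<alpha>\<^sub>0) / \<alpha>\<^sub>0 - (t' powr \<alpha>\<^sub>0 - (t' - t) powr \<alpha>\<^sub>0) / \<alpha>\<^sub>0)))"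
      unfolding w_def using t
      by (intro has_bochner_integral_mult_right has_bochner_integral_add has_bochner_integral_diff W) auto
    have w_eq: "w s = (if 0 \<le> s \<and> s < t then C * ((t - s) powr (\<alpha>\<^sub>0 - 1) - (t' - s) powr (\<alpha>\<^sub>0 - 1))
        else if 0 \<le> s \<and> s < t' then C * (t' - s) powr (\<alpha>\<^sub>0 - 1) else 0)" for s
      using t by (auto simp: w_def W_def indicator_def)
    have w0: "0 \<le> w s" for s
    proof -
      have "(t' - s) powr (\<alpha>\<^sub>0 - 1) \<le> (t - s) powr (\<alpha>\<^sub>0 - 1)" if "s < t"
        using that t \<alpha>\<^sub>0_le_1 by (intro powr_mono2') auto
      then show ?thesis using C(1) by (auto simp: w_eq)
    qed
    have wi: "integrable lborel w" using w by (rule integrable.intros)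
    have "(LINT s|lborel. w s) \<le> 2 * C / \<alpha>\<^sub>0 * (t' - t) powr \<alpha>\<^sub>0"
    proof -
      \<comment> \<open>The mass of w is \<open>C / \<alpha>\<^sub>0\<close> times \<open>t powr
        \<alpha>\<^sub>0 - t' powr \<alpha>\<^sub>0 + 2 * (t' - t) powr \<alpha>\<^sub>0\<close>;
        monotonicity discards the first two terms.\<close>
      have "t powr \<alpha>\<^sub>0 \<le> t' powr \<alpha>\<^sub>0" using t \<alpha>\<^sub>0_pos by (intro powr_mono2) auto
      then have "C * (t powr \<alpha>\<^sub>0 - t' powr \<alpha>\<^sub>0 + 2 * (t' - t) powr \<alpha>\<^sub>0) / \<alpha>\<^sub>0 \<le> C * (2 * (t' - t) powr \<alpha>\<^sub>0) / \<alpha>\<^sub>0"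
        using C(1) \<alpha>\<^sub>0_pos by (intro divide_right_mono mult_left_mono) auto
      moreover have "(LINT s|lborel. w s) = C * (t powr \<alpha>\<^sub>0 - t' powr \<alpha>\<^sub>0 + 2 * (t' - t) powr \<alpha>\<^sub>0) / \<alpha>\<^sub>0"
        using w \<alpha>\<^sub>0_pos by (simp add: has_bochner_integral_iff field_simps)
      ultimately show ?thesis by (simp add: mult_ac)
    qed
    then have le: "B * (LINT s|lborel. w s) \<le> 2 * C / \<alpha>\<^sub>0 * B * (t' - t) powr \<alpha>\<^sub>0"
      using mult_left_mono[OF _ B, of "LINT s|lborel. w s" "2 * C / \<alpha>\<^sub>0 * (t' - t) powr \<alpha>\<^sub>0"]
      by (simp only: mult_ac)
    have Jm: "J F s \<in> borel_measurable M" for s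
      using jointly_measurable_J[OF F] by (rule jointly_measurableD1)
    have L: "Lp_le (B * (LINT s|lborel. w s)) (\<lambda>x. J F t' x - J F t x)"
    proof (rule Lp_le_average(2)[OF _ wi w0 Fm B])
      show "Lp_le B (F s)" if "w s \<noteq> 0" for s
        using that t by (intro FB) (auto simp: w_eq split: if_splits)
      show "(\<lambda>x. J F t' x - J F t x) \<in> borel_measurable M" using Jm by measurable
      have wF: "AE x in M. integrable lborel (\<lambda>s. w s * F s x)"
        by (rule Lp_le_average(1)[OF _ wi w0 Fm B])
          (use t in \<open>auto simp: w_eq lborel.sigma_finite_measure_axioms split: if_splits intro!: FB\<close>)
      have "AE x in M. frac_integrable (\<alpha> x) (\<lambda>s. F s x) t'" "AE x in M. frac_integrable (\<alpha> x) (\<lambda>s. F s x) t"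
        using t FB by (auto intro!: AE_frac_integrable[OF F B])
      with \<alpha>_bounds wF
      show "AE x in M. \<bar>J F t' x - J F t x\<bar> \<le> (LINT s|lborel. w s * \<bar>F s x\<bar>)"
      proof eventually_elim
        case (elim x)
        have a: "\<alpha>\<^sub>0 \<le> \<alpha> x" "\<alpha> x \<le> 1" "0 < \<alpha> x" using elim(1) \<alpha>\<^sub>0_pos by auto
        note J1 = elim(3,4)
        have e: "J F t' x - J F t x = (LINT s|lborel. indicator {0..} s * (rl_kernel (\<alpha> x) (t' - s) * F s x)
            - indicator {0..} s * (rl_kernel (\<alpha> x) (t - s) * F s x))"
          unfolding J_def frac_integral_def by (rule Bochner_Integration.integral_diff[symmetric, OF J1])
        have "\<bar>J F t' x - J F t x\<bar> \<le> (LINT s|lborel. \<bar>indicator {0..} s * (rl_kernel (\<alpha> x) (t' - s) * F s x)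
            - indicator {0..} s * (rl_kernel (\<alpha> x) (t - s) * F s x)\<bar>)"
          unfolding e by (rule integral_abs_bound)
        also have "\<dots> \<le> (LINT s|lborel. w s * \<bar>F s x\<bar>)"
        proof (rule integral_mono)
          show "integrable lborel (\<lambda>s. \<bar>indicator {0..} s * (rl_kernel (\<alpha> x) (t' - s) * F s x)
              - indicator {0..} s * (rl_kernel (\<alpha> x) (t - s) * F s x)\<bar>)"
            by (rule integrable_abs[OF Bochner_Integration.integrable_diff[OF J1]])
          show "integrable lborel (\<lambda>s. w s * \<bar>F s x\<bar>)"
            using integrable_abs[OF elim(2)] w0 by (simp add: abs_mult)
          fix s
          have "indicator {0..} s * \<bar>rl_kernel (\<alpha> x) (t' - s) - rl_kernel (\<alpha> x) (t - s)\<bar> \<le> w s"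
          proof -
            consider "s < 0" | "0 \<le> s" "s < t" | "0 \<le> s" "t \<le> s" "s < t'" | "t' \<le> s" "t \<le> s" "0 \<le> s" using t by linarith
            then show ?thesis
            proof cases
              case 2
              then show ?thesis using C(3)[OF a(1,2), of "t' - t" "t - s"] t by (simp add: w_eq)
            next
              case 3
              then show ?thesis using C(2)[OF a(1,2), of "t' - s"] t rl_kernel_nonneg[OF a(3), of "t' - s"]
                by (simp add: w_eq rl_kernel_def[of _ "t - s"])
            qed (use w0[of s] t in \<open>auto simp: rl_kernel_def\<close>)
          qed
          then have "indicator {0..} s * \<bar>rl_kernel (\<alpha> x) (t' - s) - rl_kernel (\<alpha> x) (t - s)\<bar> * \<bar>F s x\<bar> \<le> w s * \<bar>F s x\<bar>"
            by (rule mult_right_mono) simp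
          also have "indicator {0..} s * \<bar>rl_kernel (\<alpha> x) (t' - s) - rl_kernel (\<alpha> x) (t - s)\<bar> * \<bar>F s x\<bar>
              = \<bar>indicator {0..} s * (rl_kernel (\<alpha> x) (t' - s) * F s x) - indicator {0..} s * (rl_kernel (\<alpha> x) (t - s) * F s x)\<bar>"
            by (simp add: indicator_def abs_mult flip: left_diff_distrib)
          finally show "\<bar>indicator {0..} s * (rl_kernel (\<alpha> x) (t' - s) * F s x) - indicator {0..} s * (rl_kernel (\<alpha> x) (t - s) * F s x)\<bar>
              \<le> w s * \<bar>F s x\<bar>" .
        qed
        finally show ?case .
      qed
    qed (rule lborel.sigma_finite_measure_axioms)
    have "0 \<le> B * (LINT s|lborel. w s)"
      using B w0 by (intro mult_nonneg_nonneg integral_nonneg_AE) auto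
    with L le show ?thesis by (rule_tac Lp_le_mono[OF L Lp_le_measurable[OF L]]) auto
  qed
  show ?thesis
  proof (rule that)
    show "0 < 2 * C / \<alpha>\<^sub>0" using C(1) \<alpha>\<^sub>0_pos by simp
    fix F B t t'
    assume "jointly_measurable F" "0 \<le> B" "0 \<le> t" "t \<le> t'" "t' \<le> 1" "\<And>s. 0 \<le> s \<Longrightarrow> s < t' \<Longrightarrow> Lp_le B (F s)"
    then show "Lp_le (2 * C / \<alpha>\<^sub>0 * B * (t' - t) powr \<alpha>\<^sub>0) (\<lambda>x. J F t' x - J F t x)"
      by (rule main)
  qed
qed

lemma Lp_continuous_on_J:
  assumes F: "jointly_measurable F" and T: "T \<le> 1" and B: "0 \<le> B" "\<And>s. s \<in> {0..T} \<Longrightarrow> Lp_le B (F s)"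
    and u: "u \<in> Lp p M"
  shows "Lp_continuous_on {0..T} (\<lambda>t x. u x + J F t x)"
proof -
  obtain C where C: "0 < C"
    "\<And>F B t t'. jointly_measurable F \<Longrightarrow> 0 \<le> B \<Longrightarrow> 0 \<le> t \<Longrightarrow> t \<le> t' \<Longrightarrow> t' \<le> 1 \<Longrightarrow>
      (\<And>s. 0 \<le> s \<Longrightarrow> s < t' \<Longrightarrow> Lp_le B (F s)) \<Longrightarrow>
      Lp_le (C * B * (t' - t) powr \<alpha>\<^sub>0) (\<lambda>x. J F t' x - J F t x)"
    by (rule J_increment) blast
  have inc: "Lp_le (C * B * (t' - t) powr \<alpha>\<^sub>0) (\<lambda>x. J F t' x - J F t x)" if "0 \<le> t" "t \<le> t'" "t' \<le> T" for t t'
    using that T B by (intro C(2)[OF F]) auto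
  have L: "(\<lambda>x. u x + J F t x) \<in> Lp p M" if t: "t \<in> {0..T}" for t
    using Lp_le_imp_Lp[OF inc[of 0 t]] t C(1) B(1) u by (auto simp: J_0 intro: Lp_add)
  have dist: "Lp_dist p M (\<lambda>x. u x + J F s x) (\<lambda>x. u x + J F t x) \<le> C * B * \<bar>s - t\<bar> powr \<alpha>\<^sub>0"
    if s: "s \<in> {0..T}" and t: "t \<in> {0..T}" for s t
  proof (cases "t \<le> s")
    case True
    then show ?thesis using Lp_le_imp_norm[OF inc[of t s]] s t C(1) B(1) by simp
  next
    case False
    then have "Lp_dist p M (J F t) (J F s) \<le> C * B * \<bar>s - t\<bar> powr \<alpha>\<^sub>0"
      using Lp_le_imp_norm[OF inc[of s t]] s t C(1) B(1) by (simp add: abs_minus_commute)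
    then show ?thesis using Lp_dist_commute[of "J F t" "J F s"] by simp
  qed
  have "((\<lambda>s. Lp_dist p M (\<lambda>x. u x + J F s x) (\<lambda>x. u x + J F t x)) \<longlongrightarrow> 0) (at t within {0..T})" if t: "t \<in> {0..T}" for t
  proof (rule Lim_null_comparison)
    show "\<forall>\<^sub>F s in at t within {0..T}. norm (Lp_dist p M (\<lambda>x. u x + J F s x) (\<lambda>x. u x + J F t x)) \<le> C * B * \<bar>s - t\<bar> powr \<alpha>\<^sub>0"
      using dist[OF _ t] by (auto simp: eventually_at_filter Lp_norm_nonneg)
    have "((\<lambda>s. \<bar>s - t\<bar> powr \<alpha>\<^sub>0) \<longlongrightarrow> \<bar>t - t\<bar> powr \<alpha>\<^sub>0) (at t within {0..T})"
      using \<alpha>\<^sub>0_pos by (intro tendsto_powr' tendsto_intros) auto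
    then show "((\<lambda>s. C * B * \<bar>s - t\<bar> powr \<alpha>\<^sub>0) \<longlongrightarrow> 0) (at t within {0..T})"
      using tendsto_mult_right_zero by fastforce
  qed
  then show ?thesis using L by (simp add: Lp_continuous_on_def)
qed

end

section \<open>The Caputo derivative\<close>

context fractional_Lp_space
begin

lemma RL_integral_one_minus:
  assumes w: "jointly_measurable w" and x: "x \<in> space M"
  shows "RL_integral (\<lambda>x. 1 - \<alpha> x) w t x = (if \<alpha> x = 1 then w t x else frac_integral (1 - \<alpha> x) (\<lambda>s. w s x) t)"
proof (cases "\<alpha> x = 1")
  case True
  then show ?thesis by (simp add: RL_integral_def)
next
  case False
  then show ?thesis
    using RL_integral_eq_frac_integral[of w x "\<lambda>x. 1 - \<alpha> x", OF jointly_measurableD2[OF w x]] by simp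
qed

lemma jointly_measurable_RL_integral:
  assumes w: "jointly_measurable w"
  shows "jointly_measurable (RL_integral (\<lambda>x. 1 - \<alpha> x) w)"
proof -
  have jm: "jointly_measurable (\<lambda>t x. frac_integral (1 - \<alpha> x) (\<lambda>s. w s x) t)"
    by (intro jointly_measurable_frac_integral w) measurable
  have [measurable]: "(\<lambda>z. w (fst z) (snd z)) \<in> borel_measurable (lborel \<Otimes>\<^sub>M M)"
    "(\<lambda>z. frac_integral (1 - \<alpha> (snd z)) (\<lambda>s. w s (snd z)) (fst z)) \<in> borel_measurable (lborel \<Otimes>\<^sub>M M)"
    using w jm by (simp_all add: jointly_measurable_def split_beta')
  have m: "(\<lambda>z. if \<alpha> (snd z) = 1 then w (fst z) (snd z) else frac_integral (1 - \<alpha> (snd z)) (\<lambda>s. w s (snd z)) (fst z))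
      \<in> borel_measurable (lborel \<Otimes>\<^sub>M M)" by measurable
  show ?thesis
    unfolding jointly_measurable_def split_beta'
    by (rule measurable_cong[THEN iffD2, OF _ m]) (auto simp: RL_integral_one_minus[OF w] space_pair_measure)
qed

text \<open>At almost every x, J^(1-\<alpha>) J^\<alpha> F is the ordinary primitive of F, whose L^p
  derivative is F t. Where \<alpha>(x) = 1 the outer integral is the identity and J F is already
  that primitive.\<close>

lemma Caputo_of_J:
  assumes F: "jointly_measurable F" and c: "Lp_continuous_on {0..T} F" and T: "T \<le> 1" and t: "t \<in> {0..T}"
  shows "AE x in M. RL_integral_exists (\<lambda>x. 1 - \<alpha> x) (J F) t x"
    and "has_Lp_derivative p M (RL_integral (\<lambda>x. 1 - \<alpha> x) (J F)) (F t) t {0..T}"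
proof -
  obtain B where B: "0 < B" "\<And>t. t \<in> {0..T} \<Longrightarrow> Lp_le B (F t)"
    using Lp_bounded_on_compact[OF c] by auto
  have "AE x in M. integrable lborel (\<lambda>s. indicator {0..T} s * F s x)"
    by (rule AE_integrable_in_time[OF F _ B(2)]) (use B in auto)
  then have *: "AE x in M. \<forall>s\<in>{0..T}. RL_integral_exists (\<lambda>x. 1 - \<alpha> x) (J F) s x \<and>
      RL_integral (\<lambda>x. 1 - \<alpha> x) (J F) s x = frac_integral 1 (\<lambda>s. F s x) s"
    using \<alpha>_bounds AE_space
  proof eventually_elim
    case (elim x)
    note jm = jointly_measurable_J[OF F]
    note Fx = jointly_measurableD2[OF F elim(3)] and Jx = jointly_measurableD2[OF jm elim(3)]
    show ?case
    proof
      fix s assume s: "s \<in> {0..T}"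
      show "RL_integral_exists (\<lambda>x. 1 - \<alpha> x) (J F) s x \<and>
        RL_integral (\<lambda>x. 1 - \<alpha> x) (J F) s x = frac_integral 1 (\<lambda>s. F s x) s"
      proof (cases "\<alpha> x = 1")
        case True
        then show ?thesis by (simp add: RL_integral_exists_def RL_integral_def J_def)
      next
        case False
        then have a: "0 < 1 - \<alpha> x" "0 < \<alpha> x" using elim(2) \<alpha>\<^sub>0_pos by auto
        \<comment> \<open>The orders add up to 1, so integrability of the slice of F in time
          supplies the hypothesis of the semigroup law at every s.\<close>
        have i: "frac_integrable (1 - \<alpha> x + \<alpha> x) (\<lambda>s. F s x) s"
          using s by (intro frac_integrable_ge_1 indicator_integrable_subset[OF elim(1)] Fx) auto
        have J: "(\<lambda>s. J F s x) = frac_integral (\<alpha> x) (\<lambda>s. F s x)" by (simp add: J_def fun_eq_iff)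
        note sg = frac_integral_semigroup[OF a Fx i, folded J]
        show ?thesis
          using RL_integral_existsI[of "J F" x "\<lambda>x. 1 - \<alpha> x", OF Jx a(1) sg(1)] sg(2) False RL_integral_one_minus[OF jm elim(3)] by simp
      qed
    qed
  qed
  then show "AE x in M. RL_integral_exists (\<lambda>x. 1 - \<alpha> x) (J F) t x"
    by eventually_elim (use t in blast)
  show "has_Lp_derivative p M (RL_integral (\<lambda>x. 1 - \<alpha> x) (J F)) (F t) t {0..T}"
  proof (rule has_Lp_derivative_cong_AE[OF has_Lp_derivative_integral[OF F c t] t])
    show "RL_integral (\<lambda>x. 1 - \<alpha> x) (J F) s \<in> borel_measurable M" for s
      by (intro jointly_measurableD1 jointly_measurable_RL_integral jointly_measurable_J F)
    show "AE x in M. RL_integral (\<lambda>x. 1 - \<alpha> x) (J F) s x = frac_integral 1 (\<lambda>s. F s x) s" if "s \<in> {0..T}" for s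
      using * by eventually_elim (use that in blast)
    show "F t \<in> borel_measurable M" using F by (rule jointly_measurableD1)
  qed auto
qed

text \<open>Applying the fractional integral of order \<open>\<alpha>\<close> to \<open>J\<^bsup>1-\<alpha>\<^esup> w = J\<^bsup>1\<^esup> F\<close> gives
  \<open>J\<^bsup>1\<^esup> w = J\<^bsup>1\<^esup> (J\<^bsup>\<alpha>\<^esup> F)\<close>.\<close>

lemma J_of_Caputo:
  assumes w: "jointly_measurable w" "Lp_continuous_on {0..T} w" "AE x in M. w 0 x = 0"
    and F: "jointly_measurable F" "Lp_continuous_on {0..T} F" and T: "0 < T" "T \<le> 1"
    and der: "\<And>t. t \<in> {0..T} \<Longrightarrow> has_Lp_derivative p M (RL_integral (\<lambda>x. 1 - \<alpha> x) w) (F t) t {0..T}"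
    and t: "t \<in> {0..T}"
  shows "AE x in M. w t x = J F t x"
proof -
  define K where "K = RL_integral (\<lambda>x. 1 - \<alpha> x) w"
  define P where "P t x = frac_integral 1 (\<lambda>s. F s x) t" for t x
  have jm: "jointly_measurable K" "jointly_measurable P" "jointly_measurable (J F)"
    unfolding K_def P_def by (intro jointly_measurable_RL_integral jointly_measurable_frac_integral jointly_measurable_J w F borel_measurable_const)+
  have "AE x in M. K s x - P s x = 0" if s: "s \<in> {0..T}" for s
  proof (rule has_Lp_derivative_zero_imp_zero[OF _ _ s])
    show "has_Lp_derivative p M (\<lambda>s x. K s x - P s x) (\<lambda>_. 0) t {0..T}" if t: "t \<in> {0..T}" for t
      using has_Lp_derivative_diff[OF der[OF t] has_Lp_derivative_integral[OF F t] t] by (simp add: K_def P_def)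
    show "AE x in M. K 0 x - P 0 x = 0"
      using w(3) AE_space
      by eventually_elim (simp add: K_def P_def RL_integral_one_minus[OF w(1)] frac_integral_0)
  qed
  then have "AE x in M. K s x = P s x" if "s \<in> {0..T}" for s using that by fastforce
  \<comment> \<open>Agreement for each time, outside a null set depending on the time, becomes
    agreement at almost every time for almost every fixed x; this suffices under a further
    fractional integral.\<close>
  then have KP: "AE x in M. AE s in lborel. s \<in> {0..T} \<longrightarrow> K s x = P s x"
    by (intro AE_AE_commute jm) auto
  obtain B where B: "0 < B" "\<And>t. t \<in> {0..T} \<Longrightarrow> Lp_le B (F t)"
    using Lp_bounded_on_compact[OF F(2)] by auto
  obtain B' where B': "0 < B'" "\<And>t. t \<in> {0..T} \<Longrightarrow> Lp_le B' (w t)"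
    using Lp_bounded_on_compact[OF w(2)] by auto
  have "(\<lambda>_. 0) \<in> Lp p M" using Lp_le_imp_Lp[of 0 "\<lambda>_. 0"] by (simp add: Lp_le_0_iff)
  from Lp_continuous_on_J[OF F(1) T(2) _ B(2) this] B(1)
  have Jc: "Lp_continuous_on {0..T} (J F)" by simp
  obtain B'' where B'': "0 < B''" "\<And>t. t \<in> {0..T} \<Longrightarrow> Lp_le B'' (J F t)"
    using Lp_bounded_on_compact[OF Jc] by auto
  have i: "AE x in M. integrable lborel (\<lambda>s. indicator {0..T} s * F s x)"
    "AE x in M. integrable lborel (\<lambda>s. indicator {0..T} s * w s x)"
    "AE x in M. integrable lborel (\<lambda>s. indicator {0..T} s * J F s x)"
    using AE_integrable_in_time[OF F(1) _ B(2)] AE_integrable_in_time[OF w(1) _ B'(2)] AE_integrable_in_time[OF jm(3) _ B''(2)]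
      B(1) B'(1) B''(1) by auto
  have "AE x in M. \<forall>t\<in>{0..T}. frac_integral 1 (\<lambda>s. w s x - J F s x) t = 0"
    using i KP \<alpha>_bounds AE_space
  proof eventually_elim
    case (elim x)
    note x = elim(6)
    note mx = jointly_measurableD2[OF F(1) x] jointly_measurableD2[OF w(1) x] jointly_measurableD2[OF jm(1) x]
      jointly_measurableD2[OF jm(2) x] jointly_measurableD2[OF jm(3) x]
    have J: "(\<lambda>s. J F s x) = frac_integral (\<alpha> x) (\<lambda>s. F s x)" by (simp add: J_def fun_eq_iff)
    have P: "(\<lambda>s. P s x) = frac_integral 1 (\<lambda>s. F s x)" by (simp add: P_def fun_eq_iff)
    have a: "0 < \<alpha> x" "\<alpha> x \<le> 1" using elim(5) \<alpha>\<^sub>0_pos by auto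
    show ?case
    proof
      fix t assume t: "t \<in> {0..T}"
      have int: "frac_integrable b (\<lambda>s. F s x) t" "frac_integrable b (\<lambda>s. w s x) t" "frac_integrable b (\<lambda>s. J F s x) t"
        if "1 \<le> b" for b
        using t by (intro frac_integrable_ge_1[OF that] indicator_integrable_subset[OF elim(1)]
            indicator_integrable_subset[OF elim(2)] indicator_integrable_subset[OF elim(3)] mx; simp)+
      have "frac_integral 1 (\<lambda>s. w s x) t = frac_integral 1 (\<lambda>s. J F s x) t"
      proof (cases "\<alpha> x = 1")
        case True
        have "AE s in lborel. s \<in> {0..T} \<longrightarrow> w s x = J F s x"
          using elim(4) by eventually_elim (use True in \<open>auto simp: K_def P_def J_def RL_integral_def\<close>)
        then show ?thesis using t by (intro frac_integral_cong_AE[of _ _ T] mx) auto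
      next
        case False
        then have a': "0 < 1 - \<alpha> x" using a by simp
        have K: "(\<lambda>s. K s x) = frac_integral (1 - \<alpha> x) (\<lambda>s. w s x)"
          using False by (simp add: K_def RL_integral_one_minus[OF w(1) x] fun_eq_iff)
        have "frac_integral 1 (\<lambda>s. w s x) t = frac_integral (\<alpha> x) (\<lambda>s. K s x) t"
          using frac_integral_semigroup(2)[OF a(1) a' mx(2), of t] int by (simp add: K)
        also have "\<dots> = frac_integral (\<alpha> x) (\<lambda>s. P s x) t"
          using t elim(4) by (intro frac_integral_cong_AE[of _ _ T] mx) auto
        also have "\<dots> = frac_integral (\<alpha> x + 1) (\<lambda>s. F s x) t"
          unfolding P using a int by (intro frac_integral_semigroup(2) mx) auto
        also have "\<dots> = frac_integral (1 + \<alpha> x) (\<lambda>s. F s x) t" by (simp add: add.commute)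
        also have "\<dots> = frac_integral 1 (\<lambda>s. J F s x) t"
          unfolding J using a int by (intro frac_integral_semigroup(2)[symmetric] mx) auto
        finally show ?thesis .
      qed
      then show "frac_integral 1 (\<lambda>s. w s x - J F s x) t = 0"
        using Bochner_Integration.integral_diff[OF int(2,3)[OF order_refl]]
        by (simp add: frac_integral_def right_diff_distrib)
    qed
  qed
  then have "AE x in M. frac_integral 1 (\<lambda>s. w s x - J F s x) s = 0" if "s \<in> {0..T}" for s
    by eventually_elim (use that in blast)
  \<comment> \<open>The pointwise argument yields only equal primitives. As w - J F is a continuous
    curve, differentiating the zero primitive gives equality at the given t.\<close>
  then have "AE x in M. w t x - J F t x = 0"
    by (rule has_Lp_derivative_of_zero[OF has_Lp_derivative_integral[OF jointly_measurable_diff[OF w(1) jm(3)]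
      Lp_continuous_on_diff[OF w(2) Jc] t] t T(1)])
  then show ?thesis by simp
qed

end

section \<open>The integral equation\<close>

locale fractional_problem = fractional_Lp_space +
  fixes g :: "real \<Rightarrow> ('a \<Rightarrow> real) \<Rightarrow> 'a \<Rightarrow> real" and u\<^sub>0 :: "'a \<Rightarrow> real"
  assumes u\<^sub>0: "u\<^sub>0 \<in> Lp p M"
    and g_continuous: "continuous_Lp_map p M g"
    and g_Lipschitz: "locally_Lipschitz_Lp p M g"
begin

lemma g_Lp: "0 \<le> t \<Longrightarrow> u \<in> Lp p M \<Longrightarrow> g t u \<in> Lp p M"
  using g_continuous by (simp add: continuous_Lp_map_def)

lemma g_eps:
  assumes "0 \<le> t" "u \<in> Lp p M" "0 < \<epsilon>"
  obtains \<delta> where "0 < \<delta>"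
    "\<And>s v. 0 \<le> s \<Longrightarrow> v \<in> Lp p M \<Longrightarrow> \<bar>s - t\<bar> + Lp_dist p M v u < \<delta> \<Longrightarrow> Lp_dist p M (g s v) (g t u) < \<epsilon>"
  using g_continuous assms unfolding continuous_Lp_map_def by meson

text \<open>If u = v almost everywhere their distance is 0, so (t, u) lies in every neighbourhood of
  (t, v), and continuity puts g t u within every \<epsilon> of g t v.\<close>

lemma g_cong_AE:
  assumes "0 \<le> t" "u \<in> Lp p M" "v \<in> Lp p M" "AE x in M. u x = v x"
  shows "AE x in M. g t u x = g t v x"
proof (rule Lp_dist_eq_0D)
  have d: "Lp_dist p M u v = 0" using assms by (intro Lp_norm_eq_0I Lp_measurable Lp_diff) auto
  show "Lp_dist p M (g t u) (g t v) \<le> 0"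
  proof (rule field_le_epsilon)
    fix e :: real assume "0 < e"
    then obtain \<delta> where "0 < \<delta>"
      "\<And>s w. 0 \<le> s \<Longrightarrow> w \<in> Lp p M \<Longrightarrow> \<bar>s - t\<bar> + Lp_dist p M w v < \<delta> \<Longrightarrow> Lp_dist p M (g s w) (g t v) < e"
      using g_eps[OF assms(1,3)] by blast
    from this(2)[OF assms(1,2)] this(1) d show "Lp_dist p M (g t u) (g t v) \<le> 0 + e" by simp
  qed
qed (use assms g_Lp in auto)

lemma Lp_continuous_on_g:
  assumes \<phi>: "Lp_continuous_on {0..T} \<phi>"
  shows "Lp_continuous_on {0..T} (\<lambda>t. g t (\<phi> t))"
  unfolding Lp_continuous_on_eps
proof (intro conjI ballI allI impI)
  note L = Lp_continuous_on_Lp[OF \<phi>]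
  fix t assume t: "t \<in> {0..T}"
  show "g t (\<phi> t) \<in> Lp p M" using t by (intro g_Lp L) auto
  fix e :: real assume e: "0 < e"
  have "0 \<le> t" using t by simp
  from g_eps[OF this L[OF t] e] obtain d where d: "0 < d"
    "\<And>s v. 0 \<le> s \<Longrightarrow> v \<in> Lp p M \<Longrightarrow> \<bar>s - t\<bar> + Lp_dist p M v (\<phi> t) < d \<Longrightarrow> Lp_dist p M (g s v) (g t (\<phi> t)) < e"
    by blast
  obtain d' where d': "0 < d'" "\<And>s. s \<in> {0..T} \<Longrightarrow> \<bar>s - t\<bar> < d' \<Longrightarrow> Lp_dist p M (\<phi> s) (\<phi> t) < d / 2"
    using \<phi> t d(1) unfolding Lp_continuous_on_eps by (meson half_gt_zero)
  show "\<exists>\<delta>>0. \<forall>s\<in>{0..T}. \<bar>s - t\<bar> < \<delta> \<longrightarrow> Lp_dist p M (g s (\<phi> s)) (g t (\<phi> t)) < e"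
  proof (intro exI[of _ "min d' (d / 2)"] conjI ballI impI)
    fix s assume s: "s \<in> {0..T}" "\<bar>s - t\<bar> < min d' (d / 2)"
    have "\<bar>s - t\<bar> + Lp_dist p M (\<phi> s) (\<phi> t) < d" using d'(2)[OF s(1)] s(2) by auto
    then show "Lp_dist p M (g s (\<phi> s)) (g t (\<phi> t)) < e" using d(2)[OF _ L[OF s(1)]] s by auto
  qed (use d d' in auto)
qed

definition version :: "real \<Rightarrow> (real \<Rightarrow> 'a \<Rightarrow> real) \<Rightarrow> (real \<Rightarrow> 'a \<Rightarrow> real) \<Rightarrow> bool" where
  "version \<tau> U F \<longleftrightarrow> jointly_measurable F \<and> (\<forall>t\<in>{0..\<tau>}. AE x in M. F t x = g t (U t) x)"

text \<open>The version F is an explicit argument, so that two solutions can be compared although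
  their right-hand sides were represented independently.\<close>

definition mild :: "real \<Rightarrow> (real \<Rightarrow> 'a \<Rightarrow> real) \<Rightarrow> (real \<Rightarrow> 'a \<Rightarrow> real) \<Rightarrow> bool" where
  "mild \<tau> U F \<longleftrightarrow> Lp_continuous_on {0..\<tau>} U \<and> version \<tau> U F \<and>
     (\<forall>t\<in>{0..\<tau>}. AE x in M. U t x = u\<^sub>0 x + J F t x)"

text \<open>On the ball of radius r, B bounds g and L is its Lipschitz constant; C is the constant
  in the norm bound for \<open>J\<close>. The strict inequality in the first smallness condition is
  what the first exit argument contradicts; the second makes the contraction factor 1/2.\<close>

definition contraction_data :: "real \<Rightarrow> real \<Rightarrow> real \<Rightarrow> real \<Rightarrow> real \<Rightarrow> bool" where
  "contraction_data \<tau> r B L C \<longleftrightarrow> 0 < \<tau> \<and> \<tau> \<le> 1 \<and> 0 < r \<and> 0 < B \<and> 0 < L \<and> 0 < C \<and>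
     (\<forall>t\<in>{0..\<tau>}. \<forall>u\<in>Lp p M. Lp_dist p M u u\<^sub>0 \<le> r \<longrightarrow> Lp_norm p M (g t u) \<le> B) \<and>
     (\<forall>t\<in>{0..\<tau>}. \<forall>u\<in>Lp p M. \<forall>v\<in>Lp p M. Lp_dist p M u u\<^sub>0 \<le> r \<longrightarrow> Lp_dist p M v u\<^sub>0 \<le> r \<longrightarrow>
        Lp_dist p M (g t u) (g t v) \<le> L * Lp_dist p M u v) \<and>
     (\<forall>F B t. jointly_measurable F \<longrightarrow> 0 \<le> B \<longrightarrow> t \<in> {0..1} \<longrightarrow> (\<forall>s. 0 \<le> s \<and> s < t \<longrightarrow> Lp_le B (F s)) \<longrightarrow>
        Lp_le (C * B * t powr \<alpha>\<^sub>0) (J F t)) \<and>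
     C * B * \<tau> powr \<alpha>\<^sub>0 < r \<and> C * L * \<tau> powr \<alpha>\<^sub>0 \<le> 1 / 2"

lemma contraction_data_exists: "\<exists>\<tau> r B L C. contraction_data \<tau> r B L C"
proof -
  obtain C where C: "0 < C"
    "\<And>F B t t'. jointly_measurable F \<Longrightarrow> 0 \<le> B \<Longrightarrow> 0 \<le> t \<Longrightarrow> t \<le> t' \<Longrightarrow> t' \<le> 1 \<Longrightarrow>
      (\<And>s. 0 \<le> s \<Longrightarrow> s < t' \<Longrightarrow> Lp_le B (F s)) \<Longrightarrow>
      Lp_le (C * B * (t' - t) powr \<alpha>\<^sub>0) (\<lambda>x. J F t' x - J F t x)"
    by (rule J_increment) blast
  have JB: "Lp_le (C * B * t powr \<alpha>\<^sub>0) (J F t)"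
    if "jointly_measurable F" "0 \<le> B" "t \<in> {0..1}" "\<forall>s. 0 \<le> s \<and> s < t \<longrightarrow> Lp_le B (F s)" for F B t
  proof -
    have "Lp_le (C * B * (t - 0) powr \<alpha>\<^sub>0) (\<lambda>x. J F t x - J F 0 x)" using that by (intro C(2)) auto
    then show ?thesis by (simp add: J_0)
  qed
  have "(0::real) \<le> 0" by simp
  from g_Lipschitz[unfolded locally_Lipschitz_Lp_def, rule_format, OF this u\<^sub>0]
  obtain r0 L where rL: "0 < r0" "0 < L"
    "\<And>t u v. (t, v) \<in> time_Lp_ball p M 0 u\<^sub>0 r0 \<Longrightarrow> (t, u) \<in> time_Lp_ball p M 0 u\<^sub>0 r0 \<Longrightarrow>
      Lp_dist p M (g t v) (g t u) \<le> L * Lp_dist p M v u" by blast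
  obtain d where d: "0 < d"
    "\<And>s v. 0 \<le> s \<Longrightarrow> v \<in> Lp p M \<Longrightarrow> \<bar>s - 0\<bar> + Lp_dist p M v u\<^sub>0 < d \<Longrightarrow> Lp_dist p M (g s v) (g 0 u\<^sub>0) < 1"
    using g_eps[OF order_refl u\<^sub>0, of 1] by auto
  \<comment> \<open>With \<tau> \<le> r, times and distances on the closed ball add up to at most 2
    * r = r0 / 2, inside the open time-space ball of the Lipschitz hypothesis.\<close>
  define r where "r = r0 / 4"
  \<comment> \<open>Three contributions: the value at (0, \<open>u\<^sub>0\<close>), at most 1 for
    the change in time at \<open>u\<^sub>0\<close> by continuity, and L * r for moving inside the
    ball.\<close>
  define B where "B = Lp_norm p M (g 0 u\<^sub>0) + 1 + L * r"
  have r: "0 < r" using rL by (simp add: r_def)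
  have B: "0 < B" using Lp_norm_nonneg[of "g 0 u\<^sub>0"] rL(2) r by (simp add: B_def add_nonneg_pos add_pos_pos)
  \<comment> \<open>Target size of \<open>\<tau> powr \<alpha>\<^sub>0\<close>. The + 1 in the
    denominator makes C * B * \<eta> strictly smaller than r.\<close>
  define \<eta> where "\<eta> = min (r / (C * B + 1)) (1 / (2 * C * L))"
  have CB: "0 < C * B" "0 < C * L" using C(1) B rL by auto
  have \<eta>: "0 < \<eta>" "C * B * \<eta> < r" "C * L * \<eta> \<le> 1 / 2"
  proof -
    show "0 < \<eta>" using r CB by (simp add: \<eta>_def)
    have "C * B * \<eta> \<le> C * B * (r / (C * B + 1))" using CB by (intro mult_left_mono) (auto simp: \<eta>_def)
    also have "\<dots> < r" using CB r by (simp add: field_simps)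
    finally show "C * B * \<eta> < r" .
    have "C * L * \<eta> \<le> C * L * (1 / (2 * C * L))" using CB by (intro mult_left_mono) (auto simp: \<eta>_def)
    also have "\<dots> = 1 / 2" using C(1) rL by simp
    finally show "C * L * \<eta> \<le> 1 / 2" .
  qed
  \<comment> \<open>The four bounds serve, in order, the kernel estimate, the ball of the Lipschitz
    hypothesis, continuity of g in time, and smallness of
    \<open>\<tau> powr \<alpha>\<^sub>0\<close>.\<close>
  define \<tau> where "\<tau> = min (min 1 r) (min (d / 2) (\<eta> powr (1 / \<alpha>\<^sub>0)))"
  have \<tau>: "0 < \<tau>" "\<tau> \<le> 1" "\<tau> \<le> r" "\<tau> < d" using r d(1) \<eta> by (auto simp: \<tau>_def)
  have "\<tau> powr \<alpha>\<^sub>0 \<le> (\<eta> powr (1 / \<alpha>\<^sub>0)) powr \<alpha>\<^sub>0" using \<tau>(1) \<alpha>\<^sub>0_pos by (intro powr_mono2) (auto simp: \<tau>_def)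
  then have \<tau>\<eta>: "\<tau> powr \<alpha>\<^sub>0 \<le> \<eta>" using \<eta> \<alpha>\<^sub>0_pos by (simp add: powr_powr)
  have small: "C * B * \<tau> powr \<alpha>\<^sub>0 < r" "C * L * \<tau> powr \<alpha>\<^sub>0 \<le> 1 / 2"
    using mult_left_mono[OF \<tau>\<eta>, of "C * B"] mult_left_mono[OF \<tau>\<eta>, of "C * L"] CB \<eta> by auto
  have ball: "(t, u) \<in> time_Lp_ball p M 0 u\<^sub>0 r0" if "t \<in> {0..\<tau>}" "u \<in> Lp p M" "Lp_dist p M u u\<^sub>0 \<le> r" for t u
    using that \<tau> r by (auto simp: time_Lp_ball_def r_def)
  have lip: "Lp_dist p M (g t u) (g t v) \<le> L * Lp_dist p M u v"
    if "t \<in> {0..\<tau>}" "u \<in> Lp p M" "v \<in> Lp p M" "Lp_dist p M u u\<^sub>0 \<le> r" "Lp_dist p M v u\<^sub>0 \<le> r" for t u v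
    by (intro rL(3) ball that)
  have "Lp_norm p M (g t u) \<le> B" if t: "t \<in> {0..\<tau>}" and u: "u \<in> Lp p M" "Lp_dist p M u u\<^sub>0 \<le> r" for t u
  proof -
    have t0: "0 \<le> t" using t by simp
    have z: "Lp_dist p M u\<^sub>0 u\<^sub>0 = 0" by (simp add: Lp_norm_eq_0I)
    have "Lp_norm p M (g t u) \<le> Lp_dist p M (g t u) (g t u\<^sub>0) + Lp_norm p M (g t u\<^sub>0)"
      using Lp_norm_add_le[OF Lp_diff[OF g_Lp[OF t0 u(1)] g_Lp[OF t0 u\<^sub>0]] g_Lp[OF t0 u\<^sub>0]] by simp
    moreover have "Lp_norm p M (g t u\<^sub>0) \<le> Lp_dist p M (g t u\<^sub>0) (g 0 u\<^sub>0) + Lp_norm p M (g 0 u\<^sub>0)"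
      using Lp_norm_add_le[OF Lp_diff[OF g_Lp[OF t0 u\<^sub>0] g_Lp[OF order_refl u\<^sub>0]] g_Lp[OF order_refl u\<^sub>0]] by simp
    moreover have "Lp_dist p M (g t u\<^sub>0) (g 0 u\<^sub>0) < 1" using d(2)[OF t0 u\<^sub>0] t \<tau> z by simp
    moreover have "Lp_dist p M (g t u) (g t u\<^sub>0) \<le> L * Lp_dist p M u u\<^sub>0" using t u u\<^sub>0 z r by (intro lip) auto
    moreover have "L * Lp_dist p M u u\<^sub>0 \<le> L * r" using u rL by (intro mult_left_mono) auto
    ultimately show ?thesis by (simp add: B_def)
  qed
  then have "contraction_data \<tau> r B L C"
    unfolding contraction_data_def using \<tau> r B rL(2) C(1) lip JB small by blast
  then show ?thesis by blast
qed

section \<open>Mild solutions on a fixed short interval\<close>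

context
  fixes \<tau> r B L C
  assumes data: "contraction_data \<tau> r B L C"
begin

lemma data_pos: "0 < \<tau>" "\<tau> \<le> 1" "0 < r" "0 < B" "0 < L" "0 < C"
  and data_small: "C * B * \<tau> powr \<alpha>\<^sub>0 < r" "C * L * \<tau> powr \<alpha>\<^sub>0 \<le> 1 / 2"
  using data unfolding contraction_data_def by blast+

lemma data_bound: "t \<in> {0..\<tau>} \<Longrightarrow> u \<in> Lp p M \<Longrightarrow> Lp_dist p M u u\<^sub>0 \<le> r \<Longrightarrow> Lp_norm p M (g t u) \<le> B"
  and data_Lipschitz: "t \<in> {0..\<tau>} \<Longrightarrow> u \<in> Lp p M \<Longrightarrow> v \<in> Lp p M \<Longrightarrow> Lp_dist p M u u\<^sub>0 \<le> r \<Longrightarrow>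
    Lp_dist p M v u\<^sub>0 \<le> r \<Longrightarrow> Lp_dist p M (g t u) (g t v) \<le> L * Lp_dist p M u v"
  using data unfolding contraction_data_def by blast+

lemma data_J:
  "jointly_measurable F \<Longrightarrow> 0 \<le> K \<Longrightarrow> t \<in> {0..\<tau>} \<Longrightarrow> (\<And>s. 0 \<le> s \<Longrightarrow> s < t \<Longrightarrow> Lp_le K (F s)) \<Longrightarrow>
    Lp_le (C * K * t powr \<alpha>\<^sub>0) (J F t)"
proof -
  assume a: "jointly_measurable F" "0 \<le> K" "t \<in> {0..\<tau>}" "\<And>s. 0 \<le> s \<Longrightarrow> s < t \<Longrightarrow> Lp_le K (F s)"
  then have "t \<in> {0..1}" using data_pos(2) by auto
  with a show ?thesis using data unfolding contraction_data_def by blast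
qed

lemma t_powr_le: "t \<in> {0..\<tau>} \<Longrightarrow> t powr \<alpha>\<^sub>0 \<le> \<tau> powr \<alpha>\<^sub>0"
  using \<alpha>\<^sub>0_pos by (intro powr_mono2) auto

lemma version_bound:
  assumes "version \<tau> U F" "t \<in> {0..\<tau>}" "U t \<in> Lp p M" "Lp_dist p M (U t) u\<^sub>0 \<le> r"
  shows "Lp_le B (F t)"
proof (rule Lp_le_cong_AE)
  have "g t (U t) \<in> Lp p M" using assms by (intro g_Lp) auto
  then show "Lp_le B (g t (U t))" using assms data_bound data_pos by (subst Lp_le_iff) auto
qed (use assms data_pos in \<open>auto simp: version_def intro: jointly_measurableD1\<close>)

text \<open>J F t looks only at times before t, so nothing is assumed about U t itself; the
  conclusion is strict, so U cannot reach distance r at t.\<close>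

lemma J_stays_in_ball:
  assumes v: "version \<tau> U F" and t: "t \<in> {0..\<tau>}"
    and U: "\<And>s. 0 \<le> s \<Longrightarrow> s < t \<Longrightarrow> U s \<in> Lp p M \<and> Lp_dist p M (U s) u\<^sub>0 \<le> r"
  shows "J F t \<in> Lp p M" "Lp_norm p M (J F t) < r"
proof -
  have F: "Lp_le B (F s)" if "0 \<le> s" "s < t" for s
    using U[OF that] that t by (intro version_bound[OF v]) auto
  then have J: "Lp_le (C * B * t powr \<alpha>\<^sub>0) (J F t)"
    using v t data_pos by (intro data_J) (auto simp: version_def)
  have "0 \<le> C * B * t powr \<alpha>\<^sub>0" using data_pos by auto
  with J show "J F t \<in> Lp p M" by (rule Lp_le_imp_Lp)
  have "Lp_norm p M (J F t) \<le> C * B * t powr \<alpha>\<^sub>0" using J by (rule Lp_le_imp_norm) fact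
  also have "\<dots> \<le> C * B * \<tau> powr \<alpha>\<^sub>0" using t_powr_le[OF t] data_pos by (intro mult_left_mono) auto
  also have "\<dots> < r" by (rule data_small)
  finally show "Lp_norm p M (J F t) < r" .
qed

text \<open>F - G is bounded by L * K before t, and J multiplies bounds by at most
  \<open>C * \<tau> powr \<alpha>\<^sub>0\<close>; together with L this is at most 1/2. F and G may
  be any versions.\<close>

lemma J_contraction:
  assumes v: "version \<tau> U F" "version \<tau> V G" and t: "t \<in> {0..\<tau>}" and K: "0 \<le> K"
    and U: "\<And>s. s \<in> {0..\<tau>} \<Longrightarrow> U s \<in> Lp p M \<and> Lp_dist p M (U s) u\<^sub>0 \<le> r"
    and V: "\<And>s. s \<in> {0..\<tau>} \<Longrightarrow> V s \<in> Lp p M \<and> Lp_dist p M (V s) u\<^sub>0 \<le> r"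
    and UV: "\<And>s. s \<in> {0..\<tau>} \<Longrightarrow> Lp_dist p M (U s) (V s) \<le> K"
  shows "Lp_dist p M (J F t) (J G t) \<le> K / 2"
proof -
  have jm: "jointly_measurable F" "jointly_measurable G" using v by (auto simp: version_def)
  have B: "Lp_le B (F s)" "Lp_le B (G s)" if "0 \<le> s" "s < t" for s
    using that t U V by (auto intro!: version_bound[OF v(1)] version_bound[OF v(2)])
  have FG: "Lp_le (L * K) (\<lambda>x. F s x - G s x)" if "0 \<le> s" "s < t" for s
  proof (rule Lp_le_cong_AE)
    have s: "s \<in> {0..\<tau>}" using that t by auto
    have "Lp_dist p M (g s (U s)) (g s (V s)) \<le> L * Lp_dist p M (U s) (V s)"
      using U[OF s] V[OF s] s by (intro data_Lipschitz) auto
    also have "\<dots> \<le> L * K" using UV[OF s] data_pos by (intro mult_left_mono) auto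
    finally show "Lp_le (L * K) (\<lambda>x. g s (U s) x - g s (V s) x)"
      using U[OF s] V[OF s] that K data_pos by (subst Lp_le_iff) (auto intro!: Lp_diff g_Lp)
    have "AE x in M. F s x = g s (U s) x" "AE x in M. G s x = g s (V s) x" using v s by (auto simp: version_def)
    then show "AE x in M. F s x - G s x = g s (U s) x - g s (V s) x" by eventually_elim auto
    show "(\<lambda>x. F s x - G s x) \<in> borel_measurable M"
      using jm[THEN jointly_measurableD1] by (intro borel_measurable_diff) auto
  qed (use K data_pos in auto)
  have "Lp_le (C * (L * K) * t powr \<alpha>\<^sub>0) (J (\<lambda>s x. F s x - G s x) t)"
    using K data_pos t FG by (intro data_J jointly_measurable_diff jm) auto
  moreover have "AE x in M. J (\<lambda>s x. F s x - G s x) t x = J F t x - J G t x"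
    using t data_pos B by (intro J_diff[OF jm, of B]) auto
  then have "AE x in M. J F t x - J G t x = J (\<lambda>s x. F s x - G s x) t x" by eventually_elim auto
  moreover have "(\<lambda>x. J F t x - J G t x) \<in> borel_measurable M"
    using jm[THEN jointly_measurable_J, THEN jointly_measurableD1] by (intro borel_measurable_diff) auto
  moreover have nn: "0 \<le> C * (L * K) * t powr \<alpha>\<^sub>0" using K data_pos by auto
  ultimately have "Lp_le (C * (L * K) * t powr \<alpha>\<^sub>0) (\<lambda>x. J F t x - J G t x)"
    by (blast intro: Lp_le_cong_AE)
  then have "Lp_dist p M (J F t) (J G t) \<le> C * (L * K) * t powr \<alpha>\<^sub>0" using nn by (rule Lp_le_imp_norm)
  also have "\<dots> = C * L * t powr \<alpha>\<^sub>0 * K" by (simp add: mult_ac)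
  also have "C * L * t powr \<alpha>\<^sub>0 \<le> C * L * \<tau> powr \<alpha>\<^sub>0" using t_powr_le[OF t] data_pos by (intro mult_left_mono) auto
  also have "\<dots> \<le> 1 / 2" by (rule data_small)
  finally show ?thesis using K by (simp add: mult_right_mono)
qed

lemma mild_dist_u\<^sub>0:
  assumes m: "mild \<tau> U F" and t: "t \<in> {0..\<tau>}"
  shows "Lp_dist p M (U t) u\<^sub>0 = Lp_norm p M (J F t)"
proof (rule Lp_norm_cong_AE)
  have "AE x in M. U t x = u\<^sub>0 x + J F t x" using m t by (simp add: mild_def)
  then show "AE x in M. U t x - u\<^sub>0 x = J F t x" by eventually_elim simp
  show "(\<lambda>x. U t x - u\<^sub>0 x) \<in> borel_measurable M"
    using m t u\<^sub>0 by (intro Lp_measurable Lp_diff) (auto simp: mild_def intro: Lp_continuous_on_Lp)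
  show "J F t \<in> borel_measurable M"
    using m by (auto simp: mild_def version_def intro: jointly_measurableD1 jointly_measurable_J)
qed

text \<open>First exit argument: at the first time \<open>t\<^sub>1\<close> with \<open>\<parallel>U t\<^sub>1 - u\<^sub>0\<parallel> \<ge> r\<close> the values of \<open>U\<close> that
  enter \<open>J F t\<^sub>1\<close> lie in the ball.\<close>

lemma mild_stays_in_ball:
  assumes m: "mild \<tau> U F" and t: "t \<in> {0..\<tau>}"
  shows "U t \<in> Lp p M \<and> Lp_dist p M (U t) u\<^sub>0 \<le> r"
proof -
  have c: "Lp_continuous_on {0..\<tau>} U" and v: "version \<tau> U F" using m by (auto simp: mild_def)
  note UL = Lp_continuous_on_Lp[OF c]
  have "Lp_dist p M (U t) u\<^sub>0 \<le> r"
  proof (rule ccontr)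
    assume "\<not> ?thesis"
    then have tS: "t \<in> {s \<in> {0..\<tau>}. r \<le> Lp_dist p M (U s) u\<^sub>0}" using t by auto
    have "continuous_on {0..\<tau>} (\<lambda>s. Lp_dist p M (U s) u\<^sub>0)"
      using continuous_on_Lp_norm[OF Lp_continuous_on_diff[OF c Lp_continuous_on_const[OF u\<^sub>0]]] .
    then have "closed {s \<in> {0..\<tau>}. r \<le> Lp_dist p M (U s) u\<^sub>0}"
      by (intro continuous_closed_preimage[of _ _ "{r..}", simplified vimage_def Int_def, simplified]) auto
    then have "compact ({0..\<tau>} \<inter> {s \<in> {0..\<tau>}. r \<le> Lp_dist p M (U s) u\<^sub>0})" by (intro compact_Int_closed) auto
    moreover have "{0..\<tau>} \<inter> {s \<in> {0..\<tau>}. r \<le> Lp_dist p M (U s) u\<^sub>0} = {s \<in> {0..\<tau>}. r \<le> Lp_dist p M (U s) u\<^sub>0}" by auto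
    ultimately have "compact {s \<in> {0..\<tau>}. r \<le> Lp_dist p M (U s) u\<^sub>0}" by simp
    then obtain t1 where t1: "t1 \<in> {0..\<tau>}" "r \<le> Lp_dist p M (U t1) u\<^sub>0"
      and min: "\<And>s. s \<in> {0..\<tau>} \<Longrightarrow> r \<le> Lp_dist p M (U s) u\<^sub>0 \<Longrightarrow> t1 \<le> s"
      using compact_attains_inf[of "{s \<in> {0..\<tau>}. r \<le> Lp_dist p M (U s) u\<^sub>0}"] tS by blast
    have "Lp_norm p M (J F t1) < r"
    proof (rule J_stays_in_ball(2)[OF v t1(1)])
      fix s assume s: "0 \<le> s" "s < t1"
      then have "s \<in> {0..\<tau>}" using t1 by auto
      then show "U s \<in> Lp p M \<and> Lp_dist p M (U s) u\<^sub>0 \<le> r" using UL min[of s] s(2) by force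
    qed
    then show False using mild_dist_u\<^sub>0[OF m t1(1)] t1(2) by simp
  qed
  then show ?thesis using UL t by simp
qed

text \<open>No supremum over time is formed: a bound uniform in time, initially 2 * r because both
  curves lie in the ball, is halved again and again.\<close>

lemma mild_unique:
  assumes m: "mild \<tau> U F" "mild \<tau> V G" and t: "t \<in> {0..\<tau>}"
  shows "AE x in M. U t x = V t x"
proof -
  have v: "version \<tau> U F" "version \<tau> V G" using m by (auto simp: mild_def)
  note b = mild_stays_in_ball[OF m(1)] mild_stays_in_ball[OF m(2)]
  have eq: "Lp_dist p M (U t) (V t) = Lp_dist p M (J F t) (J G t)" if t: "t \<in> {0..\<tau>}" for t
  proof (rule Lp_norm_cong_AE)
    have "AE x in M. U t x = u\<^sub>0 x + J F t x" "AE x in M. V t x = u\<^sub>0 x + J G t x" using m t by (auto simp: mild_def)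
    then show "AE x in M. U t x - V t x = J F t x - J G t x" by eventually_elim simp
    show "(\<lambda>x. U t x - V t x) \<in> borel_measurable M" using b t by (intro Lp_measurable Lp_diff) auto
    show "(\<lambda>x. J F t x - J G t x) \<in> borel_measurable M"
      using v by (intro borel_measurable_diff jointly_measurableD1 jointly_measurable_J) (auto simp: version_def)
  qed
  have "Lp_dist p M (U t) (V t) \<le> 2 * r * (1/2)^n" if "t \<in> {0..\<tau>}" for n t
    using that
  proof (induction n arbitrary: t)
    case 0
    have "Lp_dist p M (U t) (V t) \<le> Lp_dist p M (U t) u\<^sub>0 + Lp_dist p M u\<^sub>0 (V t)"
      using b 0 u\<^sub>0 by (intro Lp_dist_triangle) auto
    then show ?case using b[of t] 0 Lp_dist_commute[of u\<^sub>0 "V t"] by simp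
  next
    case (Suc n)
    have "Lp_dist p M (J F t) (J G t) \<le> (2 * r * (1/2)^n) / 2"
      using Suc data_pos by (intro J_contraction[OF v] b) auto
    then show ?case using eq Suc by simp
  qed
  from this[OF t] have "Lp_dist p M (U t) (V t) \<le> 0"
  proof (rule LIMSEQ_le_const[rotated, OF exI, OF allI, OF impI])
    show "(\<lambda>n. 2 * r * (1/2)^n) \<longlonglongrightarrow> 0" by (intro tendsto_mult_right_zero LIMSEQ_power_zero) auto
  qed
  then show ?thesis using b t by (intro Lp_dist_eq_0D) auto
qed

definition curve_in_ball :: "(real \<Rightarrow> 'a \<Rightarrow> real) \<Rightarrow> bool" where
  "curve_in_ball U \<longleftrightarrow> jointly_measurable U \<and> Lp_continuous_on {0..\<tau>} U \<and>
    (\<forall>t\<in>{0..\<tau>}. Lp_dist p M (U t) u\<^sub>0 \<le> r)"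

lemma curve_in_ballD:
  assumes "curve_in_ball U" "t \<in> {0..\<tau>}"
  shows "U t \<in> Lp p M \<and> Lp_dist p M (U t) u\<^sub>0 \<le> r"
  using assms Lp_continuous_on_Lp[of "{0..\<tau>}" U t] by (auto simp: curve_in_ball_def)

lemma curve_in_ball_step:
  assumes U: "curve_in_ball U" and v: "version \<tau> U F"
  shows "curve_in_ball (\<lambda>t x. u\<^sub>0 x + J F t x)"
  unfolding curve_in_ball_def
proof (intro conjI ballI)
  have F: "jointly_measurable F" using v by (simp add: version_def)
  show "jointly_measurable (\<lambda>t x. u\<^sub>0 x + J F t x)"
    using u\<^sub>0 by (intro jointly_measurable_add jointly_measurable_const jointly_measurable_J F Lp_measurable)
  show "Lp_continuous_on {0..\<tau>} (\<lambda>t x. u\<^sub>0 x + J F t x)"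
  proof (rule Lp_continuous_on_J[OF F data_pos(2) _ _ u\<^sub>0])
    show "Lp_le B (F s)" if "s \<in> {0..\<tau>}" for s
      using curve_in_ballD[OF U that] by (intro version_bound[OF v that]) auto
  qed (use data_pos in auto)
  fix t assume t: "t \<in> {0..\<tau>}"
  have "Lp_norm p M (J F t) < r"
    by (rule J_stays_in_ball(2)[OF v t]) (use t curve_in_ballD[OF U] in auto)
  then show "Lp_norm p M (\<lambda>x. u\<^sub>0 x + J F t x - u\<^sub>0 x) \<le> r" by simp
qed

lemma ex_version: "Lp_continuous_on {0..\<tau>} U \<Longrightarrow> \<exists>F. version \<tau> U F"
  unfolding version_def by (intro jointly_measurable_version Lp_continuous_on_g)

text \<open>Picard iteration from the constant curve. The limit V satisfies the fixed point equation
  only almost everywhere at each time; the curve \<Phi> V has the form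
  \<open>u\<^sub>0 + J F\<close> at every point, which makes its initial value and joint
  measurability exact.\<close>

lemma mild_exists: "\<exists>F. mild \<tau> (\<lambda>t x. u\<^sub>0 x + J F t x) F"
proof -
  define ver where "ver U = (SOME F. version \<tau> U F)" for U
  have ver: "version \<tau> U (ver U)" if "curve_in_ball U" for U
    using someI_ex[OF ex_version[of U]] that by (simp add: ver_def curve_in_ball_def)
  define \<Phi> where "\<Phi> U = (\<lambda>t x. u\<^sub>0 x + J (ver U) t x)" for U
  have \<Phi>: "curve_in_ball (\<Phi> U)" if "curve_in_ball U" for U
    unfolding \<Phi>_def by (rule curve_in_ball_step[OF that ver[OF that]])
  have contr: "Lp_dist p M (\<Phi> U t) (\<Phi> V t) \<le> K / 2"
    if "curve_in_ball U" "curve_in_ball V" "t \<in> {0..\<tau>}" "0 \<le> K"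
      "\<And>s. s \<in> {0..\<tau>} \<Longrightarrow> Lp_dist p M (U s) (V s) \<le> K" for U V t K
    using J_contraction[OF ver[OF that(1)] ver[OF that(2)] that(3,4) curve_in_ballD[OF that(1)] curve_in_ballD[OF that(2)] that(5)]
    by (simp add: \<Phi>_def)
  define u where "u n = (\<Phi> ^^ n) (\<lambda>_. u\<^sub>0)" for n
  have u: "curve_in_ball (u n)" for n
  proof (induction n)
    case 0
    show ?case using data_pos u\<^sub>0
      by (simp add: u_def curve_in_ball_def jointly_measurable_const Lp_measurable Lp_continuous_on_const Lp_norm_eq_0I)
  qed (simp add: u_def \<Phi>)
  note uD = curve_in_ballD[OF u]
  have step: "Lp_dist p M (u (Suc n) t) (u n t) \<le> r * (1/2)^n" if "t \<in> {0..\<tau>}" for n t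
    using that
  proof (induction n arbitrary: t)
    case 0
    then show ?case using uD[of t 1] by (simp add: u_def)
  next
    case (Suc n)
    then show ?case using contr[OF u[of "Suc n"] u[of n], of t "r * (1/2)^n"] data_pos by (simp add: u_def)
  qed
  \<comment> \<open>A pointwise limit of jointly measurable iterates is jointly measurable. The
    steps r * (1/2)^n sum to the tail 2 * r * (1/2)^n.\<close>
  define V where "V t x = lim (\<lambda>n. u n t x)" for t x
  have V: "V t \<in> Lp p M" "Lp_dist p M (V t) (u n t) \<le> 2 * r * (1/2)^n" if "t \<in> {0..\<tau>}" for t n
    using Lp_fast_Cauchy[of "\<lambda>n. u n t" r] uD that step data_pos by (auto simp: V_def[abs_def])
  have small: "\<exists>n. 2 * r * (1/2)^n < e" if "0 < e" for e :: real
  proof -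
    have "(\<lambda>n. 2 * r * (1/2)^n) \<longlonglongrightarrow> 0" by (intro tendsto_mult_right_zero LIMSEQ_power_zero) auto
    from order_tendstoD(2)[OF this that] show ?thesis by (auto simp: eventually_sequentially)
  qed
  have Vc: "Lp_continuous_on {0..\<tau>} V"
    unfolding Lp_continuous_on_eps
  proof (intro conjI ballI allI impI V(1))
    fix t e :: real assume t: "t \<in> {0..\<tau>}" and e: "0 < e"
    obtain n where n: "2 * r * (1/2)^n < e / 3" using small[of "e / 3"] e by auto
    have "Lp_continuous_on {0..\<tau>} (u n)" using u by (simp add: curve_in_ball_def)
    moreover have "0 < e / 3" using e by simp
    ultimately obtain d where d: "d > 0" "\<And>s. s \<in> {0..\<tau>} \<Longrightarrow> \<bar>s - t\<bar> < d \<Longrightarrow> Lp_dist p M (u n s) (u n t) < e / 3"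
      unfolding Lp_continuous_on_eps using t by meson
    show "\<exists>\<delta>>0. \<forall>s\<in>{0..\<tau>}. \<bar>s - t\<bar> < \<delta> \<longrightarrow> Lp_dist p M (V s) (V t) < e"
    proof (intro exI[of _ d] conjI ballI impI d(1))
      fix s assume s: "s \<in> {0..\<tau>}" "\<bar>s - t\<bar> < d"
      have "Lp_dist p M (V s) (V t) \<le> Lp_dist p M (V s) (u n s) + Lp_dist p M (u n s) (V t)"
        using V(1) uD s t by (intro Lp_dist_triangle) auto
      also have "Lp_dist p M (u n s) (V t) \<le> Lp_dist p M (u n s) (u n t) + Lp_dist p M (u n t) (V t)"
        using V(1) uD s t by (intro Lp_dist_triangle) auto
      finally show "Lp_dist p M (V s) (V t) < e"
        using V(2)[OF s(1), of n] V(2)[OF t, of n] n d(2)[OF s] Lp_dist_commute[of "u n t" "V t"] by linarith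
    qed
  qed
  have "Lp_dist p M (V t) u\<^sub>0 \<le> r" if t: "t \<in> {0..\<tau>}" for t
  proof (rule field_le_epsilon)
    fix e :: real assume "0 < e"
    then obtain n where n: "2 * r * (1/2)^n < e" using small by blast
    have "Lp_dist p M (V t) u\<^sub>0 \<le> Lp_dist p M (V t) (u n t) + Lp_dist p M (u n t) u\<^sub>0"
      using V(1) uD t u\<^sub>0 by (intro Lp_dist_triangle) auto
    then show "Lp_dist p M (V t) u\<^sub>0 \<le> r + e" using uD[OF t, of n] V(2)[OF t, of n] n by linarith
  qed
  moreover have "jointly_measurable V"
  proof -
    have [measurable]: "(\<lambda>z. u n (fst z) (snd z)) \<in> borel_measurable (lborel \<Otimes>\<^sub>M M)" for n
    proof -
      have "jointly_measurable (u n)" using u[of n] by (simp add: curve_in_ball_def)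
      then show ?thesis by (simp add: jointly_measurable_def split_beta')
    qed
    show ?thesis unfolding jointly_measurable_def V_def split_beta by measurable
  qed
  ultimately have Vb: "curve_in_ball V" using Vc by (simp add: curve_in_ball_def)
  have eq: "AE x in M. \<Phi> V t x = V t x" if t: "t \<in> {0..\<tau>}" for t
  proof (rule Lp_dist_eq_0D)
    show "Lp_dist p M (\<Phi> V t) (V t) \<le> 0"
    proof (rule field_le_epsilon)
      fix e :: real assume "0 < e"
      then obtain n where n: "2 * r * (1/2)^n < e / 2" using small[of "e / 2"] by auto
      \<comment> \<open>u (Suc n) is \<Phi> (u n), so its distances to \<Phi> V and to V are each at
        most half of 2 * r * (1/2)^n, by contraction and by convergence.\<close>
      have "Lp_dist p M (\<Phi> V t) (V t) \<le> Lp_dist p M (\<Phi> V t) (u (Suc n) t) + Lp_dist p M (u (Suc n) t) (V t)"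
        using V(1) uD t curve_in_ballD[OF \<Phi>[OF Vb]] by (intro Lp_dist_triangle) auto
      also have "Lp_dist p M (\<Phi> V t) (u (Suc n) t) \<le> (2 * r * (1/2)^n) / 2"
        using contr[OF Vb u[of n] t, of "2 * r * (1/2)^n"] V(2) data_pos by (simp add: u_def)
      also have "Lp_dist p M (u (Suc n) t) (V t) \<le> (2 * r * (1/2)^n) / 2"
        using V(2)[OF t, of "Suc n"] by (simp add: Lp_dist_commute[of "u (Suc n) t"])
      finally have "Lp_dist p M (\<Phi> V t) (V t) \<le> 2 * r * (1/2)^n" by simp
      moreover have "0 \<le> 2 * r * (1/2)^n" using data_pos by simp
      ultimately show "Lp_dist p M (\<Phi> V t) (V t) \<le> 0 + e" using n \<open>0 < e\<close> by linarith
    qed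
  qed (use V(1) t curve_in_ballD[OF \<Phi>[OF Vb]] in auto)
  have "version \<tau> (\<Phi> V) (ver V)"
    unfolding version_def
  proof (intro conjI ballI)
    show "jointly_measurable (ver V)" using ver[OF Vb] by (simp add: version_def)
    fix t assume t: "t \<in> {0..\<tau>}"
    have "AE x in M. ver V t x = g t (V t) x" using ver[OF Vb] t by (simp add: version_def)
    moreover have "AE x in M. g t (\<Phi> V t) x = g t (V t) x"
      using t V(1) curve_in_ballD[OF \<Phi>[OF Vb]] eq by (intro g_cong_AE) auto
    ultimately show "AE x in M. ver V t x = g t (\<Phi> V t) x" by eventually_elim simp
  qed
  \<comment> \<open>The version chosen for V also serves \<Phi> V, since g respects equality almost
    everywhere.\<close>
  then have "mild \<tau> (\<Phi> V) (ver V)"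
    using \<Phi>[OF Vb] by (simp add: mild_def curve_in_ball_def) (simp add: \<Phi>_def)
  then show ?thesis unfolding \<Phi>_def by blast
qed

end
end

section \<open>Lebesgue measure on a product\<close>

lemma sigma_finite_completion:
  assumes "sigma_finite_measure M"
  shows "sigma_finite_measure (completion M)"
proof -
  interpret sigma_finite_measure M by fact
  obtain A where "countable A" "A \<subseteq> sets M" "\<Union>A = space M" "\<forall>a\<in>A. emeasure M a \<noteq> \<infinity>"
    using sigma_finite_countable by auto
  then show ?thesis
    by (intro sigma_finite_measure.intro exI[of _ A]) (auto simp: emeasure_completion main_part_sets subset_eq)
qed

lemma sigma_finite_lebesgue_on:
  "S \<in> sets lebesgue \<Longrightarrow> sigma_finite_measure (lebesgue_on S)"
  by (intro sigma_finite_measure_restrict_space sigma_finite_completion lborel.sigma_finite_measure_axioms) auto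

lemma AE_lebesgue_on_iff:
  "S \<in> sets lebesgue \<Longrightarrow> (AE x in lebesgue_on S. P x) \<longleftrightarrow> (AE x in lborel. x \<in> S \<longrightarrow> P x)"
  by (simp add: AE_restrict_space_iff AE_completion_iff)

text \<open>Preimages under f and g differ only inside the set where f and g differ, a null set all
  of whose subsets are measurable in the completion.\<close>

lemma borel_measurable_completion_cong_AE:
  fixes f g :: "'a \<Rightarrow> 'b :: topological_space"
  assumes g[measurable]: "g \<in> borel_measurable (completion M)" and eq: "AE x in M. f x = g x"
  shows "f \<in> borel_measurable (completion M)"
proof (rule measurableI)
  fix B :: "'b set" assume B[measurable]: "B \<in> sets borel"
  have [measurable]: "Measurable.pred (completion M) (\<lambda>x. f x \<noteq> g x \<and> f x \<in> B)"
    "Measurable.pred (completion M) (\<lambda>x. f x \<noteq> g x)"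
    by (rule sets_completion_AE, use eq in eventually_elim, simp)+
  have "{x \<in> space (completion M). (f x \<noteq> g x \<and> f x \<in> B) \<or> (\<not> f x \<noteq> g x \<and> g x \<in> B)} \<in> sets (completion M)"
    by measurable
  moreover have "f -` B \<inter> space (completion M) = {x \<in> space (completion M). (f x \<noteq> g x \<and> f x \<in> B) \<or> (\<not> f x \<noteq> g x \<and> g x \<in> B)}"
    by auto
  ultimately show "f -` B \<inter> space (completion M) \<in> sets (completion M)" by simp
qed simp

text \<open>Beyond Borel sets one has to pull back null sets: the preimage of a null set A is UNIV
  \<times> A, which the product measure assigns measure 0 even though UNIV has infinite
  measure.\<close>

lemma measurable_snd_lebesgue:
  "(snd :: 'a::euclidean_space \<times> 'b::euclidean_space \<Rightarrow> 'b) \<in> lebesgue \<rightarrow>\<^sub>M lebesgue"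
proof (rule completion.measurable_completion2)
  show m: "(snd :: 'a \<times> 'b \<Rightarrow> 'b) \<in> lebesgue \<rightarrow>\<^sub>M lborel"
    by (rule measurable_completion) (simp add: borel_measurable_continuous_onI continuous_on_snd)
  show "null_sets lborel \<subseteq> null_sets (distr lebesgue lborel (snd :: 'a \<times> 'b \<Rightarrow> 'b))"
  proof
    fix A :: "'b set" assume A: "A \<in> null_sets lborel"
    have "(UNIV :: 'a set) \<times> A \<in> null_sets (lborel \<Otimes>\<^sub>M lborel)"
      using null_setsD1[OF A] null_setsD2[OF A]
      by (intro null_setsI) (simp_all add: lborel.emeasure_pair_measure_Times)
    then have "(UNIV :: 'a set) \<times> A \<in> null_sets lebesgue"
      unfolding lborel_prod by (rule null_sets_completionI)
    moreover have "snd -` A \<inter> space lebesgue = (UNIV :: 'a set) \<times> A" by auto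
    ultimately show "A \<in> null_sets (distr lebesgue lborel (snd :: 'a \<times> 'b \<Rightarrow> 'b))"
      using null_setsD2[OF A] by (simp only: null_sets_distr_iff[OF m])
  qed
qed

lemma lebesgue_on_Times_measurable:
  fixes F :: "real \<Rightarrow> 'a::euclidean_space \<Rightarrow> real"
  assumes F: "(\<lambda>(t, x). F t x) \<in> borel_measurable (lborel \<Otimes>\<^sub>M lebesgue_on \<Omega>)"
  shows "(\<lambda>(t, x). F t x) \<in> borel_measurable (lebesgue_on (I \<times> \<Omega>))"
proof -
  have "fst \<in> lebesgue_on (I \<times> \<Omega>) \<rightarrow>\<^sub>M (lborel :: real measure)"
    by (intro measurable_restrict_space1 measurable_completion) (simp add: borel_measurable_continuous_onI continuous_on_fst)
  moreover have "snd \<in> lebesgue_on (I \<times> \<Omega>) \<rightarrow>\<^sub>M lebesgue_on \<Omega>"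
    by (intro measurable_restrict_space2 measurable_restrict_space1 measurable_snd_lebesgue) auto
  ultimately have "(\<lambda>z. (fst z, snd z)) \<in> lebesgue_on (I \<times> \<Omega>) \<rightarrow>\<^sub>M (lborel \<Otimes>\<^sub>M lebesgue_on \<Omega>)"
    by (rule measurable_Pair)
  from measurable_compose[OF this F] show ?thesis by (simp add: split_beta')
qed

text \<open>D is measurable only in the completed product, so it is split into a Borel part S and a
  piece inside a Borel null set N'. Almost every section of N' is null, hence Fubini can be applied
  to the Borel set S \<union> N'.\<close>

lemma AE_AE_swap_lebesgue:
  fixes D :: "('a::euclidean_space \<times> 'b::euclidean_space) set"
  assumes D: "D \<in> sets lebesgue" and null: "\<And>t. AE x in lborel. (t, x) \<notin> D"
  shows "AE x in lborel. AE t in lborel. (t, x) \<notin> D"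
proof -
  obtain S N N' where S: "D = S \<union> N" "N \<subseteq> N'" "N' \<in> null_sets lborel" "S \<in> sets lborel"
    using D by (rule sets_completionE)
  have sets: "S \<in> sets (lborel \<Otimes>\<^sub>M lborel)" "N' \<in> sets (lborel \<Otimes>\<^sub>M lborel)"
    using S(4) null_setsD2[OF S(3)] by (simp_all only: lborel_prod)
  have "AE z in lborel \<Otimes>\<^sub>M lborel. z \<notin> N'"
    unfolding lborel_prod using S(3) by (rule AE_not_in)
  then have "AE t in lborel. AE x in lborel. (t, x) \<notin> N'"
    by (rule lborel_pair.AE_pair)
  then have "AE t in lborel. AE x in lborel. (t, x) \<notin> S \<union> N'"
  proof eventually_elim
    case (elim t)
    with null[of t] show ?case by eventually_elim (auto simp: S(1))
  qed
  moreover have "{z \<in> space (lborel \<Otimes>\<^sub>M lborel). (fst z, snd z) \<notin> S \<union> N'} \<in> sets (lborel \<Otimes>\<^sub>M lborel)"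
  proof -
    have "{z \<in> space (lborel \<Otimes>\<^sub>M lborel). (fst z, snd z) \<notin> S \<union> N'} = space (lborel \<Otimes>\<^sub>M lborel) - (S \<union> N')"
      by auto
    then show ?thesis using sets by (simp only: sets.Diff sets.top sets.Un)
  qed
  ultimately have "AE x in lborel. AE t in lborel. (t, x) \<notin> S \<union> N'"
    using lborel_pair.AE_commute[of "\<lambda>t x. (t, x) \<notin> S \<union> N'"] by blast
  then show ?thesis
  proof eventually_elim
    case (elim x)
    then show ?case by eventually_elim (use S in auto)
  qed
qed

text \<open>Only k is assumed measurable. A slice of a solution at fixed x inherits measurability in
  time from its version through completeness of Lebesgue measure.\<close>

lemma RL_integral_cong_AE:
  assumes k[measurable]: "(\<lambda>s. k s x) \<in> borel_measurable lborel"
    and eq: "AE s in lborel. s \<in> {0..t} \<longrightarrow> h s x = k s x" and b: "\<beta> x \<noteq> 0"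
  shows "RL_integral \<beta> h t x = RL_integral \<beta> k t x"
proof -
  have eq': "AE s in lborel. indicator {0..t} s *\<^sub>R ((t - s) powr (\<beta> x - 1) * h s x)
      = indicator {0..t} s *\<^sub>R ((t - s) powr (\<beta> x - 1) * k s x)"
    using eq by eventually_elim (auto simp: indicator_def)
  have km: "(\<lambda>s. indicator {0..t} s *\<^sub>R ((t - s) powr (\<beta> x - 1) * k s x)) \<in> borel_measurable lebesgue"
    by (rule measurable_completion) measurable
  have "(LINT s:{0..t}|lebesgue. (t - s) powr (\<beta> x - 1) * h s x) = (LINT s:{0..t}|lebesgue. (t - s) powr (\<beta> x - 1) * k s x)"
    unfolding set_lebesgue_integral_def
    by (rule integral_cong_AE[OF borel_measurable_completion_cong_AE[OF km eq'] km AE_completion[OF eq']])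
  then show ?thesis using b by (simp add: RL_integral_def)
qed

section \<open>Solutions and mild solutions on a short interval\<close>

theorem theorem32:
  fixes p :: ennreal
    and \<Omega> :: "(real ^ 'n) set"
    and A :: "(real ^ 'n \<Rightarrow> real) \<Rightarrow> real ^ 'n \<Rightarrow> real"
    and \<alpha>\<^sub>0 :: real
    and \<alpha> u\<^sub>0 :: "real ^ 'n \<Rightarrow> real"
    and f :: "real \<Rightarrow> (real ^ 'n \<Rightarrow> real) \<Rightarrow> real ^ 'n \<Rightarrow> real"
  assumes "1 \<le> p"
    and "open \<Omega>"
    and "bounded_linear_Lp p (lebesgue_on \<Omega>) A"
    and "0 < \<alpha>\<^sub>0" and "\<alpha>\<^sub>0 < 1"
    and "\<alpha> \<in> Lp \<infinity> (lebesgue_on \<Omega>)"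
    and "AE x in lebesgue_on \<Omega>. \<alpha>\<^sub>0 \<le> \<alpha> x \<and> \<alpha> x \<le> 1"
    and "u\<^sub>0 \<in> Lp p (lebesgue_on \<Omega>)"
    and "continuous_Lp_map p (lebesgue_on \<Omega>) f"
    and "locally_Lipschitz_Lp p (lebesgue_on \<Omega>) f"
  shows "\<exists>\<tau>\<^sub>0>0.
     (\<exists>u. is_solution p \<Omega> \<alpha> A f u\<^sub>0 {0..\<tau>\<^sub>0} u) \<and>
     (\<forall>u v. is_solution p \<Omega> \<alpha> A f u\<^sub>0 {0..\<tau>\<^sub>0} u \<longrightarrow> is_solution p \<Omega> \<alpha> A f u\<^sub>0 {0..\<tau>\<^sub>0} v \<longrightarrow>
        (\<forall>t\<in>{0..\<tau>\<^sub>0}. AE x in lebesgue_on \<Omega>. u t x = v t x))"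
proof -
  define M where "M = lebesgue_on \<Omega>"
  define g where "g = (\<lambda>t u x. A u x + f t u x)"
  note asm = assms[folded M_def]
  have \<Omega>: "\<Omega> \<in> sets lebesgue" using assms(2) by auto
  interpret Lp_space M p
    by (intro Lp_space.intro Lp_space_axioms.intro asm(1)) (simp add: M_def sigma_finite_lebesgue_on[OF \<Omega>])
  have fL: "\<And>t u. 0 \<le> t \<Longrightarrow> u \<in> Lp p M \<Longrightarrow> f t u \<in> Lp p M" using asm(9) by (simp add: continuous_Lp_map_def)
  interpret fractional_problem M p \<alpha> \<alpha>\<^sub>0 g u\<^sub>0
  proof unfold_locales
    show "\<alpha> \<in> borel_measurable M" using asm(6) by (simp add: Lp_def)
    show "continuous_Lp_map p M g" unfolding g_def by (rule continuous_Lp_map_plus_linear[OF asm(3,9)])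
    show "locally_Lipschitz_Lp p M g" unfolding g_def by (rule locally_Lipschitz_Lp_plus_linear[OF asm(3) fL asm(10)])
  qed (use asm in auto)
  obtain \<tau> r B L C where data: "contraction_data \<tau> r B L C" using contraction_data_exists by blast
  have \<tau>: "0 < \<tau>" "\<tau> \<le> 1" using data_pos(1,2)[OF data] .

  have ex: "\<exists>u. is_solution p \<Omega> \<alpha> A f u\<^sub>0 {0..\<tau>} u"
  proof -
    obtain F where m: "mild \<tau> (\<lambda>t x. u\<^sub>0 x + J F t x) F" using mild_exists[OF data] by blast
    define U where "U = (\<lambda>t x. u\<^sub>0 x + J F t x)"
    have c: "Lp_continuous_on {0..\<tau>} U" and F: "jointly_measurable F"
      and Fg: "\<And>t. t \<in> {0..\<tau>} \<Longrightarrow> AE x in M. F t x = g t (U t) x"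
      using m by (auto simp: mild_def version_def U_def)
    have Fc: "Lp_continuous_on {0..\<tau>} F"
      by (rule Lp_continuous_on_cong_AE[OF Lp_continuous_on_g[OF c] jointly_measurableD1[OF F] Fg])
    have Um: "jointly_measurable U"
      unfolding U_def using u\<^sub>0 by (intro jointly_measurable_add jointly_measurable_const jointly_measurable_J F Lp_measurable)
    \<comment> \<open>J F vanishes at time 0 for every x, so subtracting the initial value leaves
      exactly J F, with no exceptional set.\<close>
    have w: "(\<lambda>t x. U t x - U 0 x) = J F" by (simp add: U_def J_0 fun_eq_iff)
    have "is_solution p \<Omega> \<alpha> A f u\<^sub>0 {0..\<tau>} U"
      unfolding is_solution_def
    proof (intro conjI ballI)
      show "U \<in> Lp_curves p {0..\<tau>} \<Omega>"
        using lebesgue_on_Times_measurable[OF Um[unfolded jointly_measurable_def, unfolded M_def]]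
          c[unfolded Lp_continuous_on_def, unfolded M_def]
        by (simp add: Lp_curves_def)
      show "AE x in lebesgue_on \<Omega>. U 0 x = u\<^sub>0 x" by (simp add: U_def J_0)
      fix t assume t: "t \<in> {0..\<tau>}"
      have "has_Caputo_derivative p \<Omega> \<alpha> U (F t) t {0..\<tau>}"
        unfolding has_Caputo_derivative_def has_RL_derivative_def w M_def[symmetric]
        using Caputo_of_J[OF F Fc \<tau>(2)] t by blast
      moreover have "AE x in lebesgue_on \<Omega>. F t x = A (U t) x + f t (U t) x"
        using Fg[OF t] unfolding g_def M_def .
      ultimately show "\<exists>G. has_Caputo_derivative p \<Omega> \<alpha> U G t {0..\<tau>} \<and>
          (AE x in lebesgue_on \<Omega>. G x = A (U t) x + f t (U t) x)" by blast
    qed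
    then show ?thesis by blast
  qed
  \<comment> \<open>Uniqueness concerns arbitrary solutions; each agrees, time by time, with a curve
    satisfying the integral equation, to which uniqueness of mild solutions applies.\<close>
  have mild_version: "\<exists>U F. mild \<tau> U F \<and> (\<forall>t\<in>{0..\<tau>}. AE x in M. U t x = u t x)"
    if u: "is_solution p \<Omega> \<alpha> A f u\<^sub>0 {0..\<tau>} u" for u
  proof -
    have um: "(\<lambda>(t, x). u t x) \<in> borel_measurable (lebesgue_on ({0..\<tau>} \<times> \<Omega>))"
      and uc: "Lp_continuous_on {0..\<tau>} u"
      using u unfolding is_solution_def Lp_curves_def Lp_continuous_on_def
      unfolding M_def by blast+
    obtain U where U: "jointly_measurable U" and Uu: "\<And>t. t \<in> {0..\<tau>} \<Longrightarrow> AE x in M. U t x = u t x"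
      using jointly_measurable_version[OF uc] by blast
    have Uc: "Lp_continuous_on {0..\<tau>} U"
      by (rule Lp_continuous_on_cong_AE[OF uc jointly_measurableD1[OF U] Uu])
    obtain F where F: "jointly_measurable F" and Fg: "\<And>t. t \<in> {0..\<tau>} \<Longrightarrow> AE x in M. F t x = g t (U t) x"
      using jointly_measurable_version[OF Lp_continuous_on_g[OF Uc]] by blast
    have Fc: "Lp_continuous_on {0..\<tau>} F"
      by (rule Lp_continuous_on_cong_AE[OF Lp_continuous_on_g[OF Uc] jointly_measurableD1[OF F] Fg])
    \<comment> \<open>u and U agree for each t at almost every x, but the fractional integral sees
      whole time slices. The disagreement set D is Lebesgue measurable because
      \<open>Lp_curves\<close> demands joint measurability of u; Fubini then makes almost every
      slice agree.\<close>
    have slices: "AE x in M. AE s in lborel. s \<in> {0..\<tau>} \<longrightarrow> u s x = U s x"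
    proof -
      define D where "D = {z \<in> {0..\<tau>} \<times> \<Omega>. u (fst z) (snd z) \<noteq> U (fst z) (snd z)}"
      have S: "{0..\<tau>} \<times> \<Omega> \<in> sets lebesgue"
        using assms(2) by (intro sets_completionI_sets) (simp add: borel_Times)
      have "(\<lambda>z. u (fst z) (snd z)) \<in> borel_measurable (lebesgue_on ({0..\<tau>} \<times> \<Omega>))"
        "(\<lambda>z. U (fst z) (snd z)) \<in> borel_measurable (lebesgue_on ({0..\<tau>} \<times> \<Omega>))"
        using um lebesgue_on_Times_measurable[OF U[unfolded jointly_measurable_def, unfolded M_def], of "{0..\<tau>}"]
        by (simp_all add: split_beta')
      then have "{z \<in> space (lebesgue_on ({0..\<tau>} \<times> \<Omega>)). u (fst z) (snd z) \<noteq> U (fst z) (snd z)} \<in> sets (lebesgue_on ({0..\<tau>} \<times> \<Omega>))"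
        by measurable
      then have "D \<in> sets lebesgue"
        using S by (simp add: D_def sets_restrict_space_iff)
      moreover have "AE x in lborel. (t, x) \<notin> D" for t
      proof (cases "t \<in> {0..\<tau>}")
        case True
        have "AE x in lborel. x \<in> \<Omega> \<longrightarrow> U t x = u t x"
          using Uu[OF True] unfolding M_def AE_lebesgue_on_iff[OF \<Omega>] .
        then show ?thesis by eventually_elim (auto simp: D_def)
      next
        case False
        then have "(t, x) \<notin> D" for x by (auto simp: D_def)
        then show ?thesis by simp
      qed
      ultimately have "AE x in lborel. AE t in lborel. (t, x) \<notin> D" by (rule AE_AE_swap_lebesgue)
      then have "AE x in lborel. x \<in> \<Omega> \<longrightarrow> (AE s in lborel. s \<in> {0..\<tau>} \<longrightarrow> u s x = U s x)"
      proof eventually_elim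
        case (elim x)
        show ?case
        proof
          assume "x \<in> \<Omega>"
          with elim show "AE s in lborel. s \<in> {0..\<tau>} \<longrightarrow> u s x = U s x"
            by (elim AE_mp) (auto simp: D_def)
        qed
      qed
      then show ?thesis unfolding M_def AE_lebesgue_on_iff[OF \<Omega>] .
    qed
    define w where "w t x = U t x - U 0 x" for t x
    have wm: "jointly_measurable w"
      unfolding w_def by (intro jointly_measurable_diff jointly_measurable_const U jointly_measurableD1[OF U])
    have wc: "Lp_continuous_on {0..\<tau>} w"
      unfolding w_def using \<tau> by (intro Lp_continuous_on_diff Uc Lp_continuous_on_const Lp_continuous_on_Lp[OF Uc]) auto
    have U0: "AE x in M. U 0 x = u 0 x" using Uu[of 0] \<tau> by simp
    \<comment> \<open>Where \<alpha>(x) = 1 the order is 0 and the values at t and 0 themselves must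
      agree; elsewhere agreement of the slices at almost every time, together with the initial
      values, is enough.\<close>
    have RL: "AE x in M. RL_integral (\<lambda>x. 1 - \<alpha> x) w t x = RL_integral (\<lambda>x. 1 - \<alpha> x) (\<lambda>t x. u t x - u 0 x) t x"
      if t: "t \<in> {0..\<tau>}" for t
      using slices Uu[OF t] U0 AE_space
    proof eventually_elim
      case (elim x)
      show ?case
      proof (cases "\<alpha> x = 1")
        case True
        then show ?thesis using elim by (simp add: RL_integral_def w_def)
      next
        case False
        have "AE s in lborel. s \<in> {0..t} \<longrightarrow> u s x - u 0 x = w s x"
          using elim(1) by eventually_elim (use t elim in \<open>auto simp: w_def\<close>)
        then show ?thesis using False
          by (intro RL_integral_cong_AE[symmetric] jointly_measurableD2[OF wm elim(4)]) auto
      qed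
    qed
    have der: "has_Lp_derivative p M (RL_integral (\<lambda>x. 1 - \<alpha> x) w) (F t) t {0..\<tau>}" if t: "t \<in> {0..\<tau>}" for t
    proof -
      obtain G where G: "has_Lp_derivative p M (RL_integral (\<lambda>x. 1 - \<alpha> x) (\<lambda>t x. u t x - u 0 x)) G t {0..\<tau>}"
        "AE x in M. G x = g t (u t) x"
        using u t unfolding is_solution_def has_Caputo_derivative_def has_RL_derivative_def M_def g_def by blast
      have "AE x in M. g t (U t) x = g t (u t) x"
        using t by (intro g_cong_AE Uu Lp_continuous_on_Lp[OF Uc] Lp_continuous_on_Lp[OF uc]) auto
      with Fg[OF t] G(2) have "AE x in M. F t x = G x" by eventually_elim simp
      then show ?thesis
        by (intro has_Lp_derivative_cong_AE[OF G(1) t] RL jointly_measurableD1[OF F]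
            jointly_measurableD1[OF jointly_measurable_RL_integral[OF wm]])
    qed
    have w0: "AE x in M. w 0 x = 0" by (simp add: w_def)
    have u0: "AE x in M. u 0 x = u\<^sub>0 x" using u unfolding is_solution_def M_def by blast
    have "AE x in M. U t x = u\<^sub>0 x + J F t x" if t: "t \<in> {0..\<tau>}" for t
    proof -
      have "AE x in M. w t x = J F t x"
        by (rule J_of_Caputo[OF wm wc w0 F Fc \<tau> _ t]) (rule der)
      then show ?thesis using U0 u0 by eventually_elim (simp add: w_def)
    qed
    then have "mild \<tau> U F" using Uc F Fg by (simp add: mild_def version_def)
    moreover have "\<forall>t\<in>{0..\<tau>}. AE x in M. U t x = u t x" using Uu by blast
    ultimately show ?thesis by blast
  qed
  have unique: "AE x in lebesgue_on \<Omega>. u t x = v t x"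
    if sol: "is_solution p \<Omega> \<alpha> A f u\<^sub>0 {0..\<tau>} u" "is_solution p \<Omega> \<alpha> A f u\<^sub>0 {0..\<tau>} v" "t \<in> {0..\<tau>}" for u v t
  proof -
    obtain U F where U: "mild \<tau> U F" "\<forall>t\<in>{0..\<tau>}. AE x in M. U t x = u t x" using mild_version[OF sol(1)] by blast
    obtain V G where V: "mild \<tau> V G" "\<forall>t\<in>{0..\<tau>}. AE x in M. V t x = v t x" using mild_version[OF sol(2)] by blast
    have "AE x in M. u t x = v t x"
      using bspec[OF U(2) sol(3)] bspec[OF V(2) sol(3)] mild_unique[OF data U(1) V(1) sol(3)]
      by eventually_elim simp
    then show ?thesis unfolding M_def .
  qed
  show ?thesis
    by (intro exI[of _ \<tau>] conjI allI impI ballI \<tau>(1) ex) (rule unique)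
qed

end
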